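(* For every $n\ge1$, the map $\mathcal{R}:\mathfrak{W}_n\to\mathfrak{W}_n$ is a bijection such that for every $w\in\mathfrak{W}_n$ we have $w\sim_{cid}\mathcal{R}(w)$ and $$(w\setminus s)^-\sim_{rid}\mathcal{R}(w)\setminus m,$$ where $s$ and $m$ are the smallest and largest letters of $w$. Moreover, the set of integers occurring in $\mathcal{R}(w)$ equals the set of integers occurring in $w$.
   Context: Partitions are Young diagrams in English notation, box $(i,j)$ in row $i$ from the top and column $j$ from the left. For $\lambda\subseteq\mu$, $\mathrm{Inc}(\mu/\lambda)$ is the set of fillings of $\mu/\lambda$ by positive integers strictly increasing along rows and down columns; $\mathrm{Inc}^{st}(\mu/\lambda)$ is the subset of those whose set of entries is $\{1,\dots,k\}$ for some $k$. $\sigma_n=(n,\dots,1)$; $M_n\in\mathrm{Inc}(\sigma_n)$ has entry $i+j-1$ in box $(i,j)$. Inner corner of $\mu/\lambda$: a box of $\lambda$ with no box of $\lambda$ immediately right of or below it; outer corner: a box not in $\mu$ whose box immediately above and box immediately left are each in $\mu$ or outside the positive quadrant. $\mathrm{jdt}_B(T)$ (for a set $B$ of inner corners): put dots in $B$; for $i=1,2,\dots$, simultaneously replace each dot having an $i$ immediately below or right of it by $i$ and each such $i$ by a dot; delete dots. $\mathrm{rjdt}_C(S)$ (for a set $C$ of outer corners, $k$ the largest entry): put dots in $C$; for $i=k,\dots,1$ simultaneously replace each dot having an $i$ immediately above or left of it by $i$ and each such $i$ by a dot; delete dots. For $T\in\mathrm{Inc}(\lambda)$ (largest entry $k$, $B_i$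 = boxes containing $i$) and $U\in\mathrm{Inc}(\mu/\lambda)$ (largest entry $k'$, $C_i$ = boxes containing $i$): $\mathrm{jdt}_T(U)=U_0$ where $U_k=U$, $U_{i-1}=\mathrm{jdt}_{B_i}(U_i)$; $\mathrm{rjdt}_U(T)=T_{k'+1}$ where $T_1=T$, $T_{i+1}=\mathrm{rjdt}_{C_i}(T_i)$; $\mathrm{infusion}(T,U)=(\mathrm{jdt}_T(U),\mathrm{rjdt}_U(T))$. A tableau $U\in\mathrm{Inc}(\mu/\lambda)$ rectifies to a straight-shape $T$ if $\mathrm{jdt}_S(U)=T$ for some $S\in\mathrm{Inc}(\lambda)$; $\mathrm{Rect}_T(\mu/\lambda)$ is the set of tableaux of shape $\mu/\lambda$ rectifying to $T$. $\mathfrak{W}_n$: words of length $n$ in positive integers; $\mathfrak{W}^{st}_n$: those whose set of letters is $\{1,\dots,k\}$ for some $k$. A word $w\in\mathfrak{W}_n$ is identified with the tableau of shape $\sigma_n/\sigma_{n-1}$ having $w_i$ in box $(n+1-i,i)$, and $(\mathcal{W}(w),\mathcal{M}(w))=\mathrm{infusion}(M_{n-1},w)$. Promotion: for a straight shape $\lambda$ and $W\in\mathrm{Inc}^{st}(\lambda)$ with largest entry $k$, delete the entry $1$ (in box $(1,1)$) and decrement all other entries by $1$, obtaining $W^-$; compute $\mathrm{jdt}_{\{(1,1)\}}(W^-)$, of some straight shape $\rho\subseteq\lambda$, and fill the vacated boxes $\lambda/\rho$ with $k$; the result is $\partial W\in\mathrm{Inc}^{st}(\lambda)$. For $n\ge2$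 the map $f(w)=\mathrm{infusion}(M_{n-1},w)$ is a bijection from $\mathfrak{W}^{st}_n$ onto $\bigcup_{\lambda}\mathrm{Inc}^{st}(\lambda)\times\mathrm{Rect}_{M_{n-1}}(\sigma_n/\lambda)$, and $\mathcal{R}(w):=f^{-1}(\partial\mathcal{W}(w),\mathcal{M}(w))$ for $w\in\mathfrak{W}^{st}_n$. For general $w\in\mathfrak{W}_n$ with distinct letters $v_1<\dots<v_k$, let $\mathrm{st}(w)$ replace each $v_i$ by $i$, and let $\mathcal{R}(w)$ be $\mathcal{R}(\mathrm{st}(w))$ with each $i$ replaced by $v_i$. For $n=1$, $\mathcal{R}$ is the identity. For a word $x$, $\mathrm{lis}(x)$, $\mathrm{lds}(x)$ denote the lengths of longest strictly increasing/decreasing subsequences. $u\sim_{cid}w$ (same length $n$): for all $1\le i\le j\le n$, $\mathrm{lis}$ and $\mathrm{lds}$ of $u_i\cdots u_j$ and $w_i\cdots w_j$ agree. $u\sim_{rid}w$: for every integer interval $[a,b]$, the words obtained from $u$ and $w$ by deleting all letters not in $[a,b]$ have equal $\mathrm{lis}$ and equal $\mathrm{lds}$. For a word $x$ and letter $a$, $x\setminus a$ deletes all occurrences of $a$. If $s=v_1<v_2<\dots<v_k$ are the letters of $w$, $(w\setminus s)^-$ is obtained from $w\setminus s$ by replacing $v_i$ by $v_{i-1}$ for $2\le i\le k$. *)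

theory Defs
  imports Main "HOL-Library.Sublist"
begin

section \<open>Tableaux, slides and infusion\<close>

text \<open>Boxes are pairs (row, column) in English notation, both coordinates counted from 1, so a
  neighbour of a box with a coordinate 0 is never a box of a tableau. A tableau is a partial map
  whose domain is its (skew) shape.\<close>

type_synonym box = "nat \<times> nat"
type_synonym tableau = "box \<Rightarrow> nat option"

fun right_of :: "box \<Rightarrow> box" where "right_of (i, j) = (i, j + 1)"
fun below :: "box \<Rightarrow> box" where "below (i, j) = (i + 1, j)"
fun left_of :: "box \<Rightarrow> box" where "left_of (i, j) = (i, j - 1)"
fun above :: "box \<Rightarrow> box" where "above (i, j) = (i - 1, j)"

definition boxes_with :: "tableau \<Rightarrow> nat \<Rightarrow> box set" where
  "boxes_with T i = {b. T b = Some i}"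

text \<open>The 0 only matters for the empty tableau: the loops below then run over no index.\<close>

definition largest_entry :: "tableau \<Rightarrow> nat" where
  "largest_entry T = Max (insert 0 (ran T))"

datatype cell = Dot | Entry nat

type_synonym dotted_tableau = "box \<Rightarrow> cell option"

definition put_dots :: "box set \<Rightarrow> tableau \<Rightarrow> dotted_tableau" where
  "put_dots B T = (\<lambda>b. if b \<in> B then Some Dot else map_option Entry (T b))"

definition delete_dots :: "dotted_tableau \<Rightarrow> tableau" where
  "delete_dots F = (\<lambda>b. case F b of Some (Entry a) \<Rightarrow> Some a | _ \<Rightarrow> None)"

text \<open>Both branches read the old filling, so all replacements are simultaneous.\<close>

definition jdt_step :: "nat \<Rightarrow> dotted_tableau \<Rightarrow> dotted_tableau" where
  "jdt_step i F = (\<lambda>b.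
     if F b = Some Dot \<and> (F (below b) = Some (Entry i) \<or> F (right_of b) = Some (Entry i))
       then Some (Entry i)
     else if F b = Some (Entry i) \<and> (F (above b) = Some Dot \<or> F (left_of b) = Some Dot)
       then Some Dot
     else F b)"

definition rjdt_step :: "nat \<Rightarrow> dotted_tableau \<Rightarrow> dotted_tableau" where
  "rjdt_step i F = (\<lambda>b.
     if F b = Some Dot \<and> (F (above b) = Some (Entry i) \<or> F (left_of b) = Some (Entry i))
       then Some (Entry i)
     else if F b = Some (Entry i) \<and> (F (below b) = Some Dot \<or> F (right_of b) = Some Dot)
       then Some Dot
     else F b)"

definition jdt :: "box set \<Rightarrow> tableau \<Rightarrow> tableau" where
  "jdt B T = delete_dots (fold jdt_step [1..<largest_entry T + 1] (put_dots B T))"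

definition rjdt :: "box set \<Rightarrow> tableau \<Rightarrow> tableau" where
  "rjdt C S = delete_dots (fold rjdt_step (rev [1..<largest_entry S + 1]) (put_dots C S))"

definition jdt_by :: "tableau \<Rightarrow> tableau \<Rightarrow> tableau" where
  "jdt_by T U = fold (\<lambda>i. jdt (boxes_with T i)) (rev [1..<largest_entry T + 1]) U"

definition rjdt_by :: "tableau \<Rightarrow> tableau \<Rightarrow> tableau" where
  "rjdt_by U T = fold (\<lambda>i. rjdt (boxes_with U i)) [1..<largest_entry U + 1] T"

definition infusion :: "tableau \<Rightarrow> tableau \<Rightarrow> tableau \<times> tableau" where
  "infusion T U = (jdt_by T U, rjdt_by U T)"

definition promotion :: "tableau \<Rightarrow> tableau" where
  "promotion W =
     (let Wm = (\<lambda>b. if b = (1, 1) then None else map_option (\<lambda>a. a - 1) (W b));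
          V = jdt {(1, 1)} Wm
      in (\<lambda>b. if b \<in> dom W - dom V then Some (largest_entry W) else V b))"


section \<open>Words\<close>

definition words :: "nat \<Rightarrow> nat list set" where
  "words n = {w. length w = n \<and> (\<forall>x \<in> set w. 1 \<le> x)}"

definition st_words :: "nat \<Rightarrow> nat list set" where
  "st_words n = {w \<in> words n. \<exists>k. set w = {1..k}}"

text \<open>The tableau \<open>M_n\<close> of staircase shape \<open>(n, \<dots>, 1)\<close>.\<close>

definition M_tab :: "nat \<Rightarrow> tableau" where
  "M_tab n = (\<lambda>(i, j). if 1 \<le> i \<and> 1 \<le> j \<and> i + j \<le> n + 1 then Some (i + j - 1) else None)"

text \<open>A word of length \<open>n\<close> as a tableau on the antidiagonal \<open>i + j = n + 1\<close>; the letter in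
  column \<open>j\<close> is the \<open>j\<close>-th one (list positions start at 0).\<close>

definition word_tab :: "nat list \<Rightarrow> tableau" where
  "word_tab w = (\<lambda>(i, j). if 1 \<le> i \<and> 1 \<le> j \<and> i + j = length w + 1 then Some (w ! (j - 1)) else None)"

definition word_infusion :: "nat list \<Rightarrow> tableau \<times> tableau" where
  "word_infusion w = infusion (M_tab (length w - 1)) (word_tab w)"

definition \<W> :: "nat list \<Rightarrow> tableau" where
  "\<W> w = fst (word_infusion w)"

definition \<M> :: "nat list \<Rightarrow> tableau" where
  "\<M> w = snd (word_infusion w)"

definition R_st :: "nat list \<Rightarrow> nat list" where
  "R_st w = inv_into (st_words (length w)) word_infusion (promotion (\<W> w), \<M> w)"

text \<open>If \<open>v\<^sub>1 < \<dots> < v\<^sub>k\<close> are the distinct letters of \<open>w\<close>, then \<open>letter w i\<close> is \<open>v\<^sub>i\<close> and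
  \<open>rank w\<close> sends \<open>v\<^sub>i\<close> to \<open>i\<close>.\<close>

definition letter :: "nat list \<Rightarrow> nat \<Rightarrow> nat" where
  "letter w i = sorted_list_of_set (set w) ! (i - 1)"

definition rank :: "nat list \<Rightarrow> nat \<Rightarrow> nat" where
  "rank w x = card {y \<in> set w. y \<le> x}"

definition st :: "nat list \<Rightarrow> nat list" where
  "st w = map (rank w) w"

definition \<R> :: "nat list \<Rightarrow> nat list" where
  "\<R> w = (if length w = 1 then w else map (letter w) (R_st (st w)))"

text \<open>\<open>(w \ s)\<^sup>-\<close> for \<open>s = v\<^sub>1\<close>: each \<open>v\<^sub>i\<close> with \<open>i \<ge> 2\<close> becomes \<open>v\<^sub>i\<^sub>-\<^sub>1\<close>. The indices refer to the
  letters of \<open>w\<close>, not to those of \<open>w \ s\<close>.\<close>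

definition remove_min_shift :: "nat list \<Rightarrow> nat list" where
  "remove_min_shift w = map (\<lambda>x. letter w (rank w x - 1)) (removeAll (Min (set w)) w)"


section \<open>Monotone subsequences and the equivalences\<close>

definition lis :: "nat list \<Rightarrow> nat" where
  "lis x = Max (length ` {s. subseq s x \<and> sorted_wrt (<) s})"

definition lds :: "nat list \<Rightarrow> nat" where
  "lds x = Max (length ` {s. subseq s x \<and> sorted_wrt (>) s})"

text \<open>The consecutive subword \<open>u\<^sub>i \<dots> u\<^sub>j\<close>, with positions counted from 1.\<close>

definition factor :: "nat list \<Rightarrow> nat \<Rightarrow> nat \<Rightarrow> nat list" where
  "factor u i j = drop (i - 1) (take j u)"

definition cid :: "nat list \<Rightarrow> nat list \<Rightarrow> bool" (infix "\<sim>cid" 50) where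
  "u \<sim>cid w \<longleftrightarrow> length u = length w \<and>
     (\<forall>i j. 1 \<le> i \<and> i \<le> j \<and> j \<le> length u \<longrightarrow>
        lis (factor u i j) = lis (factor w i j) \<and> lds (factor u i j) = lds (factor w i j))"

definition restrict_letters :: "int \<Rightarrow> int \<Rightarrow> nat list \<Rightarrow> nat list" where
  "restrict_letters a b u = filter (\<lambda>x. int x \<in> {a..b}) u"

definition rid :: "nat list \<Rightarrow> nat list \<Rightarrow> bool" (infix "\<sim>rid" 50) where
  "u \<sim>rid w \<longleftrightarrow>
     (\<forall>a b. lis (restrict_letters a b u) = lis (restrict_letters a b w) \<and>
            lds (restrict_letters a b u) = lds (restrict_letters a b w))"

end

theory Submission
  imports Defs
begin

text \<open>A filling is read as the chain of the diagrams of its entries at most \<open>j\<close>, and infusion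
  becomes a growth diagram \<open>g i j\<close> of diagrams whose unit squares are given by a local rule. For a
  word, the left column is the chain of staircases, the bottom row is the word, the top row is
  \<open>\<W> w\<close> and the right column is \<open>\<M> w\<close>. Three statistics are unchanged by every slide, because
  they are unchanged by every single step of it.

  (1) Lengths of column-increasing sequences with letters in an interval. Promotion is a slide of
  \<open>\<W> w\<close> without its letter 1, so passing from the bottom row of the diagram of \<open>w\<close> to its top row, through
  promotion, and back to the bottom row of the diagram of \<open>\<R> w\<close>, they give the second equivalence.

  (2) Costs of descending paths. They measure the last row of rectifications; together with (1) they
  show that the right column alone determines \<open>lis\<close> of all factors. Since \<open>w\<close> and \<open>\<R> w\<close> have the same
  right column, this gives the first equivalence.

  (3) Existence of certain arrays of boxes. They single out the staircase filling among the straight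
  ones, hence a right column rectifying to it along one chain does so along every other
  chain. So the diagram built from the promoted top row and the same right column has the staircases
  as left column, and its bottom row is a word.

  Decreasing subsequences are treated by reflecting all diagrams in the main diagonal. Every step
  can be undone, so \<open>\<R>\<close> is injective, and therefore bijective on each finite set of words with given
  letters.\<close>

section \<open>Growth squares\<close>

text \<open>Rectifying an increasing tableau, unlike a standard one, may give different results for
  different orders of the slides. That \<open>\<M> w\<close> rectifies to the staircase filling
  along \<open>\<W> w\<close> therefore says nothing yet about the promotion of
  \<open>\<W> w\<close>. If the left column changed together with the top row, the bottom row would
  not fill an antidiagonal, and no word could be read off. This is the obstacle that statistic (3)
  removes. Halfway through a slide the letters need not form an increasing filling. So the
  statistics are defined for arbitrary families of box sets, and each single step is repaired by a
  local exchange. For the first equivalence the word has to be forgotten: increasing subsequences of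
  a factor live on the bottom row, path costs on the right column. Adding antidiagonals before the
  word (\<open>prefixed\<close>) and after it (\<open>completion\<close>) produces a straight shape
  whose row \<open>n\<close> has length \<open>b + 1 - a\<close> minus the \<open>lis\<close> of the
  factor. Both statistics see this row.\<close>

definition diagram :: "box set \<Rightarrow> bool" where
  "diagram A \<longleftrightarrow> finite A \<and> (\<forall>r c. (r, c) \<in> A \<longrightarrow> 1 \<le> r \<and> 1 \<le> c) \<and>
     (\<forall>r c r' c'. (r, c) \<in> A \<longrightarrow> 1 \<le> r' \<longrightarrow> r' \<le> r \<longrightarrow> 1 \<le> c' \<longrightarrow> c' \<le> c \<longrightarrow> (r', c') \<in> A)"

text \<open>One letter of an increasing filling occupies a rook strip: its boxes are corners of
  \<open>B\<close>, hence no two of them share a row or a column.\<close>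

definition strip :: "box set \<Rightarrow> box set \<Rightarrow> bool" where
  "strip A B \<longleftrightarrow> diagram A \<and> diagram B \<and> A \<subseteq> B \<and>
     (\<forall>r c. (r, c) \<in> B - A \<longrightarrow> (r + 1, c) \<notin> B \<and> (r, c + 1) \<notin> B)"

definition addable :: "box set \<Rightarrow> nat \<Rightarrow> nat \<Rightarrow> bool" where
  "addable A r c \<longleftrightarrow> (r = 1 \<or> (r - 1, c) \<in> A) \<and> (c = 1 \<or> (r, c - 1) \<in> A)"

definition maximal :: "box set \<Rightarrow> nat \<Rightarrow> nat \<Rightarrow> bool" where
  "maximal B r c \<longleftrightarrow> (r + 1, c) \<notin> B \<and> (r, c + 1) \<notin> B"

text \<open>For \<open>A \<subseteq> B \<subseteq> D\<close> obtained by adding the boxes of two consecutive letters, \<open>C\<close> is the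
  intermediate diagram after the two letters have been switched. A box of \<open>D - A\<close> that is
  neither forced to be in both of \<open>B\<close>, \<open>C\<close> nor in none of them has no neighbour in \<open>D - A\<close>,
  so it changes its letter.\<close>

definition square :: "box set \<Rightarrow> box set \<Rightarrow> box set \<Rightarrow> box set \<Rightarrow> bool" where
  "square A B C D \<longleftrightarrow> strip A B \<and> strip B D \<and> strip A C \<and> strip C D \<and>
     (\<forall>r c. (r, c) \<in> D - A \<longrightarrow> ((r, c) \<in> C \<longleftrightarrow> addable A r c \<and> \<not> ((r, c) \<in> B \<and> maximal D r c)))"

section \<open>Boxes of diagrams and strips\<close>

lemma diagram_pos: "diagram A \<Longrightarrow> (r, c) \<in> A \<Longrightarrow> 1 \<le> r \<and> 1 \<le> c"
  unfolding diagram_def by blast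

lemma diagram_le:
  "diagram A \<Longrightarrow> (r, c) \<in> A \<Longrightarrow> 1 \<le> r' \<Longrightarrow> r' \<le> r \<Longrightarrow> 1 \<le> c' \<Longrightarrow> c' \<le> c \<Longrightarrow> (r', c') \<in> A"
  unfolding diagram_def by blast

lemma strip_diagram: "strip A B \<Longrightarrow> diagram A" "strip A B \<Longrightarrow> diagram B"
  and strip_subset: "strip A B \<Longrightarrow> A \<subseteq> B"
  unfolding strip_def by blast+

text \<open>The boxes of \<open>B - A\<close> are corners of \<open>B\<close>, so a box with another
  box of \<open>B\<close> weakly south-east of it has to be in \<open>A\<close>.\<close>

lemma strip_less:
  assumes "strip A B" "(r, c) \<in> B" "1 \<le> r'" "r' \<le> r" "1 \<le> c'" "c' \<le> c" "(r', c') \<noteq> (r, c)"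
  shows "(r', c') \<in> A"
proof (rule ccontr)
  assume nA: "(r', c') \<notin> A"
  have B: "diagram B" using assms(1) by (simp add: strip_diagram)
  have "(r', c') \<in> B" using diagram_le[OF B assms(2-6)] .
  then have "(r' + 1, c') \<notin> B" "(r', c' + 1) \<notin> B"
    using nA assms(1) unfolding strip_def by blast+
  moreover have "(r' + 1, c') \<in> B" if "r' < r"
    using diagram_le[OF B assms(2)] that assms by auto
  moreover have "(r', c' + 1) \<in> B" if "c' < c"
    using diagram_le[OF B assms(2)] that assms by auto
  ultimately show False using assms by (metis le_neq_implies_less)
qed

lemma strip_above: "strip A B \<Longrightarrow> (Suc r, c) \<in> B \<Longrightarrow> 1 \<le> r \<Longrightarrow> (r, c) \<in> A"
  using strip_less[of A B "Suc r" c r c] diagram_pos[OF strip_diagram(2), of A B "Suc r" c] by auto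

lemma strip_left: "strip A B \<Longrightarrow> (r, Suc c) \<in> B \<Longrightarrow> 1 \<le> c \<Longrightarrow> (r, c) \<in> A"
  using strip_less[of A B r "Suc c" r c] diagram_pos[OF strip_diagram(2), of A B r "Suc c"] by auto

lemma strip_refl: "diagram A \<Longrightarrow> strip A A"
  unfolding strip_def by auto

lemma strip_addable:
  assumes "strip A B" "(r, c) \<in> B" shows "addable A r c"
proof -
  have "1 \<le> r" "1 \<le> c" using diagram_pos[OF strip_diagram(2)[OF assms(1)] assms(2)] by auto
  then show ?thesis
    using strip_above[OF assms(1), of "r - 1" c] strip_left[OF assms(1), of r "c - 1"] assms(2)
    unfolding addable_def by (cases "r = 1"; cases "c = 1") auto
qed

lemma strip_maximal: "strip A B \<Longrightarrow> (r, c) \<in> B \<Longrightarrow> (r, c) \<notin> A \<Longrightarrow> maximal B r c"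
  unfolding maximal_def strip_def by auto

text \<open>Boxes of \<open>B\<close> and \<open>C\<close> can be added to \<open>A\<close>, and
  boxes of \<open>D\<close> outside \<open>B\<close> or outside \<open>C\<close> are maximal in
  \<open>D\<close>; under these constraints the rule reads the same from both sides. Hence one
  notion of square serves \<open>jdt\<close> and \<open>rjdt\<close>, and growth diagrams can be
  transposed.\<close>

lemma square_sym:
  assumes "square A B C D" shows "square A C B D"
proof -
  have S: "strip A B" "strip B D" "strip A C" "strip C D" using assms unfolding square_def by auto
  have "((r, c) \<in> B) \<longleftrightarrow> addable A r c \<and> \<not> ((r, c) \<in> C \<and> maximal D r c)"
    if "(r, c) \<in> D - A" for r c
  proof -
    have eq: "(r, c) \<in> C \<longleftrightarrow> addable A r c \<and> \<not> ((r, c) \<in> B \<and> maximal D r c)"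
      using that assms unfolding square_def by auto
    have "(r, c) \<in> B \<Longrightarrow> addable A r c" using S(1) strip_addable by blast
    moreover have "(r, c) \<notin> B \<Longrightarrow> maximal D r c" using S(2) that strip_maximal by blast
    moreover have "(r, c) \<notin> C \<Longrightarrow> maximal D r c" using S(4) that strip_maximal by blast
    ultimately show ?thesis using eq by blast
  qed
  then show ?thesis using S unfolding square_def by blast
qed

lemma square_unique:
  assumes "square A B C D" "square A B C' D" shows "C = C'"
proof -
  have sub: "A \<subseteq> C" "C \<subseteq> D" "A \<subseteq> C'" "C' \<subseteq> D" using assms unfolding square_def strip_def by blast+
  have "x \<in> C \<longleftrightarrow> x \<in> C'" if "x \<in> D - A" for x
    using that assms unfolding square_def by (cases x) blast
  then show ?thesis using sub by blast
qed

lemma square_exists: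
  assumes AB: "strip A B" and BD: "strip B D"
  shows "\<exists>C. square A B C D"
proof -
  define C where "C = A \<union> {(r, c). (r, c) \<in> D - A \<and> addable A r c \<and> \<not> ((r, c) \<in> B \<and> maximal D r c)}"
  have dA: "diagram A" and dB: "diagram B" and dD: "diagram D" and sub: "A \<subseteq> B" "B \<subseteq> D"
    using AB BD unfolding strip_def by auto
  have CD: "A \<subseteq> C" "C \<subseteq> D" using sub unfolding C_def by auto
  have add: "addable A r c" if "(r, c) \<in> C" for r c
    using that strip_addable[OF strip_refl[OF dA]] unfolding C_def by auto
  \<comment> \<open>Everything north-west of an addable box is already in \<open>A\<close>, so
    adding such boxes yields a diagram and a strip.\<close>
  have down: "(r', c') \<in> A" if "(r, c) \<in> C" "1 \<le> r'" "r' \<le> r" "1 \<le> c'" "c' \<le> c" "(r', c') \<noteq> (r, c)"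
    for r c r' c'
  proof (cases "r' < r")
    case True
    then have "(r - 1, c) \<in> A" using add[OF that(1)] that(2) unfolding addable_def by auto
    then show ?thesis using diagram_le[OF dA, of "r - 1" c r' c'] that True by auto
  next
    case False
    then have "r' = r" "c' < c" using that by auto
    then have "(r, c - 1) \<in> A" using add[OF that(1)] that(4) unfolding addable_def by auto
    then show ?thesis using diagram_le[OF dA, of r "c - 1" r' c'] that \<open>r' = r\<close> \<open>c' < c\<close> by auto
  qed
  have finC: "finite C" using CD(2) dD finite_subset unfolding diagram_def by auto
  have dC: "diagram C"
    unfolding diagram_def
  proof (intro conjI allI impI)
    fix r c r' c' assume "(r, c) \<in> C" "1 \<le> r'" "r' \<le> r" "1 \<le> c'" "c' \<le> c"
    then show "(r', c') \<in> C" using down[of r c r' c'] CD(1) by (cases "(r', c') = (r, c)") auto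
  next
    fix r c assume "(r, c) \<in> C"
    then show "1 \<le> r" using diagram_pos[OF dD] CD by blast
  next
    fix r c assume "(r, c) \<in> C"
    then show "1 \<le> c" using diagram_pos[OF dD] CD by blast
  qed (rule finC)
  have AC: "strip A C"
    unfolding strip_def
  proof (intro conjI allI impI)
    fix r c assume rc: "(r, c) \<in> C - A"
    then have p: "1 \<le> r" "1 \<le> c" using diagram_pos[OF dC] by auto
    show "(r + 1, c) \<notin> C" using down[of "r + 1" c r c] rc p by auto
    show "(r, c + 1) \<notin> C" using down[of r "c + 1" r c] rc p by auto
  qed (use dA dC CD in auto)
  have CD': "strip C D"
    unfolding strip_def
  proof (intro conjI allI impI)
    fix r c assume rc: "(r, c) \<in> D - C"
    then have nA: "(r, c) \<notin> A" using CD by auto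
    have "maximal D r c"
    proof (cases "(r, c) \<in> B")
      case True
      then have "addable A r c" using strip_addable[OF AB] by auto
      then show ?thesis using rc True unfolding C_def by auto
    next
      case False
      then show ?thesis using strip_maximal[OF BD] rc by auto
    qed
    then show "(r + 1, c) \<notin> D" "(r, c + 1) \<notin> D" unfolding maximal_def by auto
  qed (use dC dD CD in auto)
  have "square A B C D"
    unfolding square_def using AB BD AC CD' unfolding C_def by auto
  then show ?thesis by blast
qed

lemma square_strips:
  assumes "square A B C D"
  shows "strip A B" "strip B D" "strip A C" "strip C D"
  using assms unfolding square_def by auto

text \<open>The box loses its letter to a dot above or to the left: it can be added to
  \<open>B\<close> and to \<open>C\<close> but not to \<open>A\<close>, so the neighbour missing in
  \<open>A\<close> is a dot that receives the letter.\<close>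

lemma square_moved:
  assumes sq: "square A B C D" and x: "(r, c) \<in> D" "(r, c) \<notin> B" "(r, c) \<notin> C"
  shows "(1 < r \<and> (r - 1, c) \<in> B - A \<and> (r - 1, c) \<in> C) \<or> (1 < c \<and> (r, c - 1) \<in> B - A \<and> (r, c - 1) \<in> C)"
proof -
  have S: "strip A B" "strip B D" "strip A C" "strip C D" using assms unfolding square_def by auto
  have A: "(r, c) \<notin> A" using strip_subset[OF S(1)] x by auto
  then have na: "\<not> addable A r c" using sq x unfolding square_def by blast
  have p: "1 \<le> r" "1 \<le> c" using diagram_pos[OF strip_diagram(2)[OF S(2)] x(1)] by auto
  have aC: "addable C r c" "addable B r c" using strip_addable S x by blast+
  then show ?thesis using na p unfolding addable_def by auto
qed

lemma square_nbr_above: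
  assumes sq: "square A B C D" and x: "(r, c) \<in> D" and y: "1 < r" "(r - 1, c) \<notin> A"
  shows "(r - 1, c) \<in> B" "(r - 1, c) \<in> C"
proof -
  have S: "strip B D" "strip C D" using assms unfolding square_def by auto
  show "(r - 1, c) \<in> B" using strip_above[OF S(1), of "r - 1" c] x y by auto
  show "(r - 1, c) \<in> C" using strip_above[OF S(2), of "r - 1" c] x y by auto
qed

lemma square_nbr_left:
  assumes sq: "square A B C D" and x: "(r, c) \<in> D" and y: "1 < c" "(r, c - 1) \<notin> A"
  shows "(r, c - 1) \<in> B" "(r, c - 1) \<in> C"
proof -
  have S: "strip B D" "strip C D" using assms unfolding square_def by auto
  show "(r, c - 1) \<in> B" using strip_left[OF S(1), of r "c - 1"] x y by auto
  show "(r, c - 1) \<in> C" using strip_left[OF S(2), of r "c - 1"] x y by auto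
qed

text \<open>Read backwards: a dot that has received the letter took it from below or from the
  right.\<close>

lemma square_moved_rev:
  assumes sq: "square A B C D" and x: "(r, c) \<in> C" "(r, c) \<notin> A" "(r, c) \<in> B"
  shows "(r + 1, c) \<in> D \<or> (r, c + 1) \<in> D"
proof -
  have "(r, c) \<in> D - A" using sq x unfolding square_def strip_def by blast
  then have "\<not> maximal D r c" using sq x unfolding square_def by blast
  then show ?thesis unfolding maximal_def by auto
qed

lemma square_nonempty:
  assumes "square A B C D" "B \<noteq> D" shows "A \<noteq> C"
proof
  assume "A = C"
  obtain r c where x: "(r, c) \<in> D" "(r, c) \<notin> B"
    using assms unfolding square_def strip_def by auto
  have "(r, c) \<notin> C" using \<open>A = C\<close> x assms(1) unfolding square_def strip_def by blast
  then show False using square_moved[OF assms(1) x] \<open>A = C\<close> by auto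
qed

section \<open>Slides\<close>

definition chain :: "(nat \<Rightarrow> box set) \<Rightarrow> nat \<Rightarrow> bool" where
  "chain s J \<longleftrightarrow> diagram (s 0) \<and> (\<forall>j<J. strip (s j) (s (Suc j)))"

definition layer :: "(nat \<Rightarrow> box set) \<Rightarrow> nat \<Rightarrow> box set" where
  "layer s j = s (Suc j) - s j"

text \<open>The chain \<open>b\<close> is the filling before the slide and \<open>a\<close> the one after it; the boxes of
  \<open>b j - a j\<close> are the dots when \<open>j\<close> letters have been processed.\<close>

definition slide :: "(nat \<Rightarrow> box set) \<Rightarrow> (nat \<Rightarrow> box set) \<Rightarrow> nat \<Rightarrow> bool" where
  "slide a b J \<longleftrightarrow> chain a J \<and> chain b J \<and> (\<forall>j\<le>J. strip (a j) (b j)) \<and>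
     (\<forall>j<J. square (a j) (b j) (a (Suc j)) (b (Suc j)))"

text \<open>The letters after \<open>t\<close> steps of the slide, without the dots. These families
  need not be layers of a chain, which is why the statistics take families of box sets as
  arguments.\<close>

definition mixed :: "(nat \<Rightarrow> box set) \<Rightarrow> (nat \<Rightarrow> box set) \<Rightarrow> nat \<Rightarrow> nat \<Rightarrow> box set" where
  "mixed a b t j = (if j < t then layer a j else layer b j)"

lemma chain_diagram: "chain s J \<Longrightarrow> j \<le> J \<Longrightarrow> diagram (s j)"
  by (cases j) (auto simp: chain_def strip_def)

lemma chain_strip: "chain s J \<Longrightarrow> j < J \<Longrightarrow> strip (s j) (s (Suc j))"
  by (auto simp: chain_def)

lemma chain_mono:
  assumes "chain s J" "i \<le> j" "j \<le> J" shows "s i \<subseteq> s j"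
  using assms(2,3)
proof (induction j rule: dec_induct)
  case (step j)
  then show ?case using chain_strip[OF assms(1), of j] strip_subset by fastforce
qed simp

lemma layer_between:
  assumes "x \<in> s j" "x \<notin> s i" "i \<le> j"
  shows "\<exists>u. i \<le> u \<and> u < j \<and> x \<in> layer s u"
  using assms(3,1)
proof (induction j rule: dec_induct)
  case base
  then show ?case using assms by simp
next
  case (step j)
  then show ?case unfolding layer_def by (cases "x \<in> s j") (auto simp: less_Suc_eq)
qed

lemma slide_chains: "slide a b J \<Longrightarrow> chain a J" "slide a b J \<Longrightarrow> chain b J"
  and slide_strip: "slide a b J \<Longrightarrow> j \<le> J \<Longrightarrow> strip (a j) (b j)"
  and slide_square: "slide a b J \<Longrightarrow> j < J \<Longrightarrow> square (a j) (b j) (a (Suc j)) (b (Suc j))"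
  unfolding slide_def by blast+

lemma mixed_step: "j \<noteq> t \<Longrightarrow> mixed a b (Suc t) j = mixed a b t j"
  unfolding mixed_def by auto

text \<open>The families \<open>mixed a b J\<close> and \<open>layer a\<close> agree only below
  \<open>J\<close>; the premise \<open>cong\<close> says that \<open>P\<close> looks no
  further.\<close>

lemma mixed_induct:
  assumes "\<And>t. t < J \<Longrightarrow> P (mixed a b t) \<longleftrightarrow> P (mixed a b (Suc t))"
    and cong: "\<And>L L'. (\<And>j. j < J \<Longrightarrow> L j = L' j) \<Longrightarrow> P L \<Longrightarrow> P L'"
  shows "P (layer a) \<longleftrightarrow> P (layer b)"
proof -
  have "P (mixed a b 0) \<longleftrightarrow> P (mixed a b t)" if "t \<le> J" for t
    using that by (induction t) (use assms(1) in auto)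
  then have "P (mixed a b 0) \<longleftrightarrow> P (mixed a b J)" by simp
  moreover have "mixed a b 0 = layer b" by (auto simp: mixed_def)
  moreover have "P (mixed a b J) \<longleftrightarrow> P (layer a)"
    using cong[of "mixed a b J" "layer a"] cong[of "layer a" "mixed a b J"] by (auto simp: mixed_def)
  ultimately show ?thesis by simp
qed

section \<open>Increasing subsequences under slides\<close>

text \<open>A triple \<open>(u, r, c)\<close> stands for the letter \<open>u\<close> in box \<open>(r, c)\<close>. It is essential to compare
  columns and not rows: with rows the invariance fails in the middle of a slide.\<close>

definition increasing :: "(nat \<times> nat \<times> nat) set \<Rightarrow> bool" where
  "increasing S \<longleftrightarrow> (\<forall>u r c v r' c'. (u, r, c) \<in> S \<longrightarrow> (v, r', c') \<in> S \<longrightarrow>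
     (u, r, c) = (v, r', c') \<or> (u < v \<and> c < c') \<or> (v < u \<and> c' < c))"

text \<open>The predicate \<open>P\<close> will select an interval of letters. The column bound
  \<open>d\<close> will select a prefix of the word.\<close>

definition has_increasing ::
  "(nat \<Rightarrow> box set) \<Rightarrow> nat \<Rightarrow> (nat \<Rightarrow> bool) \<Rightarrow> nat \<Rightarrow> bool" where
  "has_increasing L d P m \<longleftrightarrow> (\<exists>S. finite S \<and> card S = m \<and> increasing S \<and>
     (\<forall>u r c. (u, r, c) \<in> S \<longrightarrow> P u \<and> (r, c) \<in> L u \<and> c \<le> d))"

lemma increasingD:
  "increasing S \<Longrightarrow> (u, r, c) \<in> S \<Longrightarrow> (v, r', c') \<in> S \<Longrightarrow>
    u = v \<and> r = r' \<and> c = c' \<or> u < v \<and> c < c' \<or> v < u \<and> c' < c"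
  unfolding increasing_def by blast

text \<open>At most one triple of \<open>S\<close> has the letter \<open>t\<close>, the only one
  that moves, so a single replacement suffices. It may carry another letter.\<close>

lemma has_increasing_exchange:
  assumes S: "finite S" "increasing S" "\<And>u r c. (u, r, c) \<in> S \<Longrightarrow> P u \<and> (r, c) \<in> L u \<and> c \<le> d"
    and L: "\<And>u. u \<noteq> t \<Longrightarrow> L' u = L u"
    and ex: "\<And>r c. (t, r, c) \<in> S \<Longrightarrow> \<exists>u' r' c'. P u' \<and> (r', c') \<in> L' u' \<and> c' \<le> d \<and>
      (\<forall>v p q. (v, p, q) \<in> S \<longrightarrow> v \<noteq> t \<longrightarrow> (v < u' \<and> q < c') \<or> (u' < v \<and> c' < q))"
  shows "has_increasing L' d P (card S)"
proof (cases "\<exists>r c. (t, r, c) \<in> S")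
  case False
  then have "P u \<and> (r, c) \<in> L' u \<and> c \<le> d" if "(u, r, c) \<in> S" for u r c
    using S(3)[OF that] L[of u] that by (cases "u = t") auto
  then show ?thesis unfolding has_increasing_def using S(1,2) by (intro exI[of _ S]) blast
next
  case True
  then obtain r c where x: "(t, r, c) \<in> S" by blast
  obtain u' r' c' where y: "P u'" "(r', c') \<in> L' u'" "c' \<le> d"
    "\<And>v p q. (v, p, q) \<in> S \<Longrightarrow> v \<noteq> t \<Longrightarrow> (v < u' \<and> q < c') \<or> (u' < v \<and> c' < q)"
    using ex[OF x] by blast
  have other: "v \<noteq> t" if "(v, p, q) \<in> S - {(t, r, c)}" for v p q
    using increasingD[OF S(2) x, of v p q] that by auto
  define S' where "S' = insert (u', r', c') (S - {(t, r, c)})"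
  have new: "(u', r', c') \<notin> S - {(t, r, c)}"
  proof
    assume a: "(u', r', c') \<in> S - {(t, r, c)}"
    show False using y(4)[OF _ other[OF a]] a by blast
  qed
  have "finite (S - {(t, r, c)})" using S(1) by simp
  then have "card S' = Suc (card (S - {(t, r, c)}))"
    unfolding S'_def using new by (rule card_insert_disjoint)
  also have "\<dots> = card S" using card_Suc_Diff1[OF S(1) x] .
  finally have "card S' = card S" .
  moreover have "increasing S'"
    unfolding increasing_def
  proof (intro allI impI)
    fix w p q w' p' q' assume e: "(w, p, q) \<in> S'" "(w', p', q') \<in> S'"
    have old: "(w < u' \<and> q < c') \<or> (u' < w \<and> c' < q)" if "(w, p, q) \<in> S - {(t, r, c)}" for w p q
      using y(4)[of w p q] other[OF that] that by blast
    consider "(w, p, q) = (u', r', c')" "(w', p', q') = (u', r', c')"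
      | "(w, p, q) = (u', r', c')" "(w', p', q') \<in> S - {(t, r, c)}"
      | "(w, p, q) \<in> S - {(t, r, c)}" "(w', p', q') = (u', r', c')"
      | "(w, p, q) \<in> S" "(w', p', q') \<in> S"
      using e unfolding S'_def by blast
    then show "(w, p, q) = (w', p', q') \<or> w < w' \<and> q < q' \<or> w' < w \<and> q' < q"
    proof cases
      case 2
      then show ?thesis using old[OF 2(2)] by auto
    next
      case 3
      then show ?thesis using old[OF 3(1)] by auto
    next
      case 4
      then show ?thesis using S(2) unfolding increasing_def by blast
    qed auto
  qed
  moreover have "P w \<and> (p, q) \<in> L' w \<and> q \<le> d" if "(w, p, q) \<in> S'" for w p q
  proof (cases "(w, p, q) = (u', r', c')")
    case True
    then show ?thesis using y by auto
  next
    case False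
    then have "(w, p, q) \<in> S - {(t, r, c)}" using that unfolding S'_def by blast
    then show ?thesis using S(3)[of w p q] L[OF other] by fastforce
  qed
  moreover have "finite S'" using S(1) S'_def by simp
  ultimately show ?thesis unfolding has_increasing_def by (intro exI[of _ S']) blast
qed

text \<open>The letter \<open>t\<close> moves up or left. Only a move to the left can hurt, and only
  if a smaller letter \<open>v\<close> of \<open>S\<close> already uses the column entered. Then the
  box above the old one carries a letter strictly between \<open>v\<close> and \<open>t\<close>, and
  this box, in the old column, is the replacement. Convexity of \<open>P\<close> admits its
  letter.\<close>

lemma has_increasing_step1:
  assumes sl: "slide a b J" and t: "t < J"
    and convex: "\<And>u v w. P u \<Longrightarrow> P w \<Longrightarrow> u \<le> v \<Longrightarrow> v \<le> w \<Longrightarrow> P v"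
    and h: "has_increasing (mixed a b t) d P m"
  shows "has_increasing (mixed a b (Suc t)) d P m"
proof -
  obtain S where S: "finite S" "card S = m" "increasing S"
    "\<And>u r c. (u, r, c) \<in> S \<Longrightarrow> P u \<and> (r, c) \<in> mixed a b t u \<and> c \<le> d"
    using h unfolding has_increasing_def by blast
  let ?A = "a t" and ?B = "b t" and ?C = "a (Suc t)" and ?D = "b (Suc t)"
  have sq: "square ?A ?B ?C ?D" using slide_square[OF sl t] .
  have ca: "chain a J" using sl slide_chains by blast
  have dA: "diagram ?A" using chain_diagram[OF ca] t by simp
  have "has_increasing (mixed a b (Suc t)) d P (card S)"
  proof (rule has_increasing_exchange[OF S(1,3,4)])
    fix r c assume x: "(t, r, c) \<in> S"
    then have xD: "(r, c) \<in> ?D" "(r, c) \<notin> ?B" and xd: "P t" "c \<le> d"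
      using S(4)[OF x] by (auto simp: mixed_def layer_def)
    have cmp: "(v < t \<and> q < c) \<or> (t < v \<and> c < q)" if "(v, p, q) \<in> S" "v \<noteq> t" for v p q
      using increasingD[OF S(3) x that(1)] that(2) by auto
    show "\<exists>u' r' c'. P u' \<and> (r', c') \<in> mixed a b (Suc t) u' \<and> c' \<le> d \<and>
      (\<forall>v p q. (v, p, q) \<in> S \<longrightarrow> v \<noteq> t \<longrightarrow> (v < u' \<and> q < c') \<or> (u' < v \<and> c' < q))"
    proof (cases "(r, c) \<in> ?C \<or> (1 < r \<and> (r - 1, c) \<in> ?C - ?A)")
      case True
      have "(r, c) \<notin> ?A" using xD sq square_strips(1) strip_subset by blast
      then obtain r' where "(r', c) \<in> ?C - ?A" using True by blast
      then have "(r', c) \<in> mixed a b (Suc t) t" by (simp add: mixed_def layer_def)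
      then show ?thesis using cmp xd by blast
    next
      case False
      then have left: "1 < c" "(r, c - 1) \<in> ?C - ?A"
        using square_moved[OF sq xD] by auto
      show ?thesis
      proof (cases "\<exists>v p. (v, p, c - 1) \<in> S \<and> v < t")
        case no: False
        have "(r, c - 1) \<in> mixed a b (Suc t) t" using left by (simp add: mixed_def layer_def)
        moreover have "(v < t \<and> q < c - 1) \<or> (t < v \<and> c - 1 < q)" if "(v, p, q) \<in> S" "v \<noteq> t" for v p q
        proof -
          have "q \<noteq> c - 1" if "v < t" using no \<open>(v, p, q) \<in> S\<close> that by blast
          then show ?thesis using cmp[OF that] by linarith
        qed
        ultimately show ?thesis using xd by (meson diff_le_self le_trans)
      next
        case True
        then obtain v p where q: "(v, p, c - 1) \<in> S" "v < t" by blast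
        then have "(p, c - 1) \<in> layer a v" "P v" using S(4)[OF q(1)] by (auto simp: mixed_def)
        then have pq: "(p, c - 1) \<in> a (Suc v)" "(p, c - 1) \<notin> a v" by (auto simp: layer_def)
        have cs: "strip (a v) (a (Suc v))" using chain_strip[OF ca] q t by simp
        have sub: "a (Suc v) \<subseteq> ?A" using chain_mono[OF ca, of "Suc v" t] q t by simp
        have pA: "(p, c - 1) \<in> ?A" using pq(1) sub by blast
        then have pos: "1 \<le> p" "1 \<le> c - 1" using diagram_pos[OF dA, of p "c - 1"] by auto
        \<comment> \<open>Otherwise \<open>(r, c - 1)\<close> would lie weakly above a box of
          \<open>?A\<close> in its column and would not be a dot.\<close>
        have pr: "p < r"
        proof (rule ccontr)
          assume "\<not> p < r"
          then have "(r, c - 1) \<in> ?A"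
            using diagram_le[OF dA pA, of r "c - 1"] pos
              diagram_pos[OF strip_diagram(2)[OF square_strips(2)[OF sq]] xD(1)] by auto
          then show False using left by auto
        qed
        then have "1 < r" using pos by linarith
        \<comment> \<open>If the box above were a dot, the letter would move up as well, and its
          column could be kept.\<close>
        then have yA: "(r - 1, c) \<in> ?A"
          using False square_nbr_above[OF sq xD(1)] by auto
        have "(p, c - 1) \<noteq> (r - 1, c)" "p \<le> r - 1" "c - 1 \<le> c" using left pr by auto
        then have "(r - 1, c) \<notin> a (Suc v)"
          using strip_less[OF cs, of "r - 1" c p "c - 1"] pq(2) pos by blast
        then obtain u where u: "Suc v \<le> u" "u < t" "(r - 1, c) \<in> layer a u"
          using layer_between[of "(r - 1, c)" a t "Suc v"] yA q by auto
        have "P u" using convex[OF \<open>P v\<close> xd(1), of u] u by simp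
        moreover have "(r - 1, c) \<in> mixed a b (Suc t) u" using u by (simp add: mixed_def)
        moreover have "(w < u \<and> q' < c) \<or> (u < w \<and> c < q')" if w: "(w, p', q') \<in> S" "w \<noteq> t" for w p' q'
        proof (cases "w < t")
          case True
          then have "q' < c" using cmp[OF w] by auto
          moreover have "w \<le> v"
            using increasingD[OF S(3) q(1) w(1)] \<open>q' < c\<close> by linarith
          ultimately show ?thesis using u by auto
        next
          case False
          then show ?thesis using cmp[OF w] u by auto
        qed
        ultimately show ?thesis using xd by blast
      qed
    qed
  qed (auto simp: mixed_def less_Suc_eq)
  then show ?thesis using S(2) by simp
qed

text \<open>The mirror image: going back, \<open>t\<close> may enter the next column, where a larger
  letter \<open>v\<close> of \<open>S\<close> may sit. Then the box below carries a letter strictly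
  between \<open>t\<close> and \<open>v\<close>. The letter that goes right enters a box that is a
  dot after step \<open>t\<close>, so the bound on the dots keeps it within the first
  \<open>d\<close> columns.\<close>

lemma has_increasing_step2:
  assumes sl: "slide a b J" and t: "t < J"
    and convex: "\<And>u v w. P u \<Longrightarrow> P w \<Longrightarrow> u \<le> v \<Longrightarrow> v \<le> w \<Longrightarrow> P v"
    and PJ: "\<And>u. P u \<Longrightarrow> u < J"
    and dots: "\<And>r c. (r, c) \<in> b (Suc t) - a (Suc t) \<Longrightarrow> c \<le> d"
    and h: "has_increasing (mixed a b (Suc t)) d P m"
  shows "has_increasing (mixed a b t) d P m"
proof -
  obtain S where S: "finite S" "card S = m" "increasing S"
    "\<And>u r c. (u, r, c) \<in> S \<Longrightarrow> P u \<and> (r, c) \<in> mixed a b (Suc t) u \<and> c \<le> d"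
    using h unfolding has_increasing_def by blast
  let ?A = "a t" and ?B = "b t" and ?C = "a (Suc t)" and ?D = "b (Suc t)"
  have sq: "square ?A ?B ?C ?D" using slide_square[OF sl t] .
  have cb: "chain b J" using sl slide_chains by blast
  have "has_increasing (mixed a b t) d P (card S)"
  proof (rule has_increasing_exchange[OF S(1,3,4)])
    fix r c assume x: "(t, r, c) \<in> S"
    then have xC: "(r, c) \<in> ?C" "(r, c) \<notin> ?A" and xd: "P t" "c \<le> d"
      using S(4)[OF x] by (auto simp: mixed_def layer_def)
    have cmp: "(v < t \<and> q < c) \<or> (t < v \<and> c < q)" if "(v, p, q) \<in> S" "v \<noteq> t" for v p q
      using increasingD[OF S(3) x that(1)] that(2) by auto
    have pos: "1 \<le> r" "1 \<le> c"
      using diagram_pos[OF strip_diagram(2)[OF square_strips(3)[OF sq]] xC(1)] by auto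
    have xD: "(r, c) \<in> ?D" using xC square_strips(4)[OF sq] strip_subset by blast
    show "\<exists>u' r' c'. P u' \<and> (r', c') \<in> mixed a b t u' \<and> c' \<le> d \<and>
      (\<forall>v p q. (v, p, q) \<in> S \<longrightarrow> v \<noteq> t \<longrightarrow> (v < u' \<and> q < c') \<or> (u' < v \<and> c' < q))"
    proof (cases "(r, c) \<notin> ?B \<or> (r + 1, c) \<in> ?D")
      case True
      have "(r, c) \<in> ?B \<Longrightarrow> (r + 1, c) \<notin> ?B"
        using square_strips(1)[OF sq] xC unfolding strip_def by blast
      then obtain r' where "(r', c) \<in> ?D - ?B" using True xD by blast
      then have "(r', c) \<in> mixed a b t t" by (simp add: mixed_def layer_def)
      then show ?thesis using cmp xd by blast
    next
      case False
      then have xB: "(r, c) \<in> ?B" and right: "(r, c + 1) \<in> ?D"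
        using square_moved_rev[OF sq xC] by auto
      have "(r, c + 1) \<notin> ?B" "(r, c + 1) \<notin> ?C"
        using square_strips(1,3)[OF sq] xC xB unfolding strip_def by blast+
      then have rightL: "(r, c + 1) \<in> mixed a b t t" "c + 1 \<le> d"
        using right dots by (auto simp: mixed_def layer_def)
      show ?thesis
      proof (cases "\<exists>v p. (v, p, c + 1) \<in> S \<and> t < v")
        case no: False
        have "(v < t \<and> q < c + 1) \<or> (t < v \<and> c + 1 < q)" if "(v, p, q) \<in> S" "v \<noteq> t" for v p q
        proof -
          have "q \<noteq> c + 1" if "t < v" using no \<open>(v, p, q) \<in> S\<close> that by blast
          then show ?thesis using cmp[OF that] by linarith
        qed
        then show ?thesis using rightL xd by blast
      next
        case True
        then obtain v p where q: "(v, p, c + 1) \<in> S" "t < v" by blast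
        then have "(p, c + 1) \<in> layer b v" "P v" using S(4)[OF q(1)] by (auto simp: mixed_def)
        then have pq: "(p, c + 1) \<in> b (Suc v)" "(p, c + 1) \<notin> b v" and vJ: "v < J"
          using PJ by (auto simp: layer_def)
        have cs: "strip (b v) (b (Suc v))" using chain_strip[OF cb vJ] .
        have sub: "?D \<subseteq> b v" using chain_mono[OF cb, of "Suc t" v] q vJ by simp
        have dv: "diagram (b v)" using chain_diagram[OF cb] vJ by simp
        have p1: "1 \<le> p" using diagram_pos[OF strip_diagram(2)[OF cs] pq(1)] by simp
        have pr: "r < p"
        proof (rule ccontr)
          assume "\<not> r < p"
          then have "(p, c + 1) \<in> b v" using diagram_le[OF dv, of r "c + 1" p "c + 1"] right sub p1 by auto
          then show False using pq by simp
        qed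
        have "(r + 1, c) \<in> b v" using strip_less[OF cs pq(1), of "r + 1" c] pr pos by auto
        moreover have "(r + 1, c) \<notin> ?D" using False by simp
        ultimately obtain u where u: "Suc t \<le> u" "u < v" "(r + 1, c) \<in> layer b u"
          using layer_between[of "(r + 1, c)" b v "Suc t"] q by auto
        have "P u" using convex[OF xd(1) \<open>P v\<close>, of u] u by simp
        moreover have "(r + 1, c) \<in> mixed a b t u" using u by (simp add: mixed_def)
        moreover have "(w < u \<and> q' < c) \<or> (u < w \<and> c < q')" if w: "(w, p', q') \<in> S" "w \<noteq> t" for w p' q'
        proof (cases "t < w")
          case True
          then have "c < q'" using cmp[OF w] by auto
          moreover have "v \<le> w"
            using increasingD[OF S(3) q(1) w(1)] \<open>c < q'\<close> by linarith
          ultimately show ?thesis using u by auto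
        next
          case False
          then show ?thesis using cmp[OF w] u w by auto
        qed
        ultimately show ?thesis using xd by blast
      qed
    qed
  qed (auto simp: mixed_def less_Suc_eq)
  then show ?thesis using S(2) by simp
qed

lemma slide_has_increasing:
  assumes sl: "slide a b J"
    and convex: "\<And>u v w. P u \<Longrightarrow> P w \<Longrightarrow> u \<le> v \<Longrightarrow> v \<le> w \<Longrightarrow> P v"
    and PJ: "\<And>u. P u \<Longrightarrow> u < J"
    and dots: "\<And>j r c. j \<le> J \<Longrightarrow> (r, c) \<in> b j - a j \<Longrightarrow> c \<le> d"
  shows "has_increasing (layer a) d P m \<longleftrightarrow> has_increasing (layer b) d P m"
proof (rule mixed_induct[where J = J and P = "\<lambda>L. has_increasing L d P m"])
  fix t assume t: "t < J"
  have d: "\<And>r c. (r, c) \<in> b (Suc t) - a (Suc t) \<Longrightarrow> c \<le> d" using dots[of "Suc t"] t by simp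
  show "has_increasing (mixed a b t) d P m \<longleftrightarrow> has_increasing (mixed a b (Suc t)) d P m"
  proof
    assume h: "has_increasing (mixed a b t) d P m"
    show "has_increasing (mixed a b (Suc t)) d P m"
      by (rule has_increasing_step1[OF sl t _ h]) (fact convex)
  next
    assume h: "has_increasing (mixed a b (Suc t)) d P m"
    show "has_increasing (mixed a b t) d P m"
      by (rule has_increasing_step2[OF sl t _ _ _ h]) (fact convex PJ d)+
  qed
next
  fix L L' :: "nat \<Rightarrow> box set"
  assume "\<And>j. j < J \<Longrightarrow> L j = L' j" "has_increasing L d P m"
  then show "has_increasing L' d P m"
    unfolding has_increasing_def by (metis PJ)
qed

section \<open>Descending paths under slides\<close>

text \<open>A path descends through the rows \<open>1, \<dots>, n\<close> as the letters increase; it pays for a letter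
  that occurs in its row unless it leaves the row at that letter. For a straight tableau the
  cheapest path is the last row, so the last row length of a rectification is an invariant.\<close>

definition is_path :: "nat \<Rightarrow> nat \<Rightarrow> nat \<Rightarrow> (nat \<Rightarrow> nat) \<Rightarrow> bool" where
  "is_path n p q \<rho> \<longleftrightarrow> (\<forall>u. p \<le> u \<longrightarrow> u < q \<longrightarrow> \<rho> u \<le> \<rho> (Suc u)) \<and>
     (\<forall>u. p \<le> u \<longrightarrow> u \<le> q \<longrightarrow> 1 \<le> \<rho> u \<and> \<rho> u \<le> n)"

definition paid :: "(nat \<Rightarrow> box set) \<Rightarrow> nat \<Rightarrow> nat \<Rightarrow> (nat \<Rightarrow> nat) \<Rightarrow> nat set" where
  "paid L p q \<rho> = {u. p \<le> u \<and> u < q \<and> \<rho> (Suc u) = \<rho> u \<and> (\<exists>c. (\<rho> u, c) \<in> L u)}"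

definition has_path :: "(nat \<Rightarrow> box set) \<Rightarrow> nat \<Rightarrow> nat \<Rightarrow> nat \<Rightarrow> nat \<Rightarrow> bool" where
  "has_path L n p q m \<longleftrightarrow> (\<exists>\<rho>. is_path n p q \<rho> \<and> card (paid L p q \<rho>) \<le> m)"

section \<open>Row lengths of diagrams\<close>

definition row_length :: "box set \<Rightarrow> nat \<Rightarrow> nat" where
  "row_length A r = card {c. (r, c) \<in> A}"

lemma row_length_iff:
  assumes "diagram A"
  shows "(r, c) \<in> A \<longleftrightarrow> 1 \<le> r \<and> 1 \<le> c \<and> c \<le> row_length A r"
proof -
  have fin: "finite {c. (r, c) \<in> A}"
  proof (rule finite_subset)
    show "{c. (r, c) \<in> A} \<subseteq> snd ` A" by force
    show "finite (snd ` A)" using assms unfolding diagram_def by simp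
  qed
  have down: "{1..c} \<subseteq> {c. (r, c) \<in> A}" if "(r, c) \<in> A" for c
    using that diagram_le[OF assms that] diagram_pos[OF assms that] by auto
  show ?thesis
  proof
    assume a: "(r, c) \<in> A"
    have "card {1..c} \<le> row_length A r" unfolding row_length_def using card_mono[OF fin down[OF a]] .
    then show "1 \<le> r \<and> 1 \<le> c \<and> c \<le> row_length A r" using diagram_pos[OF assms a] by simp
  next
    assume a: "1 \<le> r \<and> 1 \<le> c \<and> c \<le> row_length A r"
    show "(r, c) \<in> A"
    proof (rule ccontr)
      assume n: "(r, c) \<notin> A"
      have "c' \<in> {1..<c}" if "(r, c') \<in> A" for c'
      proof -
        have "\<not> c \<le> c'" using n diagram_le[OF assms that, of r c] a by auto
        then show ?thesis using diagram_pos[OF assms that] by auto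
      qed
      then have "{c. (r, c) \<in> A} \<subseteq> {1..<c}" by blast
      from card_mono[OF _ this] have "row_length A r \<le> c - 1" unfolding row_length_def by simp
      then show False using a by linarith
    qed
  qed
qed

lemma row_length_eqI:
  assumes "diagram A" "1 \<le> r" "(r, c + 1) \<notin> A" "c = 0 \<or> (r, c) \<in> A"
  shows "row_length A r = c"
proof (rule antisym)
  show "row_length A r \<le> c"
    using assms(2,3) row_length_iff[OF assms(1), of r "c + 1"] by (metis Suc_eq_plus1 Suc_leI le_add2 not_less)
  show "c \<le> row_length A r"
    using assms(4) row_length_iff[OF assms(1), of r c] by blast
qed

lemma row_length_antimono:
  assumes "diagram A" "1 \<le> r" "r \<le> r'" shows "row_length A r' \<le> row_length A r"
proof (cases "row_length A r' = 0")
  case False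
  then have "(r', row_length A r') \<in> A" using row_length_iff[OF assms(1)] assms by simp
  then have "(r, row_length A r') \<in> A" using diagram_le[OF assms(1)] assms False by simp
  then show ?thesis using row_length_iff[OF assms(1)] by simp
qed simp

text \<open>This interlacing lets a path be moved to a neighbouring row at the price of a delay of
  one letter.\<close>

lemma strip_row_length:
  assumes "strip A B" "1 \<le> r" shows "row_length B (Suc r) \<le> row_length A r"
proof (cases "row_length B (Suc r) = 0")
  case False
  then have "(Suc r, row_length B (Suc r)) \<in> B"
    using row_length_iff[OF strip_diagram(2)[OF assms(1)]] by simp
  then have "(r, row_length B (Suc r)) \<in> A" using strip_above[OF assms(1)] assms(2) by simp
  then show ?thesis using row_length_iff[OF strip_diagram(1)[OF assms(1)]] by simp
qed simp

lemma strip_row_length_Suc: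
  assumes S: "strip A B" and r: "1 \<le> r"
  shows "row_length B r = row_length A r + (if \<exists>c. (r, c) \<in> B - A then 1 else 0)"
proof -
  have A: "diagram A" and B: "diagram B" and sub: "A \<subseteq> B" using S unfolding strip_def by auto
  have le: "row_length A r \<le> row_length B r"
  proof (cases "row_length A r = 0")
    case False
    then have "(r, row_length A r) \<in> A" using row_length_iff[OF A] r by simp
    then show ?thesis using sub row_length_iff[OF B] by blast
  qed simp
  have le2: "row_length B r \<le> row_length A r + 1"
  proof (rule ccontr)
    assume "\<not> ?thesis"
    then have "(r, Suc (Suc (row_length A r))) \<in> B" using row_length_iff[OF B] r by simp
    then have "(r, Suc (row_length A r)) \<in> A" using strip_left[OF S] by simp
    then show False using row_length_iff[OF A] by simp
  qed
  have "(\<exists>c. (r, c) \<in> B - A) \<longleftrightarrow> row_length A r < row_length B r"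
  proof
    assume "\<exists>c. (r, c) \<in> B - A"
    then show "row_length A r < row_length B r"
      using row_length_iff[OF A, of r] row_length_iff[OF B, of r] by fastforce
  next
    assume "row_length A r < row_length B r"
    then have "(r, row_length B r) \<in> B - A"
      using row_length_iff[OF A, of r] row_length_iff[OF B, of r] r by auto
    then show "\<exists>c. (r, c) \<in> B - A" by blast
  qed
  then show ?thesis using le le2 by auto
qed

lemma card_row_layers:
  assumes ch: "chain s J" and r: "1 \<le> r" and "i \<le> j" "j \<le> J"
  shows "row_length (s j) r = row_length (s i) r + card {u. i \<le> u \<and> u < j \<and> (\<exists>c. (r, c) \<in> layer s u)}"
  using assms(3,4)
proof (induction j rule: dec_induct)
  case base
  then show ?case by (simp add: not_less[symmetric] cong: conj_cong)
next
  case (step j)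
  let ?S = "\<lambda>j. {u. i \<le> u \<and> u < j \<and> (\<exists>c. (r, c) \<in> layer s u)}"
  have "?S (Suc j) = (if \<exists>c. (r, c) \<in> layer s j then insert j (?S j) else ?S j)"
    using step by (auto simp: less_Suc_eq)
  moreover have "finite (?S j)" by (rule finite_subset[of _ "{..<j}"]) auto
  ultimately have "card (?S (Suc j)) = card (?S j) + (if \<exists>c. (r, c) \<in> layer s j then 1 else 0)"
    by auto
  moreover have "row_length (s (Suc j)) r = row_length (s j) r + (if \<exists>c. (r, c) \<in> layer s j then 1 else 0)"
    using strip_row_length_Suc[OF chain_strip[OF ch] r, of j] step unfolding layer_def by simp
  ultimately show ?case using step by simp
qed

lemma is_path_mono:
  assumes "is_path n p q \<rho>" "p \<le> u" "u \<le> v" "v \<le> q" shows "\<rho> u \<le> \<rho> v"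
  using assms(3,4)
proof (induction v rule: dec_induct)
  case (step v)
  then show ?case using assms(1,2) unfolding is_path_def by (meson Suc_leD Suc_le_lessD le_trans)
qed simp

lemma finite_paid: "finite (paid L p q \<rho>)"
  by (rule finite_subset[of _ "{..<q}"]) (auto simp: paid_def)

text \<open>Bookkeeping for rerouted paths: \<open>X\<close> collects the payments away from the
  rerouted stretch, \<open>Y\<close> and \<open>Y'\<close> those of the old and the new path along
  it.\<close>

lemma card_exchange:
  assumes "finite N" "N' \<subseteq> X \<union> Y'" "X \<union> Y \<subseteq> N" "X \<inter> Y = {}" "finite Y'" "card Y' \<le> card Y"
  shows "card N' \<le> card (N :: nat set)"
proof -
  have fin: "finite X" "finite Y" using assms finite_subset by auto
  have "card N' \<le> card (X \<union> Y')" using card_mono[of "X \<union> Y'" N'] fin assms by auto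
  also have "\<dots> \<le> card X + card Y'" by (rule card_Un_le)
  also have "\<dots> \<le> card X + card Y" using assms by simp
  also have "\<dots> = card (X \<union> Y)" using card_Un_disjoint[OF fin assms(4)] by simp
  also have "\<dots> \<le> card N" using card_mono[OF assms(1,3)] .
  finally show ?thesis .
qed

text \<open>A path becomes dearer only if \<open>t\<close> has moved up into its row
  \<open>e\<close> and the path stays there at \<open>t\<close>. Then rows \<open>e\<close> and
  \<open>e + 1\<close> of \<open>b (Suc t)\<close> have equal length. The path is rerouted to drop
  to row \<open>e + 1\<close> at \<open>t\<close>, which is thereby free; afterwards it pays for the
  growth of row \<open>e + 1\<close> instead of row \<open>e\<close>, and by interlacing this is no
  more.\<close>

lemma has_path_step1:
  assumes sl: "slide a b J" and t: "t < J" and q: "q \<le> J" and rows: "\<And>r c. (r, c) \<in> b J \<Longrightarrow> r \<le> n"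
    and h: "has_path (mixed a b t) n p q m"
  shows "has_path (mixed a b (Suc t)) n p q m"
proof -
  let ?A = "a t" and ?B = "b t" and ?C = "a (Suc t)" and ?D = "b (Suc t)"
  let ?L = "mixed a b t" and ?L' = "mixed a b (Suc t)"
  obtain \<rho> where \<rho>: "is_path n p q \<rho>" "card (paid ?L p q \<rho>) \<le> m" using h unfolding has_path_def by blast
  have sq: "square ?A ?B ?C ?D" using slide_square[OF sl t] .
  note S = square_strips[OF sq]
  have cb: "chain b J" using sl slide_chains by blast
  show ?thesis
  proof (cases "paid ?L' p q \<rho> \<subseteq> paid ?L p q \<rho>")
    case True
    then have "card (paid ?L' p q \<rho>) \<le> m" using card_mono[OF finite_paid True] \<rho>(2) by simp
    then show ?thesis using \<rho>(1) unfolding has_path_def by blast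
  next
    case False
    define e where "e = \<rho> t"
    have new: "p \<le> t" "t < q" "\<rho> (Suc t) = e" "\<exists>c. (e, c) \<in> ?C - ?A" "\<not> (\<exists>c. (e, c) \<in> ?D - ?B)"
    proof -
      obtain u where u: "u \<in> paid ?L' p q \<rho>" "u \<notin> paid ?L p q \<rho>" using False by blast
      have "u = t" using u mixed_step[of u t a b] unfolding paid_def by force
      then show "p \<le> t" "t < q" "\<rho> (Suc t) = e" "\<exists>c. (e, c) \<in> ?C - ?A" "\<not> (\<exists>c. (e, c) \<in> ?D - ?B)"
        using u unfolding paid_def e_def mixed_def layer_def by auto
    qed
    then obtain c where c: "(e, c) \<in> ?C" "(e, c) \<notin> ?A" by blast
    have cD: "(e, c) \<in> ?D" using c S(4) strip_subset by blast
    then have cB: "(e, c) \<in> ?B" using new(5) by blast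
    have pos: "1 \<le> e" "1 \<le> c" using diagram_pos[OF strip_diagram(2)[OF S(3)] c(1)] by auto
    have "(e, c + 1) \<notin> ?B" using S(1) cB c(2) unfolding strip_def by blast
    then have right: "(e, c + 1) \<notin> ?D" using new(5) by blast
    then have below: "(e + 1, c) \<in> ?D" using square_moved_rev[OF sq c cB] by blast
    have dD: "diagram ?D" using strip_diagram(2)[OF S(2)] .
    have "?D \<subseteq> b J" using chain_mono[OF cb, of "Suc t" J] t by simp
    then have en: "e + 1 \<le> n" using rows below by blast
    have rl: "row_length ?D e = c" "row_length ?D (e + 1) = c"
    proof -
      show "row_length ?D e = c" using row_length_eqI[OF dD pos(1) right] cD by simp
      have "(e + 1, c + 1) \<notin> ?D" using right diagram_le[OF dD, of "e + 1" "c + 1" e "c + 1"] pos by auto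
      then show "row_length ?D (e + 1) = c" using row_length_eqI[OF dD, of "e + 1" c] below by simp
    qed
    define \<rho>' where "\<rho>' s = (if t < s then max (\<rho> s) (e + 1) else \<rho> s)" for s
    define t1 where "t1 = Max {s. t < s \<and> s \<le> q \<and> \<rho> s = e}"
    have fin: "finite {s. t < s \<and> s \<le> q \<and> \<rho> s = e}" by simp
    have t1: "t < t1" "t1 \<le> q" "\<rho> t1 = e"
    proof -
      have "Suc t \<in> {s. t < s \<and> s \<le> q \<and> \<rho> s = e}" using new by simp
      then have "t1 \<in> {s. t < s \<and> s \<le> q \<and> \<rho> s = e}"
        unfolding t1_def using Max_in[OF fin] by blast
      then show "t < t1" "t1 \<le> q" "\<rho> t1 = e" by auto
    qed
    have t1max: "s \<le> t1" if "t < s" "s \<le> q" "\<rho> s = e" for s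
      using Max_ge[OF fin] that unfolding t1_def by auto
    have \<rho>e: "e \<le> \<rho> s" if "t \<le> s" "s \<le> q" for s
      using is_path_mono[OF \<rho>(1) new(1), of s] that e_def by simp
    have const: "\<rho> s = e" if "t \<le> s" "s \<le> t1" for s
      using \<rho>e[of s] is_path_mono[OF \<rho>(1), of s t1] that t1 new(1) by simp
    have path': "is_path n p q \<rho>'"
      unfolding is_path_def
    proof (intro conjI allI impI)
      fix u assume u: "p \<le> u" "u < q"
      then have "\<rho> u \<le> \<rho> (Suc u)" using \<rho>(1) unfolding is_path_def by blast
      then show "\<rho>' u \<le> \<rho>' (Suc u)" unfolding \<rho>'_def by auto
    next
      fix u assume u: "p \<le> u" "u \<le> q"
      then have "1 \<le> \<rho> u \<and> \<rho> u \<le> n" using \<rho>(1) unfolding is_path_def by blast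
      then show "1 \<le> \<rho>' u" "\<rho>' u \<le> n" using en unfolding \<rho>'_def by auto
    qed
    \<comment> \<open>At the letter \<open>t1\<close> the old path leaves row \<open>e\<close> free
      of charge, while the new one may still pay in row \<open>e + 1\<close>. So its stretch is one
      letter longer, unless the path ends at \<open>t1\<close>.\<close>
    define t2 where "t2 = (if t1 < q then Suc t1 else q)"
    define X where "X = {u \<in> paid ?L p q \<rho>. u < t \<or> t1 < u}"
    define Y where "Y = {u. Suc t \<le> u \<and> u < t1 \<and> (\<exists>c. (e, c) \<in> layer b u)}"
    define Y' where "Y' = {u. Suc t \<le> u \<and> u < t2 \<and> (\<exists>c. (e + 1, c) \<in> layer b u)}"
    have "card (paid ?L' p q \<rho>') \<le> card (paid ?L p q \<rho>)"
    proof (rule card_exchange[OF finite_paid])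
      show "paid ?L' p q \<rho>' \<subseteq> X \<union> Y'"
      proof
        fix u assume u: "u \<in> paid ?L' p q \<rho>'"
        then have uq: "p \<le> u" "u < q" "\<rho>' (Suc u) = \<rho>' u" "\<exists>c. (\<rho>' u, c) \<in> ?L' u"
          unfolding paid_def by auto
        consider "u < t" | "u = t" | "t < u" "u \<le> t1" | "t1 < u" by linarith
        then show "u \<in> X \<union> Y'"
        proof cases
          case 1
          then show ?thesis using uq unfolding X_def paid_def \<rho>'_def mixed_def by auto
        next
          case 2
          then show ?thesis using uq new(3) unfolding \<rho>'_def e_def by auto
        next
          case 3
          then have "\<rho>' u = e + 1" using const[of u] unfolding \<rho>'_def by simp
          moreover have "u < t2" using 3 uq unfolding t2_def by auto
          ultimately show ?thesis using uq 3 unfolding Y'_def mixed_def by auto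
        next
          case 4
          have "e < \<rho> s" if "u \<le> s" "s \<le> q" for s
          proof -
            have "t < s" "t \<le> s" using that 4 t1 by auto
            then have "e \<le> \<rho> s" "\<rho> s \<noteq> e" using \<rho>e[of s] t1max[of s] that 4 by auto
            then show ?thesis by simp
          qed
          from this[of u] this[of "Suc u"] have "e + 1 \<le> \<rho> u" "e + 1 \<le> \<rho> (Suc u)" using uq by auto
          then have "\<rho>' u = \<rho> u" "\<rho>' (Suc u) = \<rho> (Suc u)"
            unfolding \<rho>'_def by (simp_all add: max_absorb1)
          then show ?thesis using uq 4 t1 unfolding X_def paid_def mixed_def by auto
        qed
      qed
      show "X \<union> Y \<subseteq> paid ?L p q \<rho>"
      proof -
        have "u \<in> paid ?L p q \<rho>" if "u \<in> Y" for u
          using that new(1) t1(2) const[of u] const[of "Suc u"] unfolding Y_def paid_def mixed_def by auto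
        then show ?thesis unfolding X_def by blast
      qed
      show "X \<inter> Y = {}" unfolding X_def Y_def by auto
      show "finite Y'" by (rule finite_subset[of _ "{..<t2}"]) (auto simp: Y'_def)
      have t2: "Suc t \<le> t2" "t2 \<le> q" using t1 unfolding t2_def by auto
      have "row_length (b t2) (e + 1) = c + card Y'"
        using card_row_layers[OF cb _ t2(1), of "e + 1"] t2 q rl unfolding Y'_def by simp
      moreover have "row_length (b t1) e = c + card Y"
        using card_row_layers[OF cb pos(1), of "Suc t" t1] t1 q rl unfolding Y_def by simp
      moreover have "row_length (b t2) (e + 1) \<le> row_length (b t1) e"
      proof (cases "t1 < q")
        case True
        then show ?thesis using strip_row_length[OF chain_strip[OF cb] pos(1), of t1] q
          unfolding t2_def by simp
      next
        case False
        then have "t2 = t1" using t1 unfolding t2_def by simp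
        then show ?thesis using row_length_antimono[OF chain_diagram[OF cb] pos(1)] t1 q by simp
      qed
      ultimately show "card Y' \<le> card Y" by simp
    qed
    then show ?thesis using path' \<rho>(2) unfolding has_path_def by (meson le_trans)
  qed
qed

text \<open>Backwards, \<open>t\<close> returns from row \<open>r - 1\<close> to the row
  \<open>r\<close> of the path. Then rows \<open>r - 1\<close> and \<open>r\<close> of
  \<open>a t\<close> have equal length. The path is delayed: it enters row \<open>r\<close> only at
  \<open>t\<close>, which is thereby free, and pays in row \<open>r - 1\<close> where it used to pay
  in row \<open>r\<close>.\<close>

lemma has_path_step2:
  assumes sl: "slide a b J" and t: "t < J" and q: "q \<le> J"
    and h: "has_path (mixed a b (Suc t)) n p q m"
  shows "has_path (mixed a b t) n p q m"
proof -
  let ?A = "a t" and ?B = "b t" and ?C = "a (Suc t)" and ?D = "b (Suc t)"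
  let ?L = "mixed a b (Suc t)" and ?L' = "mixed a b t"
  obtain \<rho> where \<rho>: "is_path n p q \<rho>" "card (paid ?L p q \<rho>) \<le> m" using h unfolding has_path_def by blast
  have sq: "square ?A ?B ?C ?D" using slide_square[OF sl t] .
  note S = square_strips[OF sq]
  have ca: "chain a J" using sl slide_chains by blast
  show ?thesis
  proof (cases "paid ?L' p q \<rho> \<subseteq> paid ?L p q \<rho>")
    case True
    then have "card (paid ?L' p q \<rho>) \<le> m" using card_mono[OF finite_paid True] \<rho>(2) by simp
    then show ?thesis using \<rho>(1) unfolding has_path_def by blast
  next
    case False
    define r where "r = \<rho> t"
    have new: "p \<le> t" "t < q" "\<rho> (Suc t) = r" "\<exists>c. (r, c) \<in> ?D - ?B" "\<not> (\<exists>c. (r, c) \<in> ?C - ?A)"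
    proof -
      obtain u where u: "u \<in> paid ?L' p q \<rho>" "u \<notin> paid ?L p q \<rho>" using False by blast
      have "u = t" using u mixed_step[of u t a b] unfolding paid_def by force
      then show "p \<le> t" "t < q" "\<rho> (Suc t) = r" "\<exists>c. (r, c) \<in> ?D - ?B" "\<not> (\<exists>c. (r, c) \<in> ?C - ?A)"
        using u unfolding paid_def r_def mixed_def layer_def by auto
    qed
    then obtain c where c: "(r, c) \<in> ?D" "(r, c) \<notin> ?B" by blast
    have cA: "(r, c) \<notin> ?A" using c S(1) strip_subset by blast
    then have cC: "(r, c) \<notin> ?C" using new(5) by blast
    have above: "1 < r" "(r - 1, c) \<in> ?B" "(r - 1, c) \<notin> ?A"
      using square_moved[OF sq c cC] new(5) by auto
    have pos: "1 \<le> c" using diagram_pos[OF strip_diagram(2)[OF S(2)] c(1)] by simp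
    have dA: "diagram ?A" using strip_diagram(1)[OF S(1)] .
    have left: "c = 1 \<or> (r, c - 1) \<in> ?A"
      using square_nbr_left[OF sq c(1)] new(5) pos by fastforce
    have rl: "row_length ?A r = c - 1" "row_length ?A (r - 1) = c - 1"
    proof -
      show "row_length ?A r = c - 1" using row_length_eqI[OF dA, of r "c - 1"] left cA pos above by auto
      have "c = 1 \<or> (r - 1, c - 1) \<in> ?A"
        using strip_left[OF S(1), of "r - 1" "c - 1"] above pos by (cases "c = 1") auto
      then show "row_length ?A (r - 1) = c - 1"
        using row_length_eqI[OF dA, of "r - 1" "c - 1"] above pos by auto
    qed
    define \<rho>' where "\<rho>' s = (if s \<le> t then min (\<rho> s) (r - 1) else \<rho> s)" for s
    define t0 where "t0 = Min {s. p \<le> s \<and> s \<le> t \<and> \<rho> s = r}"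
    have fin: "finite {s. p \<le> s \<and> s \<le> t \<and> \<rho> s = r}" by simp
    have t0: "p \<le> t0" "t0 \<le> t" "\<rho> t0 = r"
    proof -
      have "t \<in> {s. p \<le> s \<and> s \<le> t \<and> \<rho> s = r}" using new r_def by simp
      then have "t0 \<in> {s. p \<le> s \<and> s \<le> t \<and> \<rho> s = r}"
        unfolding t0_def using Min_in[OF fin] by blast
      then show "p \<le> t0" "t0 \<le> t" "\<rho> t0 = r" by auto
    qed
    have t0min: "t0 \<le> s" if "p \<le> s" "s \<le> t" "\<rho> s = r" for s
      using Min_le[OF fin] that unfolding t0_def by auto
    have \<rho>r: "\<rho> s \<le> r" if "p \<le> s" "s \<le> t" for s
      using is_path_mono[OF \<rho>(1), of s t] that new r_def by simp
    have const: "\<rho> s = r" if "t0 \<le> s" "s \<le> t" for s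
      using \<rho>r[of s] is_path_mono[OF \<rho>(1), of t0 s] that t0 new by simp
    have path': "is_path n p q \<rho>'"
      unfolding is_path_def
    proof (intro conjI allI impI)
      fix u assume u: "p \<le> u" "u < q"
      then have "\<rho> u \<le> \<rho> (Suc u)" using \<rho>(1) unfolding is_path_def by blast
      then show "\<rho>' u \<le> \<rho>' (Suc u)" unfolding \<rho>'_def by auto
    next
      fix u assume u: "p \<le> u" "u \<le> q"
      then have "1 \<le> \<rho> u \<and> \<rho> u \<le> n" using \<rho>(1) unfolding is_path_def by blast
      then show "1 \<le> \<rho>' u" "\<rho>' u \<le> n" using above unfolding \<rho>'_def by auto
    qed
    \<comment> \<open>The old path enters row \<open>r\<close> at the letter \<open>t0 - 1\<close>
      free of charge; the new one may already pay in row \<open>r - 1\<close> for that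
      letter.\<close>
    define t2 where "t2 = (if p < t0 then t0 - 1 else p)"
    define X where "X = {u \<in> paid ?L p q \<rho>. u < t2 \<or> t < u}"
    define Y where "Y = {u. t0 \<le> u \<and> u < t \<and> (\<exists>c. (r, c) \<in> layer a u)}"
    define Y' where "Y' = {u. t2 \<le> u \<and> u < t \<and> (\<exists>c. (r - 1, c) \<in> layer a u)}"
    have t2: "p \<le> t2" "t2 \<le> t0" "t2 \<le> t" using t0 unfolding t2_def by auto
    have "card (paid ?L' p q \<rho>') \<le> card (paid ?L p q \<rho>)"
    proof (rule card_exchange[OF finite_paid])
      show "paid ?L' p q \<rho>' \<subseteq> X \<union> Y'"
      proof
        fix u assume u: "u \<in> paid ?L' p q \<rho>'"
        then have uq: "p \<le> u" "u < q" "\<rho>' (Suc u) = \<rho>' u" "\<exists>c. (\<rho>' u, c) \<in> ?L' u"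
          unfolding paid_def by auto
        consider "u < t2" | "t2 \<le> u" "u < t" | "u = t" | "t < u" by linarith
        then show "u \<in> X \<union> Y'"
        proof cases
          case 1
          then have ut: "Suc u < t0" using uq unfolding t2_def by (auto split: if_splits)
          have "\<rho> s < r" if "p \<le> s" "s < t0" for s
          proof -
            have "s \<le> t" using that t0 by simp
            then have "\<rho> s \<le> r" "\<rho> s \<noteq> r" using \<rho>r[of s] t0min[of s] that by auto
            then show ?thesis by simp
          qed
          then have "\<rho> u < r" "\<rho> (Suc u) < r" using ut uq by auto
          then have "\<rho>' u = \<rho> u" "\<rho>' (Suc u) = \<rho> (Suc u)" unfolding \<rho>'_def by auto
          then show ?thesis using uq 1 t2 unfolding X_def paid_def mixed_def by auto
        next
          case 2
          then have "\<rho> (Suc u) = r" using const[of "Suc u"] unfolding t2_def by (auto split: if_splits)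
          then have "\<rho>' (Suc u) = r - 1" using 2 unfolding \<rho>'_def by simp
          then show ?thesis using uq 2 unfolding Y'_def mixed_def by auto
        next
          case 3
          then show ?thesis using uq new(3) above unfolding \<rho>'_def r_def by auto
        next
          case 4
          then show ?thesis using uq unfolding X_def paid_def \<rho>'_def mixed_def by auto
        qed
      qed
      show "X \<union> Y \<subseteq> paid ?L p q \<rho>"
      proof -
        have "u \<in> paid ?L p q \<rho>" if "u \<in> Y" for u
          using that new(2) t0(1) const[of u] const[of "Suc u"] unfolding Y_def paid_def mixed_def by auto
        then show ?thesis unfolding X_def by blast
      qed
      show "X \<inter> Y = {}" using t2 unfolding X_def Y_def by auto
      show "finite Y'" by (rule finite_subset[of _ "{..<t}"]) (auto simp: Y'_def)
      have "c - 1 = row_length (a t2) (r - 1) + card Y'"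
        using card_row_layers[OF ca _ t2(3), of "r - 1"] t above rl unfolding Y'_def by simp
      moreover have "c - 1 = row_length (a t0) r + card Y"
        using card_row_layers[OF ca _ t0(2), of r] t above rl unfolding Y_def by simp
      moreover have "row_length (a t0) r \<le> row_length (a t2) (r - 1)"
      proof (cases "p < t0")
        case True
        then have "Suc t2 = t0" unfolding t2_def by simp
        then show ?thesis using strip_row_length[OF chain_strip[OF ca], of t2 "r - 1"] t t0 above by auto
      next
        case False
        then have "t2 = t0" using t0 unfolding t2_def by simp
        then show ?thesis using row_length_antimono[OF chain_diagram[OF ca], of t0 "r - 1" r] t t0 above
          by simp
      qed
      ultimately show "card Y' \<le> card Y" by simp
    qed
    then show ?thesis using path' \<rho>(2) unfolding has_path_def by (meson le_trans)
  qed
qed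

lemma slide_has_path:
  assumes sl: "slide a b J" and q: "q \<le> J" and rows: "\<And>r c. (r, c) \<in> b J \<Longrightarrow> r \<le> n"
  shows "has_path (layer a) n p q m \<longleftrightarrow> has_path (layer b) n p q m"
proof (rule mixed_induct[where J = J and P = "\<lambda>L. has_path L n p q m"])
  fix t assume t: "t < J"
  show "has_path (mixed a b t) n p q m \<longleftrightarrow> has_path (mixed a b (Suc t)) n p q m"
  proof
    assume h: "has_path (mixed a b t) n p q m"
    show "has_path (mixed a b (Suc t)) n p q m"
      by (rule has_path_step1[OF sl t q _ h]) (fact rows)
  next
    assume h: "has_path (mixed a b (Suc t)) n p q m"
    show "has_path (mixed a b t) n p q m" by (rule has_path_step2[OF sl t q h])
  qed
next
  fix L L' :: "nat \<Rightarrow> box set"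
  assume "\<And>j. j < J \<Longrightarrow> L j = L' j" "has_path L n p q m"
  moreover from this q have "paid L p q \<rho> = paid L' p q \<rho>" for \<rho> unfolding paid_def by auto
  ultimately show "has_path L' n p q m" unfolding has_path_def by simp
qed

section \<open>Arrays under slides\<close>

text \<open>The letters of the array are prescribed: \<open>f i j\<close> is a box with the letter \<open>k - 1 - i + j\<close>.
  Such an array encodes that the Demazure product of the reading word of \<open>L\<close> lies above the
  longest Grassmannian permutation with descent at \<open>k\<close>. The relations are weak enough to make
  sense in the middle of a slide.\<close>

definition is_array :: "(nat \<Rightarrow> box set) \<Rightarrow> nat \<Rightarrow> nat \<Rightarrow> (nat \<Rightarrow> nat \<Rightarrow> box) \<Rightarrow> bool" where
  "is_array L N k f \<longleftrightarrow> (\<forall>i j. i < k \<longrightarrow> j < N - k \<longrightarrow> f i j \<in> L (k - 1 - i + j) \<and>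
     (Suc j < N - k \<longrightarrow> snd (f i j) < snd (f i (Suc j))) \<and>
     (Suc i < k \<longrightarrow> fst (f (Suc i) j) < fst (f i j)))"

definition has_array :: "(nat \<Rightarrow> box set) \<Rightarrow> nat \<Rightarrow> nat \<Rightarrow> bool" where
  "has_array L N k \<longleftrightarrow> (\<exists>f. is_array L N k f)"

text \<open>Entries compared with each other have letters differing by one. So no two entries with
  the letter \<open>t\<close> are compared, and all of them can be replaced independently.\<close>

lemma array_exchange:
  assumes f: "is_array L N k f" and L: "\<And>u. u \<noteq> t \<Longrightarrow> L' u = L u"
    and ex: "\<And>i j. i < k \<Longrightarrow> j < N - k \<Longrightarrow> k - 1 - i + j = t \<Longrightarrow> \<exists>y. y \<in> L' t \<and>
      (0 < j \<longrightarrow> snd (f i (j - 1)) < snd y) \<and> (Suc j < N - k \<longrightarrow> snd y < snd (f i (Suc j))) \<and>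
      (0 < i \<longrightarrow> fst y < fst (f (i - 1) j)) \<and> (Suc i < k \<longrightarrow> fst (f (Suc i) j) < fst y)"
  shows "has_array L' N k"
proof -
  define Q where "Q i j y \<longleftrightarrow> y \<in> L' t \<and>
      (0 < j \<longrightarrow> snd (f i (j - 1)) < snd y) \<and> (Suc j < N - k \<longrightarrow> snd y < snd (f i (Suc j))) \<and>
      (0 < i \<longrightarrow> fst y < fst (f (i - 1) j)) \<and> (Suc i < k \<longrightarrow> fst (f (Suc i) j) < fst y)" for i j y
  define g where "g i j = (if k - 1 - i + j = t then SOME y. Q i j y else f i j)" for i j
  have Q: "Q i j (g i j)" if "i < k" "j < N - k" "k - 1 - i + j = t" for i j
  proof -
    have "\<exists>y. Q i j y" unfolding Q_def using ex[OF that] .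
    then have "Q i j (SOME y. Q i j y)" by (rule someI_ex)
    then show ?thesis using that unfolding g_def by simp
  qed
  have "is_array L' N k g"
    unfolding is_array_def
  proof (intro allI impI conjI)
    fix i j assume ij: "i < k" "j < N - k"
    show "g i j \<in> L' (k - 1 - i + j)"
    proof (cases "k - 1 - i + j = t")
      case True
      then show ?thesis using Q[OF ij] unfolding Q_def by simp
    next
      case False
      then show ?thesis using f ij L[OF False] unfolding g_def is_array_def by simp
    qed
    show "snd (g i j) < snd (g i (Suc j))" if "Suc j < N - k"
    proof -
      consider "k - 1 - i + j = t" | "k - 1 - i + Suc j = t"
        | "k - 1 - i + j \<noteq> t" "k - 1 - i + Suc j \<noteq> t" by blast
      then show ?thesis
      proof cases
        case 1
        then have "g i (Suc j) = f i (Suc j)" unfolding g_def by simp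
        then show ?thesis using Q[OF ij 1] that unfolding Q_def by simp
      next
        case 2
        then have "g i j = f i j" unfolding g_def by simp
        then show ?thesis using Q[OF ij(1) that 2] unfolding Q_def by simp
      next
        case 3
        then show ?thesis using f ij that unfolding g_def is_array_def by simp
      qed
    qed
    show "fst (g (Suc i) j) < fst (g i j)" if "Suc i < k"
    proof -
      have ne: "k - 1 - Suc i + j \<noteq> k - 1 - i + j" using that by simp
      consider "k - 1 - i + j = t" | "k - 1 - Suc i + j = t"
        | "k - 1 - i + j \<noteq> t" "k - 1 - Suc i + j \<noteq> t" by blast
      then show ?thesis
      proof cases
        case 1
        then have "k - 1 - Suc i + j \<noteq> t" using ne by metis
        then have "g (Suc i) j = f (Suc i) j" unfolding g_def by (rule if_not_P)
        then show ?thesis using Q[OF ij 1] that unfolding Q_def by simp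
      next
        case 2
        then have "k - 1 - i + j \<noteq> t" using ne by metis
        then have "g i j = f i j" unfolding g_def by (rule if_not_P)
        then show ?thesis using Q[OF that ij(2) 2] unfolding Q_def by simp
      next
        case 3
        then show ?thesis using f ij that unfolding g_def is_array_def by simp
      qed
    qed
  qed
  then show ?thesis unfolding has_array_def by blast
qed

text \<open>Each entry follows its letter, up if the array permits and otherwise left. Going up is
  forbidden only if \<open>f (Suc i) j\<close>, whose letter is \<open>t - 1\<close>, sits in the
  row above. It then sits at \<open>(r - 1, c - 1)\<close>, which keeps \<open>(r, c - 1)\<close>
  out of \<open>?A\<close>, so the letter also moves left. The array cannot forbid both
  moves.\<close>

lemma has_array_step1:
  assumes sl: "slide a b J" and t: "t < J" and h: "has_array (mixed a b t) N k"
  shows "has_array (mixed a b (Suc t)) N k"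
proof -
  let ?A = "a t" and ?B = "b t" and ?C = "a (Suc t)" and ?D = "b (Suc t)"
  have sq: "square ?A ?B ?C ?D" using slide_square[OF sl t] .
  note S = square_strips[OF sq]
  have ca: "chain a J" using sl slide_chains by blast
  have dA: "diagram ?A" using strip_diagram(1)[OF S(1)] .
  obtain f where f: "is_array (mixed a b t) N k f" using h unfolding has_array_def by blast
  have fL: "f i j \<in> mixed a b t (k - 1 - i + j)" if "i < k" "j < N - k" for i j
    using f that unfolding is_array_def by blast
  have fcol: "snd (f i j) < snd (f i (Suc j))" if "i < k" "Suc j < N - k" for i j
    using f that unfolding is_array_def by simp
  have frow: "fst (f (Suc i) j) < fst (f i j)" if "Suc i < k" "j < N - k" for i j
    using f that unfolding is_array_def by simp
  show ?thesis
  proof (rule array_exchange[OF f])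
    fix u assume "u \<noteq> t" then show "mixed a b (Suc t) u = mixed a b t u" by (rule mixed_step)
  next
    fix i j assume ij: "i < k" "j < N - k" "k - 1 - i + j = t"
    obtain r c where x: "f i j = (r, c)" by (cases "f i j")
    have xD: "(r, c) \<in> ?D" "(r, c) \<notin> ?B" using fL[OF ij(1,2)] ij(3) x by (auto simp: mixed_def layer_def)
    have b1: "f i (j - 1) \<in> ?A" "f i (j - 1) \<notin> a (t - 1)" "snd (f i (j - 1)) < c" "Suc (t - 1) = t"
      if "0 < j"
    proof -
      have t0: "k - 1 - i + (j - 1) = t - 1" "0 < t" using ij that by auto
      then have "f i (j - 1) \<in> layer a (t - 1)"
        using fL[of i "j - 1"] ij(1,2) by (simp add: mixed_def)
      then show "f i (j - 1) \<in> ?A" "f i (j - 1) \<notin> a (t - 1)" using t0 by (auto simp: layer_def)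
      show "snd (f i (j - 1)) < c" using fcol[of i "j - 1"] ij that x by simp
      show "Suc (t - 1) = t" using t0 by simp
    qed
    have b2: "f (Suc i) j \<in> ?A" "f (Suc i) j \<notin> a (t - 1)" "fst (f (Suc i) j) < r" "Suc (t - 1) = t"
      if "Suc i < k"
    proof -
      have t0: "k - 1 - Suc i + j = t - 1" "0 < t" using ij that by auto
      then have "f (Suc i) j \<in> layer a (t - 1)"
        using fL[of "Suc i" j] ij(2) that by (simp add: mixed_def)
      then show "f (Suc i) j \<in> ?A" "f (Suc i) j \<notin> a (t - 1)" using t0 by (auto simp: layer_def)
      show "fst (f (Suc i) j) < r" using frow[of i j] ij that x by simp
      show "Suc (t - 1) = t" using t0 by simp
    qed
    have st: "strip (a (t - 1)) ?A" if "Suc (t - 1) = t" using chain_strip[OF ca, of "t - 1"] that t by simp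
    have a1: "r < fst (f (i - 1) j)" if "0 < i" using frow[of "i - 1" j] ij that x by simp
    have a2: "c < snd (f i (Suc j))" if "Suc j < N - k" using fcol[of i j] ij that x by simp
    have ok: "\<exists>y. y \<in> mixed a b (Suc t) t \<and>
      (0 < j \<longrightarrow> snd (f i (j - 1)) < snd y) \<and> (Suc j < N - k \<longrightarrow> snd y < snd (f i (Suc j))) \<and>
      (0 < i \<longrightarrow> fst y < fst (f (i - 1) j)) \<and> (Suc i < k \<longrightarrow> fst (f (Suc i) j) < fst y)"
      if "(r', c') \<in> ?C - ?A" "r' \<le> r" "c' \<le> c" "0 < j \<Longrightarrow> snd (f i (j - 1)) < c'"
        "Suc i < k \<Longrightarrow> fst (f (Suc i) j) < r'" for r' c'
    proof (intro exI[of _ "(r', c')"] conjI impI)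
      show "(r', c') \<in> mixed a b (Suc t) t" using that(1) by (simp add: mixed_def layer_def)
    qed (use that a1 a2 in auto)
    consider (stay) "(r, c) \<in> ?C"
      | (up) "1 < r" "(r - 1, c) \<in> ?C - ?A" "Suc i < k \<Longrightarrow> fst (f (Suc i) j) < r - 1"
      | (blocked) "(r, c) \<notin> ?C" "1 < r" "(r - 1, c) \<in> ?B - ?A" "Suc i < k" "fst (f (Suc i) j) = r - 1"
      | (left) "(r, c) \<notin> ?C" "\<not> (1 < r \<and> (r - 1, c) \<in> ?B - ?A \<and> (r - 1, c) \<in> ?C)"
      using b2(3) by (metis DiffD1 DiffD2 DiffI Suc_diff_1 diff_is_0_eq' le_zero_eq less_Suc_eq
          nat_less_le not_gr_zero)
    then show "\<exists>y. y \<in> mixed a b (Suc t) t \<and>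
      (0 < j \<longrightarrow> snd (f i (j - 1)) < snd y) \<and> (Suc j < N - k \<longrightarrow> snd y < snd (f i (Suc j))) \<and>
      (0 < i \<longrightarrow> fst y < fst (f (i - 1) j)) \<and> (Suc i < k \<longrightarrow> fst (f (Suc i) j) < fst y)"
    proof cases
      case stay
      have "(r, c) \<notin> ?A" using xD S(1) strip_subset by blast
      then show ?thesis using ok[of r c] stay b1 b2 by blast
    next
      case up
      show ?thesis using ok[of "r - 1" c] up b1(3) by simp
    next
      case blocked
      have tt: "Suc (t - 1) = t" using b2(4) blocked by blast
      obtain c2 where B2: "f (Suc i) j = (r - 1, c2)" using blocked(5) by (metis prod.collapse)
      have B2A: "(r - 1, c2) \<in> ?A" "(r - 1, c2) \<notin> a (t - 1)" using b2(1,2) blocked(4) B2 by auto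
      have c2: "1 \<le> c2" "1 \<le> r - 1" using diagram_pos[OF dA B2A(1)] by auto
      have posc: "1 \<le> c" using diagram_pos[OF strip_diagram(2)[OF S(2)] xD(1)] by simp
      have "c2 < c"
        using diagram_le[OF dA B2A(1), of "r - 1" c] blocked(3) c2 posc by (meson DiffD2 not_less order_refl)
      moreover have "(r - 1, c - 1) \<in> ?A"
        using strip_left[OF S(1), of "r - 1" "c - 1"] blocked(3) \<open>c2 < c\<close> c2 by auto
      moreover have "c2 \<le> c - 1" using \<open>c2 < c\<close> by simp
      ultimately have "c2 = c - 1"
        using strip_less[OF st[OF tt], of "r - 1" "c - 1" "r - 1" c2] B2A(2) c2 by auto
      then have B2: "f (Suc i) j = (r - 1, c - 1)" and c1: "1 < c"
        and B2A: "(r - 1, c - 1) \<in> ?A" "(r - 1, c - 1) \<notin> a (t - 1)"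
        using B2 B2A \<open>c2 < c\<close> c2 by auto
      have rc: "(r, c - 1) \<notin> ?A"
        using strip_above[OF st[OF tt], of "r - 1" "c - 1"] B2A(2) c2 by auto
      then have left: "(r, c - 1) \<in> ?C - ?A" using square_nbr_left[OF sq xD(1) c1] by blast
      \<comment> \<open>A second obstruction would be the same box \<open>(r - 1, c - 1)\<close>.
        The entry \<open>f (Suc i) (j - 1)\<close> with letter \<open>t - 2\<close> would then be
        smaller in both coordinates, so the box to its right would belong to
        \<open>a (t - 1)\<close>, against the strip.\<close>
      have "snd (f i (j - 1)) < c - 1" if j: "0 < j"
      proof (rule ccontr)
        assume "\<not> snd (f i (j - 1)) < c - 1"
        then have "snd (f i (j - 1)) = c - 1" using b1(3)[OF j] by simp
        then obtain r1 where B1: "f i (j - 1) = (r1, c - 1)" by (metis prod.collapse)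
        then have B1A: "(r1, c - 1) \<in> ?A" "(r1, c - 1) \<notin> a (t - 1)" using b1(1,2)[OF j] by auto
        have r1: "1 \<le> r1" using diagram_pos[OF dA B1A(1)] by simp
        have c11: "1 \<le> c - 1" using c1 by simp
        have "\<not> r \<le> r1" using diagram_le[OF dA B1A(1), of r "c - 1"] rc c11 blocked(2) by auto
        then have "r1 \<le> r - 1" by simp
        then have "r1 = r - 1"
          using strip_less[OF st[OF tt] B2A(1), of r1 "c - 1"] B1A(2) r1 c11 by auto
        then have B1: "f i (j - 1) = (r - 1, c - 1)" using B1 by simp
        have t2: "k - 1 - Suc i + (j - 1) = t - 2" "Suc (t - 2) = t - 1" using ij j blocked(4) by auto
        obtain ry cy where y: "f (Suc i) (j - 1) = (ry, cy)" by (cases "f (Suc i) (j - 1)")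
        have "(ry, cy) \<in> layer a (t - 2)"
          using fL[of "Suc i" "j - 1"] ij(2) blocked(4) t2 y tt by (auto simp: mixed_def)
        then have yA: "(ry, cy) \<in> a (t - 1)" "(ry, cy) \<notin> a (t - 2)" using t2 by (auto simp: layer_def)
        have "ry < r - 1" using frow[of i "j - 1"] ij blocked(4) y B1 by simp
        moreover have "cy < c - 1" using fcol[of "Suc i" "j - 1"] ij blocked(4) j y B2 by simp
        moreover have "1 \<le> ry" "1 \<le> cy"
          using diagram_pos[OF strip_diagram(1)[OF st[OF tt]] yA(1)] by auto
        ultimately have "(ry, cy + 1) \<in> a (t - 1)"
          using strip_less[OF st[OF tt] B2A(1), of ry "cy + 1"] by auto
        moreover have "strip (a (t - 2)) (a (t - 1))"
          using chain_strip[OF ca, of "t - 2"] t2 t by simp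
        ultimately show False using yA unfolding strip_def by blast
      qed
      moreover have "fst (f (Suc i) j) < r" using blocked by simp
      ultimately show ?thesis using ok[OF left] by simp
    next
      case left
      then have L: "1 < c" "(r, c - 1) \<in> ?B - ?A" "(r, c - 1) \<in> ?C" using square_moved[OF sq xD] by auto
      \<comment> \<open>An entry with letter \<open>t - 1\<close> in column \<open>c - 1\<close>
        would lie above row \<open>r\<close>. But then \<open>(r - 1, c)\<close>, which is weakly
        south-east of it, is in \<open>?A\<close>, so its letter would be smaller than
        \<open>t - 1\<close>.\<close>
      have "snd (f i (j - 1)) < c - 1" if j: "0 < j"
      proof (rule ccontr)
        assume "\<not> snd (f i (j - 1)) < c - 1"
        then have "snd (f i (j - 1)) = c - 1" using b1(3)[OF j] by simp
        then obtain r1 where B1: "f i (j - 1) = (r1, c - 1)" by (metis prod.collapse)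
        then have B1A: "(r1, c - 1) \<in> ?A" "(r1, c - 1) \<notin> a (t - 1)" using b1(1,2)[OF j] by auto
        have r1: "1 \<le> r1" using diagram_pos[OF dA B1A(1)] by simp
        have posr: "1 \<le> r" using diagram_pos[OF strip_diagram(2)[OF S(2)] xD(1)] by simp
        have c11: "1 \<le> c - 1" using L(1) by simp
        have "\<not> r \<le> r1" using diagram_le[OF dA B1A(1), of r "c - 1"] L c11 posr by auto
        then have r1r: "r1 < r" by simp
        then have "1 < r" using r1 by simp
        then have "(r - 1, c) \<in> ?A" using left square_nbr_above[OF sq xD(1)] by blast
        moreover have "r1 \<le> r - 1" "(r1, c - 1) \<noteq> (r - 1, c)" using r1r L(1) by auto
        ultimately show False
          using strip_less[OF st[OF b1(4)[OF j]], of "r - 1" c r1 "c - 1"] B1A(2) r1 c11 by auto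
      qed
      moreover have "fst (f (Suc i) j) < r" if "Suc i < k" using b2(3)[OF that] .
      ultimately show ?thesis using ok[of r "c - 1"] L by simp
    qed
  qed
qed

text \<open>The same argument reversed: down if the array permits, otherwise right. The largest
  letter of the array is \<open>N - 2\<close>, so \<open>N \<le> Suc J\<close> keeps all its letters
  below \<open>J\<close>.\<close>

lemma has_array_step2:
  assumes sl: "slide a b J" and t: "t < J" and N: "N \<le> Suc J"
    and h: "has_array (mixed a b (Suc t)) N k"
  shows "has_array (mixed a b t) N k"
proof -
  let ?A = "a t" and ?B = "b t" and ?C = "a (Suc t)" and ?D = "b (Suc t)" and ?E = "b (Suc (Suc t))"
  have sq: "square ?A ?B ?C ?D" using slide_square[OF sl t] .
  note S = square_strips[OF sq]
  have cb: "chain b J" using sl slide_chains by blast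
  have dD: "diagram ?D" using strip_diagram(2)[OF S(2)] .
  obtain f where f: "is_array (mixed a b (Suc t)) N k f" using h unfolding has_array_def by blast
  have fL: "f i j \<in> mixed a b (Suc t) (k - 1 - i + j)" if "i < k" "j < N - k" for i j
    using f that unfolding is_array_def by blast
  have fcol: "snd (f i j) < snd (f i (Suc j))" if "i < k" "Suc j < N - k" for i j
    using f that unfolding is_array_def by simp
  have frow: "fst (f (Suc i) j) < fst (f i j)" if "Suc i < k" "j < N - k" for i j
    using f that unfolding is_array_def by simp
  show ?thesis
  proof (rule array_exchange[OF f])
    fix u assume "u \<noteq> t" then show "mixed a b t u = mixed a b (Suc t) u" by (rule mixed_step[symmetric])
  next
    fix i j assume ij: "i < k" "j < N - k" "k - 1 - i + j = t"
    obtain r c where x: "f i j = (r, c)" by (cases "f i j")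
    have xC: "(r, c) \<in> ?C" "(r, c) \<notin> ?A" using fL[OF ij(1,2)] ij(3) x by (auto simp: mixed_def layer_def)
    have pos: "1 \<le> r" "1 \<le> c" using diagram_pos[OF strip_diagram(2)[OF S(3)] xC(1)] by auto
    have xD: "(r, c) \<in> ?D" using xC S(4) strip_subset by blast
    have a1: "f (i - 1) j \<in> ?E" "f (i - 1) j \<notin> ?D" "r < fst (f (i - 1) j)" "Suc t < J"
      if "0 < i"
    proof -
      have t0: "k - 1 - (i - 1) + j = Suc t" using ij that by auto
      then have "f (i - 1) j \<in> layer b (Suc t)"
        using fL[of "i - 1" j] ij(1,2) by (simp add: mixed_def)
      then show "f (i - 1) j \<in> ?E" "f (i - 1) j \<notin> ?D" by (auto simp: layer_def)
      show "r < fst (f (i - 1) j)" using frow[of "i - 1" j] ij that x by simp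
      show "Suc t < J" using ij that N by linarith
    qed
    have a2: "f i (Suc j) \<in> ?E" "f i (Suc j) \<notin> ?D" "c < snd (f i (Suc j))" "Suc t < J"
      if "Suc j < N - k"
    proof -
      have "f i (Suc j) \<in> layer b (Suc t)"
        using fL[of i "Suc j"] ij that by (simp add: mixed_def)
      then show "f i (Suc j) \<in> ?E" "f i (Suc j) \<notin> ?D" by (auto simp: layer_def)
      show "c < snd (f i (Suc j))" using fcol[of i j] ij that x by simp
      show "Suc t < J" using ij that N by linarith
    qed
    have st: "strip ?D ?E" if "Suc t < J" using chain_strip[OF cb that] .
    have b1: "snd (f i (j - 1)) < c" if "0 < j" using fcol[of i "j - 1"] ij that x by simp
    have b2: "fst (f (Suc i) j) < r" if "Suc i < k" using frow[of i j] ij that x by simp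
    have ok: "\<exists>y. y \<in> mixed a b t t \<and>
      (0 < j \<longrightarrow> snd (f i (j - 1)) < snd y) \<and> (Suc j < N - k \<longrightarrow> snd y < snd (f i (Suc j))) \<and>
      (0 < i \<longrightarrow> fst y < fst (f (i - 1) j)) \<and> (Suc i < k \<longrightarrow> fst (f (Suc i) j) < fst y)"
      if "(r', c') \<in> ?D - ?B" "r \<le> r'" "c \<le> c'" "Suc j < N - k \<Longrightarrow> c' < snd (f i (Suc j))"
        "0 < i \<Longrightarrow> r' < fst (f (i - 1) j)" for r' c'
    proof (intro exI[of _ "(r', c')"] conjI impI)
      show "(r', c') \<in> mixed a b t t" using that(1) by (simp add: mixed_def layer_def)
    qed (use that b1 b2 in fastforce)+
    have down: "(r + 1, c) \<notin> ?B" "(r, c + 1) \<notin> ?B" if "(r, c) \<in> ?B"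
      using that xC(2) S(1) unfolding strip_def by blast+
    consider (stay) "(r, c) \<notin> ?B"
      | (down) "(r, c) \<in> ?B" "(r + 1, c) \<in> ?D" "0 < i \<Longrightarrow> r + 1 < fst (f (i - 1) j)"
      | (blocked) "(r, c) \<in> ?B" "(r + 1, c) \<in> ?D" "0 < i" "fst (f (i - 1) j) = r + 1"
      | (right) "(r, c) \<in> ?B" "(r + 1, c) \<notin> ?D"
      using a1(3) by fastforce
    then show "\<exists>y. y \<in> mixed a b t t \<and>
      (0 < j \<longrightarrow> snd (f i (j - 1)) < snd y) \<and> (Suc j < N - k \<longrightarrow> snd y < snd (f i (Suc j))) \<and>
      (0 < i \<longrightarrow> fst y < fst (f (i - 1) j)) \<and> (Suc i < k \<longrightarrow> fst (f (Suc i) j) < fst y)"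
    proof cases
      case stay
      show ?thesis using ok[of r c] stay xD a1(3) a2(3) by blast
    next
      case down
      show ?thesis using ok[of "r + 1" c] down \<open>(r, c) \<in> ?B \<Longrightarrow> (r + 1, c) \<notin> ?B\<close> a2(3) by simp
    next
      case blocked
      have tt: "Suc t < J" using a1(4) blocked by blast
      obtain c1 where A1: "f (i - 1) j = (r + 1, c1)" using blocked(4) by (metis prod.collapse)
      have A1E: "(r + 1, c1) \<in> ?E" "(r + 1, c1) \<notin> ?D" using a1(1,2) blocked(3) A1 by auto
      have c1: "1 \<le> c1" using diagram_pos[OF strip_diagram(2)[OF st[OF tt]] A1E(1)] by simp
      have "c < c1"
        using diagram_le[OF dD blocked(2), of "r + 1" c1] A1E(2) c1 by (meson le_add2 not_less order_refl)
      moreover have "(r + 1, c + 1) \<notin> ?D"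
        using S(2) blocked(2) down(1)[OF blocked(1)] unfolding strip_def by blast
      ultimately have "c1 = c + 1"
        using strip_less[OF st[OF tt] A1E(1), of "r + 1" "c + 1"] by fastforce
      then have A1: "f (i - 1) j = (r + 1, c + 1)" and A1E: "(r + 1, c + 1) \<in> ?E" "(r + 1, c + 1) \<notin> ?D"
        using A1 A1E by auto
      have right: "(r, c + 1) \<in> ?D" using strip_above[OF st[OF tt], of r "c + 1"] A1E pos by simp
      \<comment> \<open>Two obstructions would again be the same box \<open>(r + 1, c + 1)\<close>.
        The entry two letters later would exceed it in both coordinates and force it into
        \<open>?D\<close>.\<close>
      have "c + 1 < snd (f i (Suc j))" if j: "Suc j < N - k"
      proof (rule ccontr)
        assume "\<not> c + 1 < snd (f i (Suc j))"
        then have "snd (f i (Suc j)) = c + 1" using a2(3)[OF j] by simp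
        then obtain r2 where A2: "f i (Suc j) = (r2, c + 1)" by (metis prod.collapse)
        then have A2E: "(r2, c + 1) \<in> ?E" "(r2, c + 1) \<notin> ?D" using a2(1,2)[OF j] by auto
        have r2: "1 \<le> r2" using diagram_pos[OF strip_diagram(2)[OF st[OF tt]] A2E(1)] by simp
        have "r < r2" using diagram_le[OF dD right, of r2 "c + 1"] A2E(2) r2 by fastforce
        then have "r2 = r + 1"
          using strip_less[OF st[OF tt] A2E(1), of "r + 1" "c + 1"] A1E(2) by fastforce
        then have A2: "f i (Suc j) = (r + 1, c + 1)" using A2 by simp
        have t2: "k - 1 - (i - 1) + Suc j = Suc (Suc t)" using ij blocked(3) by auto
        have tJ: "Suc (Suc t) < J" using t2 j N ij blocked(3) by linarith
        obtain ry cy where y: "f (i - 1) (Suc j) = (ry, cy)" by (cases "f (i - 1) (Suc j)")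
        have "(ry, cy) \<in> layer b (Suc (Suc t))"
          using fL[of "i - 1" "Suc j"] ij(1) j t2 y by (auto simp: mixed_def)
        then have yE: "(ry, cy) \<in> b (Suc (Suc (Suc t)))" by (auto simp: layer_def)
        have ry: "r + 1 < ry" using frow[of "i - 1" "Suc j"] ij blocked(3) j y A2 by simp
        have cy: "c + 1 < cy" using fcol[of "i - 1" j] ij j y A1 by simp
        have "(ry, cy - 1) \<in> ?E"
          using strip_left[OF chain_strip[OF cb tJ], of ry "cy - 1"] yE cy by simp
        then have "(r + 1, c + 1) \<in> ?D"
          using strip_less[OF st[OF tt], of ry "cy - 1" "r + 1" "c + 1"] ry cy by auto
        then show False using A1E by simp
      qed
      then show ?thesis using ok[of r "c + 1"] right down(2)[OF blocked(1)] a1(3) by simp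
    next
      case right
      then have R: "(r, c + 1) \<in> ?D" using square_moved_rev[OF sq xC] by blast
      have "c + 1 < snd (f i (Suc j))" if j: "Suc j < N - k"
      proof (rule ccontr)
        assume "\<not> c + 1 < snd (f i (Suc j))"
        then have "snd (f i (Suc j)) = c + 1" using a2(3)[OF j] by simp
        then obtain r2 where A2: "f i (Suc j) = (r2, c + 1)" by (metis prod.collapse)
        then have A2E: "(r2, c + 1) \<in> ?E" "(r2, c + 1) \<notin> ?D" using a2(1,2)[OF j] by auto
        have st': "strip ?D ?E" using st a2(4)[OF j] by blast
        have r2: "1 \<le> r2" using diagram_pos[OF strip_diagram(2)[OF st'] A2E(1)] by simp
        have "r < r2" using diagram_le[OF dD R, of r2 "c + 1"] A2E(2) r2 by fastforce
        then have "(r + 1, c) \<in> ?D" using strip_less[OF st' A2E(1), of "r + 1" c] pos by auto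
        then show False using right by simp
      qed
      then show ?thesis using ok[of r "c + 1"] R down(2)[OF right(1)] a1(3) by simp
    qed
  qed
qed

lemma slide_has_array:
  assumes sl: "slide a b J" and N: "N \<le> Suc J"
  shows "has_array (layer a) N k \<longleftrightarrow> has_array (layer b) N k"
proof (rule mixed_induct[where J = J and P = "\<lambda>L. has_array L N k"])
  fix t assume t: "t < J"
  show "has_array (mixed a b t) N k \<longleftrightarrow> has_array (mixed a b (Suc t)) N k"
    using has_array_step1[OF sl t] has_array_step2[OF sl t N] by blast
next
  fix L L' :: "nat \<Rightarrow> box set"
  assume LL: "\<And>j. j < J \<Longrightarrow> L j = L' j" and h: "has_array L N k"
  have "L (k - 1 - i + j) = L' (k - 1 - i + j)" if "i < k" "j < N - k" for i j
    by (rule LL) (use that N in linarith)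
  then show "has_array L' N k" using h unfolding has_array_def is_array_def by (metis (no_types, lifting))
qed

section \<open>Growth diagrams\<close>

text \<open>Row \<open>i\<close> results from row \<open>Suc i\<close> by a slide: row
  \<open>I\<close> is the bottom one and row 0 the top one, and \<open>j\<close> counts the letters
  processed.\<close>

definition growth :: "(nat \<Rightarrow> nat \<Rightarrow> box set) \<Rightarrow> nat \<Rightarrow> nat \<Rightarrow> bool" where
  "growth g I J \<longleftrightarrow> (\<forall>i\<le>I. chain (g i) J) \<and> (\<forall>j\<le>J. chain (\<lambda>i. g i j) I) \<and>
     (\<forall>i<I. \<forall>j<J. square (g i j) (g (Suc i) j) (g i (Suc j)) (g (Suc i) (Suc j)))"

lemma growth_transpose: "growth g I J \<Longrightarrow> growth (\<lambda>j i. g i j) J I"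
  unfolding growth_def using square_sym by blast

lemma growth_slide: "growth g I J \<Longrightarrow> i < I \<Longrightarrow> slide (g i) (g (Suc i)) J"
  unfolding growth_def slide_def by (auto dest: chain_strip)

lemma growth_slide_column: "growth g I J \<Longrightarrow> j < J \<Longrightarrow> slide (\<lambda>i. g i j) (\<lambda>i. g i (Suc j)) I"
  using growth_slide[OF growth_transpose] by fast

lemma growth_chain: "growth g I J \<Longrightarrow> i \<le> I \<Longrightarrow> chain (g i) J"
  and growth_chain_column: "growth g I J \<Longrightarrow> j \<le> J \<Longrightarrow> chain (\<lambda>i. g i j) I"
  unfolding growth_def by auto

lemma growth_snoc:
  assumes g: "growth g I J" and sl: "slide (g I) b J"
  shows "growth (\<lambda>i. if i \<le> I then g i else b) (Suc I) J"
proof -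
  have "chain (\<lambda>i. (if i \<le> I then g i else b) j) (Suc I)" if "j \<le> J" for j
  proof -
    have c: "chain (\<lambda>i. g i j) I" using growth_chain_column[OF g that] .
    show ?thesis
      unfolding chain_def
    proof (intro conjI allI impI)
      show "diagram ((if 0 \<le> I then g 0 else b) j)" using chain_diagram[OF c] by simp
      fix i assume "i < Suc I"
      then show "strip ((if i \<le> I then g i else b) j) ((if Suc i \<le> I then g (Suc i) else b) j)"
        using chain_strip[OF c, of i] slide_strip[OF sl that] by (cases "i = I") auto
    qed
  qed
  moreover have "square ((if i \<le> I then g i else b) j) ((if Suc i \<le> I then g (Suc i) else b) j)
      ((if i \<le> I then g i else b) (Suc j)) ((if Suc i \<le> I then g (Suc i) else b) (Suc j))"
    if "i < Suc I" "j < J" for i j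
    using that slide_square[OF sl] slide_square[OF growth_slide[OF g]] by (cases "i = I") auto
  moreover have "chain (if i \<le> I then g i else b) J" if "i \<le> Suc I" for i
    using that growth_chain[OF g] slide_chains(2)[OF sl] by auto
  ultimately show ?thesis unfolding growth_def by blast
qed

section \<open>Slides and growth diagrams from boundary data\<close>

lemma slide_exists_up:
  assumes "chain b J" "strip A (b 0)"
  shows "\<exists>a. a 0 = A \<and> slide a b J"
  using assms(1)
proof (induction J)
  case 0
  then show ?case using assms(2)
    by (intro exI[of _ "\<lambda>_. A"]) (auto simp: slide_def chain_def strip_diagram(1))
next
  case (Suc J)
  then have "chain b J" unfolding chain_def by simp
  then obtain a where a: "a 0 = A" "slide a b J" using Suc by blast
  have bs: "strip (b J) (b (Suc J))" using chain_strip[OF Suc.prems] by simp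
  obtain C where C: "square (a J) (b J) C (b (Suc J))"
    using square_exists[OF slide_strip[OF a(2) order_refl] bs] by blast
  define a' where "a' = a(Suc J := C)"
  have a': "a' j = a j" if "j \<le> J" for j using that unfolding a'_def by simp
  have aC: "a' (Suc J) = C" unfolding a'_def by simp
  have "slide a' b (Suc J)"
    unfolding slide_def
  proof (intro conjI allI impI)
    show "chain a' (Suc J)"
      unfolding chain_def
    proof (intro conjI allI impI)
      show "diagram (a' 0)" using chain_diagram[OF slide_chains(1)[OF a(2)], of 0] a' by simp
      fix j assume "j < Suc J"
      then show "strip (a' j) (a' (Suc j))"
        using chain_strip[OF slide_chains(1)[OF a(2)], of j] a' aC square_strips(3)[OF C]
        by (cases "j = J") auto
    qed
    show "chain b (Suc J)" by (rule Suc.prems)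
    fix j
    show "strip (a' j) (b j)" if "j \<le> Suc J"
      using that slide_strip[OF a(2), of j] a' aC square_strips(4)[OF C] by (cases "j = Suc J") auto
    show "square (a' j) (b j) (a' (Suc j)) (b (Suc j))" if "j < Suc J"
      using that slide_square[OF a(2), of j] a' aC C by (cases "j = J") auto
  qed
  then show ?case using a(1) a' by (intro exI[of _ a']) simp
qed

text \<open>The slide is undone from its last letter to its first: each square is completed at the
  opposite corner, as \<open>square_sym\<close> permits.\<close>

lemma slide_exists_down:
  assumes "chain a J" "strip (a J) E"
  shows "\<exists>b. b J = E \<and> slide a b J"
  using assms
proof (induction J arbitrary: E)
  case 0
  then show ?case by (intro exI[of _ "\<lambda>_. E"]) (auto simp: slide_def chain_def strip_diagram(2))
next
  case (Suc J)
  have "chain a J" using Suc.prems unfolding chain_def by simp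
  obtain B where "square (a J) (a (Suc J)) B E"
    using square_exists[of "a J" "a (Suc J)" E] chain_strip[OF Suc.prems(1)] Suc.prems(2) by blast
  then have B: "square (a J) B (a (Suc J)) E" by (rule square_sym)
  obtain b where b: "b J = B" "slide a b J"
    using Suc.IH[OF \<open>chain a J\<close> square_strips(1)[OF B]] by blast
  define b' where "b' = b(Suc J := E)"
  have b': "b' j = b j" if "j \<le> J" for j using that unfolding b'_def by simp
  have bE: "b' (Suc J) = E" unfolding b'_def by simp
  have "slide a b' (Suc J)"
    unfolding slide_def
  proof (intro conjI allI impI)
    show "chain b' (Suc J)"
      unfolding chain_def
    proof (intro conjI allI impI)
      show "diagram (b' 0)" using chain_diagram[OF slide_chains(2)[OF b(2)], of 0] b' by simp
      fix j assume "j < Suc J"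
      then show "strip (b' j) (b' (Suc j))"
        using chain_strip[OF slide_chains(2)[OF b(2)], of j] b' bE b(1) square_strips(2)[OF B]
        by (cases "j = J") auto
    qed
    show "chain a (Suc J)" by (rule Suc.prems)
    fix j
    show "strip (a j) (b' j)" if "j \<le> Suc J"
      using that slide_strip[OF b(2), of j] b' bE Suc.prems(2) by (cases "j = Suc J") auto
    show "square (a j) (b' j) (a (Suc j)) (b' (Suc j))" if "j < Suc J"
      using that slide_square[OF b(2), of j] b' bE b(1) B by (cases "j = J") auto
  qed
  then show ?case using bE by blast
qed

lemma slide_unique_up:
  assumes "slide a b J" "slide a' b' J" "a 0 = a' 0" "\<And>j. j \<le> J \<Longrightarrow> b j = b' j" "j \<le> J"
  shows "a j = a' j"
  using assms(5)
proof (induction j)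
  case (Suc j)
  then show ?case
    using square_unique[of "a j" "b j" "a (Suc j)" "b (Suc j)" "a' (Suc j)"]
      slide_square[OF assms(1), of j] slide_square[OF assms(2), of j] assms(4) by simp
qed (use assms in simp)

lemma slide_unique_down:
  assumes "slide a b J" "slide a' b' J" "b J = b' J" "\<And>j. j \<le> J \<Longrightarrow> a j = a' j" "j \<le> J"
  shows "b j = b' j"
  using assms(5)
proof (induction j rule: inc_induct)
  case (step j)
  then have "square (a j) (b j) (a (Suc j)) (b (Suc j))" "square (a j) (b' j) (a (Suc j)) (b (Suc j))"
    using slide_square[OF assms(1), of j] slide_square[OF assms(2), of j] assms(4) by auto
  then show ?case using square_unique square_sym by blast
qed (use assms in simp)

text \<open>This is infusion, from the left column and the bottom row. Its inverse, from the top row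
  and the right column, is \<open>growth_exists_down\<close>.\<close>

lemma growth_exists_up:
  assumes "chain l I" "chain u J" "u 0 = l I"
  shows "\<exists>g. growth g I J \<and> (\<forall>i\<le>I. g i 0 = l i) \<and> (\<forall>j\<le>J. g I j = u j)"
  using assms
proof (induction I arbitrary: u)
  case 0
  then show ?case
    by (intro exI[of _ "\<lambda>_. u"]) (auto simp: growth_def chain_def chain_diagram[OF 0(2), unfolded chain_def])
next
  case (Suc I)
  have "chain l I" using Suc.prems(1) unfolding chain_def by simp
  obtain a where a: "a 0 = l I" "slide a u J"
    using slide_exists_up[OF Suc.prems(2), of "l I"] chain_strip[OF Suc.prems(1), of I] Suc.prems(3) by auto
  obtain g where g: "growth g I J" "\<forall>i\<le>I. g i 0 = l i" "\<forall>j\<le>J. g I j = a j"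
    using Suc.IH[OF \<open>chain l I\<close> slide_chains(1)[OF a(2)] a(1)] by blast
  have "slide (g I) u J"
    using a(2) g(3) unfolding slide_def chain_def by (auto simp: Suc_le_eq)
  from growth_snoc[OF g(1) this] show ?case
    using g(2) Suc.prems(3) by (intro exI[of _ "\<lambda>i. if i \<le> I then g i else u"]) (auto simp: le_Suc_eq)
qed

lemma growth_exists_down:
  assumes "chain u J" "chain r I" "r 0 = u J"
  shows "\<exists>g. growth g I J \<and> (\<forall>j\<le>J. g 0 j = u j) \<and> (\<forall>i\<le>I. g i J = r i)"
  using assms(2,3)
proof (induction I)
  case 0
  then show ?case
    by (intro exI[of _ "\<lambda>_. u"]) (auto simp: growth_def assms(1), auto simp: chain_def chain_diagram[OF assms(1)])
next
  case (Suc I)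
  have "chain r I" using Suc.prems(1) unfolding chain_def by simp
  then obtain g where g: "growth g I J" "\<forall>j\<le>J. g 0 j = u j" "\<forall>i\<le>I. g i J = r i"
    using Suc by blast
  have "strip (g I J) (r (Suc I))" using chain_strip[OF Suc.prems(1), of I] g(3) by simp
  then obtain b where b: "b J = r (Suc I)" "slide (g I) b J"
    using slide_exists_down[OF growth_chain[OF g(1) order_refl]] by blast
  from growth_snoc[OF g(1) b(2)] show ?case
    using g b(1) by (intro exI[of _ "\<lambda>i. if i \<le> I then g i else b"]) (auto simp: le_Suc_eq)
qed

lemma growth_unique_up:
  assumes "growth g I J" "growth g' I J" "\<And>i. i \<le> I \<Longrightarrow> g i 0 = g' i 0"
    "\<And>j. j \<le> J \<Longrightarrow> g I j = g' I j" "i \<le> I" "j \<le> J"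
  shows "g i j = g' i j"
proof -
  have "\<forall>j\<le>J. g i j = g' i j"
    using assms(5)
  proof (induction i rule: inc_induct)
    case (step i)
    then show ?case
      using slide_unique_up[OF growth_slide[OF assms(1), of i] growth_slide[OF assms(2), of i]] assms(3) by auto
  qed (use assms in simp)
  then show ?thesis using assms(6) by simp
qed

lemma growth_unique_down:
  assumes "growth g I J" "growth g' I J" "\<And>i. i \<le> I \<Longrightarrow> g i J = g' i J"
    "\<And>j. j \<le> J \<Longrightarrow> g 0 j = g' 0 j" "i \<le> I" "j \<le> J"
  shows "g i j = g' i j"
proof -
  have "\<forall>j\<le>J. g i j = g' i j"
    using assms(5)
  proof (induction i)
    case (Suc i)
    then show ?case
      using slide_unique_down[OF growth_slide[OF assms(1), of i] growth_slide[OF assms(2), of i]] assms(3)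
      by auto
  qed (use assms in simp)
  then show ?thesis using assms(6) by simp
qed

text \<open>Dots neither vanish nor arise. If \<open>C = D\<close>, then no box of
  \<open>B - A\<close> has a neighbour in \<open>D\<close> below or to the right, so it would have
  to stay outside \<open>C\<close>.\<close>

lemma square_trivial:
  assumes "square A B C D" shows "A = B \<longleftrightarrow> C = D"
proof
  assume "A = B"
  then show "C = D" using square_nonempty[OF square_sym[OF assms]] by blast
next
  note S = square_strips[OF assms]
  assume CD: "C = D"
  show "A = B"
  proof (rule ccontr)
    assume "A \<noteq> B"
    then obtain r c where x: "(r, c) \<in> B" "(r, c) \<notin> A" using S(1) unfolding strip_def by auto
    then have D: "(r, c) \<in> D" using S(2) strip_subset by blast
    have "(r + 1, c) \<notin> C" "(r, c + 1) \<notin> C" using S(3) D x CD unfolding strip_def by blast+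
    then have "maximal D r c" using CD unfolding maximal_def by simp
    then show False using assms D x CD unfolding square_def by blast
  qed
qed

lemma slide_trivial:
  assumes "slide a b J" "i \<le> J" "j \<le> J" shows "a i = b i \<longleftrightarrow> a j = b j"
proof -
  have "a 0 = b 0 \<longleftrightarrow> a j = b j" if "j \<le> J" for j
    using that
  proof (induction j)
    case (Suc j)
    then show ?case using square_trivial[OF slide_square[OF assms(1), of j]] by simp
  qed simp
  then show ?thesis using assms(2,3) by metis
qed

text \<open>All rows of a growth diagram use the same letters. This is how promotion of the top row
  is seen to preserve the letters of the word.\<close>

lemma growth_layer_empty:
  assumes "growth g I J" "i \<le> I" "i' \<le> I" "j < J"
  shows "layer (g i) j = {} \<longleftrightarrow> layer (g i') j = {}"
proof -
  have *: "layer (g i) j = {} \<longleftrightarrow> g i j = g i (Suc j)" if "i \<le> I" for i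
    using strip_subset[OF chain_strip[OF growth_chain[OF assms(1) that] assms(4)]] unfolding layer_def by auto
  show ?thesis using *[OF assms(2)] *[OF assms(3)]
      slide_trivial[OF growth_slide_column[OF assms(1,4)] assms(2,3)] by simp
qed

section \<open>Tableaux as chains of diagrams\<close>

text \<open>Letters count from 1 and layers from 0. Empty layers are allowed, so \<open>k\<close>
  may exceed the largest entry.\<close>

definition fills :: "(nat \<Rightarrow> box set) \<Rightarrow> nat \<Rightarrow> tableau \<Rightarrow> bool" where
  "fills s k T \<longleftrightarrow> chain s k \<and> (\<forall>x v. T x = Some v \<longleftrightarrow> 1 \<le> v \<and> v \<le> k \<and> x \<in> layer s (v - 1))"

lemma fills_iff: "fills s k T \<Longrightarrow> T x = Some v \<longleftrightarrow> 1 \<le> v \<and> v \<le> k \<and> x \<in> layer s (v - 1)"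
  and fills_chain: "fills s k T \<Longrightarrow> chain s k"
  unfolding fills_def by blast+

lemma fillsI:
  "chain s k \<Longrightarrow> (\<And>x v. T x = Some v \<longleftrightarrow> 1 \<le> v \<and> v \<le> k \<and> x \<in> layer s (v - 1)) \<Longrightarrow> fills s k T"
  unfolding fills_def by blast

lemma fills_unique: "fills s k T \<Longrightarrow> fills s k T' \<Longrightarrow> T = T'"
proof
  fix x assume "fills s k T" "fills s k T'"
  then have "T x = Some v \<longleftrightarrow> T' x = Some v" for v using fills_iff by blast
  then show "T x = T' x" by (metis not_Some_eq)
qed

lemma fills_chain_unique:
  assumes "fills s k T" "fills s' k T" "s 0 = s' 0" "j \<le> k"
  shows "s j = s' j"
  using assms(4)
proof (induction j)
  case (Suc j)
  have "x \<in> layer s j \<longleftrightarrow> x \<in> layer s' j" for x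
    using fills_iff[OF assms(1), of x "Suc j"] fills_iff[OF assms(2), of x "Suc j"] Suc.prems by simp
  then have "layer s j = layer s' j" by blast
  moreover have "s (Suc j) = s j \<union> layer s j" "s' (Suc j) = s' j \<union> layer s' j"
    using strip_subset[OF chain_strip[OF fills_chain[OF assms(1)]], of j]
      strip_subset[OF chain_strip[OF fills_chain[OF assms(2)]], of j] Suc.prems
    unfolding layer_def by auto
  ultimately show ?case using Suc by simp
qed (use assms in simp)

lemma fills_ran: "fills s k T \<Longrightarrow> ran T \<subseteq> {1..k}"
  using fills_iff unfolding ran_def by fastforce

lemma fills_largest:
  assumes "fills s k T"
  shows "largest_entry T \<le> k" "T x = Some v \<Longrightarrow> v \<le> largest_entry T"
proof -
  have fin: "finite (insert 0 (ran T))" using fills_ran[OF assms] finite_subset by auto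
  have "largest_entry T \<in> insert 0 (ran T)" unfolding largest_entry_def using Max_in[OF fin] by blast
  then show "largest_entry T \<le> k" using fills_ran[OF assms] by auto
  show "v \<le> largest_entry T" if "T x = Some v"
    unfolding largest_entry_def using that by (intro Max_ge[OF fin]) (auto intro: ranI)
qed

lemma fills_layer_empty:
  assumes "fills s k T" "largest_entry T \<le> j" "j < k" shows "layer s j = {}"
proof (rule ccontr)
  assume "layer s j \<noteq> {}"
  then obtain x where "x \<in> layer s j" by blast
  then have "T x = Some (Suc j)" using fills_iff[OF assms(1), of x "Suc j"] assms(3) by simp
  then show False using fills_largest(2)[OF assms(1)] assms(2) by fastforce
qed

lemma fills_largest_eq:
  assumes "fills s k T" "\<And>j. j < k \<Longrightarrow> layer s j \<noteq> {}" shows "largest_entry T = k"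
  using fills_largest(1)[OF assms(1)] fills_layer_empty[OF assms(1) order_refl] assms(2)
  by (meson le_neq_implies_less)

lemma fills_boxes_with:
  assumes "fills s k T" "i < k" shows "boxes_with T (Suc i) = s (Suc i) - s i"
  using fills_iff[OF assms(1), of _ "Suc i"] assms(2) unfolding boxes_with_def layer_def
  by (simp add: set_diff_eq)

lemma fills_dom:
  assumes "fills s k T" shows "dom T = s k - s 0"
proof -
  have ch: "chain s k" using fills_chain[OF assms] .
  have "x \<in> dom T \<longleftrightarrow> (\<exists>u<k. x \<in> layer s u)" for x
  proof
    assume "x \<in> dom T"
    then obtain v where "T x = Some v" by blast
    then have "v - 1 < k" "x \<in> layer s (v - 1)" using fills_iff[OF assms, of x v] by auto
    then show "\<exists>u<k. x \<in> layer s u" by blast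
  next
    assume "\<exists>u<k. x \<in> layer s u"
    then obtain u where "u < k" "x \<in> layer s u" by blast
    then have "T x = Some (Suc u)" using fills_iff[OF assms, of x "Suc u"] by simp
    then show "x \<in> dom T" by blast
  qed
  moreover have "(\<exists>u<k. x \<in> layer s u) \<longleftrightarrow> x \<in> s k - s 0" for x
  proof
    assume "\<exists>u<k. x \<in> layer s u"
    then obtain u where "u < k" "x \<in> layer s u" by blast
    then show "x \<in> s k - s 0"
      using chain_mono[OF ch, of "Suc u" k] chain_mono[OF ch, of 0 u] unfolding layer_def by auto
  next
    assume "x \<in> s k - s 0"
    then show "\<exists>u<k. x \<in> layer s u" using layer_between[of x s k 0] by auto
  qed
  ultimately show ?thesis by blast
qed

section \<open>Dotted tableaux and the sliding operations\<close>

definition dotted :: "(nat \<Rightarrow> box set) \<Rightarrow> (nat \<Rightarrow> box set) \<Rightarrow> nat \<Rightarrow> nat \<Rightarrow> dotted_tableau \<Rightarrow> bool" where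
  "dotted a b k t F \<longleftrightarrow> (\<forall>x. F x = Some Dot \<longleftrightarrow> x \<in> b t - a t) \<and>
     (\<forall>x v. F x = Some (Entry v) \<longleftrightarrow> 1 \<le> v \<and> v \<le> k \<and> x \<in> mixed a b t (v - 1))"

lemma dotted_iff:
  assumes "dotted a b k t F"
  shows "F x = Some Dot \<longleftrightarrow> x \<in> b t - a t"
    and "F x = Some (Entry v) \<longleftrightarrow> 1 \<le> v \<and> v \<le> k \<and> x \<in> mixed a b t (v - 1)"
  using assms unfolding dotted_def by blast+

lemma dottedI:
  assumes "\<And>x. F x = Some Dot \<longleftrightarrow> x \<in> b t - a t"
    and "\<And>x v. F x = Some (Entry v) \<longleftrightarrow> 1 \<le> v \<and> v \<le> k \<and> x \<in> mixed a b t (v - 1)"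
  shows "dotted a b k t F"
  using assms unfolding dotted_def by blast

text \<open>The square rule in the form tested by \<open>jdt_step\<close> and
  \<open>rjdt_step\<close>. On the border the tested neighbour has a coordinate 0 and is in no
  diagram, which matches the exceptions for row 1 and column 1 in \<open>addable\<close>.\<close>

lemma square_nbrs:
  assumes sq: "square A B C D"
  shows "x \<in> B - A \<Longrightarrow> x \<in> C \<longleftrightarrow> below x \<in> D - B \<or> right_of x \<in> D - B"
    and "x \<in> D - B \<Longrightarrow> x \<notin> C \<longleftrightarrow> above x \<in> B - A \<or> left_of x \<in> B - A"
proof -
  note S = square_strips[OF sq]
  obtain r c where x: "x = (r, c)" by (cases x)
  show "x \<in> C \<longleftrightarrow> below x \<in> D - B \<or> right_of x \<in> D - B" if "x \<in> B - A"
  proof -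
    have D: "(r, c) \<in> D" "(r, c) \<in> B" "(r, c) \<notin> A" using that x S(2) strip_subset by auto
    have "addable A r c" using strip_addable[OF S(1)] D by simp
    then have "(r, c) \<in> C \<longleftrightarrow> \<not> maximal D r c" using sq D unfolding square_def by blast
    moreover have "(r + 1, c) \<notin> B" "(r, c + 1) \<notin> B" using S(1) D unfolding strip_def by blast+
    ultimately show ?thesis using x unfolding maximal_def by simp
  qed
  show "x \<notin> C \<longleftrightarrow> above x \<in> B - A \<or> left_of x \<in> B - A" if "x \<in> D - B"
  proof -
    have D: "(r, c) \<in> D" "(r, c) \<notin> B" "(r, c) \<notin> A" using that x S(1) strip_subset by auto
    have pos: "1 \<le> r" "1 \<le> c" using diagram_pos[OF strip_diagram(2)[OF S(2)] D(1)] by auto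
    have C: "(r, c) \<in> C \<longleftrightarrow> addable A r c" using sq D unfolding square_def by blast
    have B: "addable B r c" using strip_addable[OF S(2) D(1)] .
    have z: "(0, c) \<notin> B" "(r, 0) \<notin> B" using diagram_pos[OF strip_diagram(2)[OF S(1)]] by fastforce+
    show ?thesis using x C B z pos unfolding addable_def by (auto simp: le_Suc_eq)
  qed
qed

lemma jdt_step_dotted:
  assumes sl: "slide a b k" and t: "t < k" and F: "dotted a b k t F"
  shows "dotted a b k (Suc t) (jdt_step (Suc t) F)"
proof -
  let ?A = "a t" and ?B = "b t" and ?C = "a (Suc t)" and ?D = "b (Suc t)"
  have sq: "square ?A ?B ?C ?D" using slide_square[OF sl t] .
  have sub: "?A \<subseteq> ?B" "?B \<subseteq> ?D" "?A \<subseteq> ?C" "?C \<subseteq> ?D" using square_strips[OF sq] strip_subset by auto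
  have dot: "F x = Some Dot \<longleftrightarrow> x \<in> ?B - ?A" for x using dotted_iff(1)[OF F] .
  have ent: "F x = Some (Entry (Suc t)) \<longleftrightarrow> x \<in> ?D - ?B" for x
    using dotted_iff(2)[OF F, of x "Suc t"] t by (simp add: mixed_def layer_def)
  have step: "jdt_step (Suc t) F x = (if x \<in> ?B - ?A \<and> x \<in> ?C then Some (Entry (Suc t))
      else if x \<in> ?D - ?B \<and> x \<notin> ?C then Some Dot else F x)" for x
    unfolding jdt_step_def dot ent using square_nbrs[OF sq, of x] by auto
  show ?thesis
  proof (rule dottedI)
    fix x
    show "jdt_step (Suc t) F x = Some Dot \<longleftrightarrow> x \<in> ?D - ?C"
      unfolding step using dot[of x] sub by auto
  next
    fix x v
    show "jdt_step (Suc t) F x = Some (Entry v) \<longleftrightarrow> 1 \<le> v \<and> v \<le> k \<and> x \<in> mixed a b (Suc t) (v - 1)"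
    proof (cases "v = Suc t")
      case True
      then show ?thesis unfolding step using dot[of x] ent[of x] sub t by (auto simp: mixed_def layer_def)
    next
      case False
      have "jdt_step (Suc t) F x = Some (Entry v) \<longleftrightarrow> F x = Some (Entry v)"
        unfolding step using dot[of x] ent[of x] False by auto
      moreover have "1 \<le> v \<Longrightarrow> mixed a b (Suc t) (v - 1) = mixed a b t (v - 1)"
        using False by (intro mixed_step) auto
      ultimately show ?thesis using dotted_iff(2)[OF F, of x v] by auto
    qed
  qed
qed

lemma rjdt_step_dotted:
  assumes sl: "slide a b k" and t: "t < k" and F: "dotted a b k (Suc t) F"
  shows "dotted a b k t (rjdt_step (Suc t) F)"
proof -
  let ?A = "a t" and ?B = "b t" and ?C = "a (Suc t)" and ?D = "b (Suc t)"
  have sq: "square ?A ?C ?B ?D" using square_sym[OF slide_square[OF sl t]] .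
  have sub: "?A \<subseteq> ?B" "?B \<subseteq> ?D" "?A \<subseteq> ?C" "?C \<subseteq> ?D" using square_strips[OF sq] strip_subset by auto
  have dot: "F x = Some Dot \<longleftrightarrow> x \<in> ?D - ?C" for x using dotted_iff(1)[OF F] .
  have ent: "F x = Some (Entry (Suc t)) \<longleftrightarrow> x \<in> ?C - ?A" for x
    using dotted_iff(2)[OF F, of x "Suc t"] t by (simp add: mixed_def layer_def)
  have step: "rjdt_step (Suc t) F x = (if x \<in> ?D - ?C \<and> x \<notin> ?B then Some (Entry (Suc t))
      else if x \<in> ?C - ?A \<and> x \<in> ?B then Some Dot else F x)" for x
    unfolding rjdt_step_def dot ent using square_nbrs[OF sq, of x] by auto
  show ?thesis
  proof (rule dottedI)
    fix x
    show "rjdt_step (Suc t) F x = Some Dot \<longleftrightarrow> x \<in> ?B - ?A"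
      unfolding step using dot[of x] sub by auto
  next
    fix x v
    show "rjdt_step (Suc t) F x = Some (Entry v) \<longleftrightarrow> 1 \<le> v \<and> v \<le> k \<and> x \<in> mixed a b t (v - 1)"
    proof (cases "v = Suc t")
      case True
      then show ?thesis unfolding step using dot[of x] ent[of x] sub t by (auto simp: mixed_def layer_def)
    next
      case False
      have "rjdt_step (Suc t) F x = Some (Entry v) \<longleftrightarrow> F x = Some (Entry v)"
        unfolding step using dot[of x] ent[of x] False by auto
      moreover have "1 \<le> v \<Longrightarrow> mixed a b (Suc t) (v - 1) = mixed a b t (v - 1)"
        using False by (intro mixed_step) auto
      ultimately show ?thesis using dotted_iff(2)[OF F, of x v] by auto
    qed
  qed
qed

lemma put_dots_dotted:
  assumes "slide a b k"
  shows "fills b k T \<Longrightarrow> dotted a b k 0 (put_dots (b 0 - a 0) T)"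
    and "fills a k T \<Longrightarrow> dotted a b k k (put_dots (b k - a k) T)"
proof -
  show "dotted a b k 0 (put_dots (b 0 - a 0) T)" if T: "fills b k T"
  proof (rule dottedI)
    have None: "T x = None" if "x \<in> b 0 - a 0" for x
      using that fills_dom[OF T] by (metis DiffD1 DiffD2 domIff)
    fix x
    show "put_dots (b 0 - a 0) T x = Some Dot \<longleftrightarrow> x \<in> b 0 - a 0" unfolding put_dots_def by auto
    fix v
    have "put_dots (b 0 - a 0) T x = Some (Entry v) \<longleftrightarrow> T x = Some v"
      unfolding put_dots_def using None[of x] by auto
    then show "put_dots (b 0 - a 0) T x = Some (Entry v) \<longleftrightarrow> 1 \<le> v \<and> v \<le> k \<and> x \<in> mixed a b 0 (v - 1)"
      using fills_iff[OF T, of x v] by (simp add: mixed_def)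
  qed
  show "dotted a b k k (put_dots (b k - a k) T)" if T: "fills a k T"
  proof (rule dottedI)
    have None: "T x = None" if "x \<in> b k - a k" for x
      using that fills_dom[OF T] by (metis DiffD1 DiffD2 domIff)
    fix x
    show "put_dots (b k - a k) T x = Some Dot \<longleftrightarrow> x \<in> b k - a k" unfolding put_dots_def by auto
    fix v
    have "put_dots (b k - a k) T x = Some (Entry v) \<longleftrightarrow> T x = Some v"
      unfolding put_dots_def using None[of x] by auto
    then show "put_dots (b k - a k) T x = Some (Entry v) \<longleftrightarrow> 1 \<le> v \<and> v \<le> k \<and> x \<in> mixed a b k (v - 1)"
      using fills_iff[OF T, of x v] by (auto simp: mixed_def)
  qed
qed

lemma delete_dots_fills:
  "dotted a b k k F \<Longrightarrow> slide a b k \<Longrightarrow> fills a k (delete_dots F)"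
  "dotted a b k 0 F \<Longrightarrow> slide a b k \<Longrightarrow> fills b k (delete_dots F)"
proof -
  have del: "delete_dots F x = Some v \<longleftrightarrow> F x = Some (Entry v)" for x v
    unfolding delete_dots_def by (auto split: option.splits cell.splits)
  show "fills a k (delete_dots F)" if F: "dotted a b k k F" and sl: "slide a b k"
    by (rule fillsI[OF slide_chains(1)[OF sl]]) (auto simp: del dotted_iff(2)[OF F] mixed_def)
  show "fills b k (delete_dots F)" if F: "dotted a b k 0 F" and sl: "slide a b k"
    by (rule fillsI[OF slide_chains(2)[OF sl]]) (auto simp: del dotted_iff(2)[OF F] mixed_def)
qed

text \<open>The loop of \<open>jdt\<close> ends at the largest entry. The layers from there to
  \<open>k\<close> are empty, so their steps would change nothing.\<close>

lemma jdt_fills: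
  assumes sl: "slide a b k" and T: "fills b k T"
  shows "fills a k (jdt (b 0 - a 0) T)"
proof -
  let ?G = "\<lambda>t. fold jdt_step [1..<t + 1] (put_dots (b 0 - a 0) T)"
  have G: "dotted a b k t (?G t)" if "t \<le> k" for t
    using that
  proof (induction t)
    case (Suc t)
    then show ?case using jdt_step_dotted[OF sl, of t "?G t"] by simp
  qed (simp add: put_dots_dotted(1)[OF sl T])
  let ?L = "largest_entry T"
  have "dotted a b k t (?G ?L)" if "?L \<le> t" "t \<le> k" for t
    using that
  proof (induction t rule: dec_induct)
    case (step t)
    then have F: "dotted a b k t (?G ?L)" by simp
    have "x \<notin> layer b t" for x using fills_layer_empty[OF T, of t] step by simp
    then have "?G ?L x \<noteq> Some (Entry (Suc t))" for x
      using dotted_iff(2)[OF F, of x "Suc t"] step by (simp add: mixed_def)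
    then have "jdt_step (Suc t) (?G ?L) = ?G ?L" unfolding jdt_step_def by auto
    then show ?case using jdt_step_dotted[OF sl _ F] step by simp
  qed (use G fills_largest(1)[OF T] in simp)
  then have "dotted a b k k (?G ?L)" using fills_largest(1)[OF T] by blast
  then show ?thesis unfolding jdt_def using delete_dots_fills(1)[OF _ sl] by simp
qed

lemma rjdt_fills:
  assumes sl: "slide a b k" and T: "fills a k T"
  shows "fills b k (rjdt (b k - a k) T)"
proof -
  let ?L = "largest_entry T" and ?P = "put_dots (b k - a k) T"
  \<comment> \<open>The loop of \<open>rjdt\<close> starts at the largest entry, so the initial
    filling must be shown to represent that state and not only state \<open>k\<close>.\<close>
  have P: "dotted a b k t ?P" if "?L \<le> t" "t \<le> k" for t
    using that(2,1)
  proof (induction t rule: inc_induct)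
    case base
    then show ?case using put_dots_dotted(2)[OF sl T] by simp
  next
    case (step t)
    then have F: "dotted a b k (Suc t) ?P" by simp
    have "layer a t = {}" using fills_layer_empty[OF T, of t] step by simp
    then have "?P x \<noteq> Some (Entry (Suc t))" for x
      using dotted_iff(2)[OF F, of x "Suc t"] step by (simp add: mixed_def)
    then have "rjdt_step (Suc t) ?P = ?P" unfolding rjdt_step_def by auto
    then show ?case using rjdt_step_dotted[OF sl _ F] step by simp
  qed
  have "dotted a b k (?L - m) (fold rjdt_step (rev [?L - m + 1..<?L + 1]) ?P)" if "m \<le> ?L" for m
    using that
  proof (induction m)
    case 0
    then show ?case using P[of ?L] fills_largest(1)[OF T] by simp
  next
    case (Suc m)
    then have e: "?L - m = Suc (?L - Suc m)" by simp
    have "[?L - Suc m + 1..<?L + 1] = (?L - m) # [?L - m + 1..<?L + 1]"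
    proof -
      have "?L - Suc m + 1 = ?L - m" using e by simp
      moreover have "[?L - m..<?L + 1] = (?L - m) # [Suc (?L - m)..<?L + 1]"
        by (rule upt_conv_Cons) simp
      ultimately show ?thesis by (simp only: Suc_eq_plus1)
    qed
    then have "fold rjdt_step (rev [?L - Suc m + 1..<?L + 1]) ?P
        = rjdt_step (?L - m) (fold rjdt_step (rev [?L - m + 1..<?L + 1]) ?P)" by simp
    then show ?case
      using rjdt_step_dotted[OF sl, of "?L - Suc m" "fold rjdt_step (rev [?L - m + 1..<?L + 1]) ?P"]
        Suc e fills_largest(1)[OF T] by simp
  qed
  from this[of ?L] have "dotted a b k 0 (fold rjdt_step (rev [1..<?L + 1]) ?P)" by simp
  then show ?thesis unfolding rjdt_def using delete_dots_fills(2)[OF _ sl] by simp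
qed

text \<open>Each letter of \<open>T\<close> lifts the filling \<open>U\<close> by one row of the
  diagram. Rows beyond the largest entry of \<open>T\<close> coincide with the bottom row, as an
  empty layer puts no dots.\<close>

lemma jdt_by_fills:
  assumes g: "growth g I J" and T: "fills (\<lambda>i. g i 0) I T" and U: "fills (g I) J U"
  shows "fills (g 0) J (jdt_by T U)"
proof -
  let ?L = "largest_entry T"
  have "fills (g i) J U" if "?L \<le> i" "i \<le> I" for i
    using that(2,1)
  proof (induction i rule: inc_induct)
    case (step i)
    have "g i 0 = g (Suc i) 0"
      using fills_layer_empty[OF T, of i] step strip_subset[OF chain_strip[OF growth_chain_column[OF g]], of 0 i]
      unfolding layer_def by auto
    then have "g i j = g (Suc i) j" if "j \<le> J" for j
      using slide_trivial[OF growth_slide[OF g], of i 0 j] step that by simp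
    then have lay: "layer (g i) v = layer (g (Suc i)) v" if "v < J" for v
      using that unfolding layer_def by simp
    have U: "fills (g (Suc i)) J U" using step by simp
    show ?case
    proof (rule fillsI)
      show "chain (g i) J" using growth_chain[OF g] step by simp
      fix x v
      show "U x = Some v \<longleftrightarrow> 1 \<le> v \<and> v \<le> J \<and> x \<in> layer (g i) (v - 1)"
        using fills_iff[OF U, of x v] lay[of "v - 1"] by auto
    qed
  qed (rule U)
  then have L: "fills (g ?L) J U" using fills_largest(1)[OF T] by simp
  have "fills (g (?L - m)) J (fold (\<lambda>i. jdt (boxes_with T i)) (rev [?L - m + 1..<?L + 1]) U)" if "m \<le> ?L" for m
    using that
  proof (induction m)
    case 0
    then show ?case using L by simp
  next
    case (Suc m)
    then have e: "?L - m = Suc (?L - Suc m)" and lI: "?L - Suc m < I" using fills_largest(1)[OF T] by auto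
    have "[?L - Suc m + 1..<?L + 1] = (?L - m) # [?L - m + 1..<?L + 1]"
    proof -
      have "?L - Suc m + 1 = ?L - m" using e by simp
      moreover have "[?L - m..<?L + 1] = (?L - m) # [Suc (?L - m)..<?L + 1]"
        by (rule upt_conv_Cons) simp
      ultimately show ?thesis by (simp only: Suc_eq_plus1)
    qed
    then have "fold (\<lambda>i. jdt (boxes_with T i)) (rev [?L - Suc m + 1..<?L + 1]) U
        = jdt (boxes_with T (?L - m)) (fold (\<lambda>i. jdt (boxes_with T i)) (rev [?L - m + 1..<?L + 1]) U)" by simp
    moreover have "boxes_with T (?L - m) = g (?L - m) 0 - g (?L - Suc m) 0"
      using fills_boxes_with[OF T lI] e by simp
    ultimately show ?case
      using jdt_fills[OF growth_slide[OF g lI]] Suc e by simp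
  qed
  from this[of ?L] show ?thesis unfolding jdt_by_def by simp
qed

text \<open>The same diagram read by columns, so the two components of an infusion are the top row
  and the right column of one growth diagram.\<close>

lemma rjdt_by_fills:
  assumes g: "growth g I J" and T: "fills (\<lambda>i. g i 0) I T" and U: "fills (g I) J U"
  shows "fills (\<lambda>i. g i J) I (rjdt_by U T)"
proof -
  let ?L = "largest_entry U" and ?F = "\<lambda>j. fold (\<lambda>i. rjdt (boxes_with U i)) [1..<j + 1] T"
  have "fills (\<lambda>i. g i j) I (?F j)" if "j \<le> J" for j
    using that
  proof (induction j)
    case (Suc j)
    have "?F (Suc j) = rjdt (boxes_with U (Suc j)) (?F j)" by simp
    moreover have "boxes_with U (Suc j) = g I (Suc j) - g I j"
      using fills_boxes_with[OF U, of j] Suc by simp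
    ultimately show ?case using rjdt_fills[OF growth_slide_column[OF g, of j]] Suc by simp
  qed (use T in simp)
  then have L: "fills (\<lambda>i. g i ?L) I (?F ?L)" using fills_largest(1)[OF U] by simp
  have "fills (\<lambda>i. g i j) I (?F ?L)" if "?L \<le> j" "j \<le> J" for j
    using that
  proof (induction j rule: dec_induct)
    case (step j)
    have "g I j = g I (Suc j)"
      using fills_layer_empty[OF U, of j] step strip_subset[OF chain_strip[OF growth_chain[OF g]], of I j]
      unfolding layer_def by auto
    then have "g i j = g i (Suc j)" if "i \<le> I" for i
      using slide_trivial[OF growth_slide_column[OF g], of j I i] step that by simp
    then have lay: "layer (\<lambda>i. g i (Suc j)) v = layer (\<lambda>i. g i j) v" if "v < I" for v
      using that unfolding layer_def by simp
    have F: "fills (\<lambda>i. g i j) I (?F ?L)" using step by simp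
    show ?case
    proof (rule fillsI)
      show "chain (\<lambda>i. g i (Suc j)) I" using growth_chain_column[OF g, of "Suc j"] step by simp
      fix x v
      show "?F ?L x = Some v \<longleftrightarrow> 1 \<le> v \<and> v \<le> I \<and> x \<in> layer (\<lambda>i. g i (Suc j)) (v - 1)"
        using fills_iff[OF F, of x v] lay[of "v - 1"] by auto
    qed
  qed (rule L)
  then show ?thesis using fills_largest(1)[OF U] unfolding rjdt_by_def by simp
qed

section \<open>Staircases and words\<close>

definition stair :: "nat \<Rightarrow> box set" where
  "stair n = {(r, c). 1 \<le> r \<and> 1 \<le> c \<and> r + c \<le> n + 1}"

definition word_chain :: "nat list \<Rightarrow> nat \<Rightarrow> box set" where
  "word_chain w j = stair (length w - 1) \<union>
     {(r, c). 1 \<le> r \<and> 1 \<le> c \<and> r + c = length w + 1 \<and> w ! (c - 1) \<le> j}"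

lemma stair_iff: "(r, c) \<in> stair n \<longleftrightarrow> 1 \<le> r \<and> 1 \<le> c \<and> r + c \<le> n + 1"
  unfolding stair_def by simp

lemma stair_0: "stair 0 = {}"
  unfolding stair_def by auto

text \<open>Two consecutive staircases differ by one antidiagonal, whose boxes are pairwise
  incomparable. Hence its boxes can be added in any order and in any groups, and arbitrary words
  become fillings.\<close>

lemma diagram_between:
  assumes "stair n \<subseteq> A" "A \<subseteq> stair (Suc n)" shows "diagram A"
  unfolding diagram_def
proof (intro conjI allI impI)
  have "A \<subseteq> {..n + 2} \<times> {..n + 2}" using assms(2) unfolding stair_def by auto
  then show "finite A" by (rule finite_subset) simp
next
  fix r c assume "(r, c) \<in> A" then show "1 \<le> r" using assms(2) by (auto simp: stair_iff)
next
  fix r c assume "(r, c) \<in> A" then show "1 \<le> c" using assms(2) by (auto simp: stair_iff)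
next
  fix r c r' c' assume a: "(r, c) \<in> A" "1 \<le> r'" "r' \<le> r" "1 \<le> c'" "c' \<le> c"
  then have rc: "r + c \<le> n + 2" using assms(2) by (auto simp: stair_iff)
  show "(r', c') \<in> A"
  proof (cases "(r', c') = (r, c)")
    case False
    then have "r' + c' < r + c" using a by auto
    then have "(r', c') \<in> stair n" using a rc by (simp add: stair_iff)
    then show ?thesis using assms(1) by blast
  qed (use a in simp)
qed

lemma strip_between:
  assumes "stair n \<subseteq> A" "A \<subseteq> B" "B \<subseteq> stair (Suc n)" shows "strip A B"
  unfolding strip_def
proof (intro conjI allI impI)
  show "diagram A" "diagram B" using diagram_between assms by (meson subset_trans)+
  fix r c assume "(r, c) \<in> B - A"
  then have "(r, c) \<notin> stair n" "(r, c) \<in> stair (Suc n)" using assms by blast+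
  then have "n + 1 < r + c" by (simp add: stair_iff)
  then have "(r + 1, c) \<notin> stair (Suc n)" "(r, c + 1) \<notin> stair (Suc n)" by (auto simp: stair_iff)
  then show "(r + 1, c) \<notin> B" "(r, c + 1) \<notin> B" using assms by auto
qed (rule assms(2))

lemma stair_mono: "m \<le> n \<Longrightarrow> stair m \<subseteq> stair n"
  by (auto simp: stair_iff)

lemma diagram_stair: "diagram (stair n)"
  using diagram_between[of n "stair n"] stair_mono by simp

lemma strip_stair: "strip (stair n) (stair (Suc n))"
  by (rule strip_between[of n]) (auto simp: stair_iff)

lemma chain_stair: "chain stair k"
  unfolding chain_def using diagram_stair strip_stair by blast

lemma layer_stair: "layer stair u = {(r, c). 1 \<le> r \<and> 1 \<le> c \<and> r + c = u + 2}"
  unfolding layer_def stair_def by auto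

lemma fills_M_tab: "fills stair n (M_tab n)"
proof (rule fillsI[OF chain_stair])
  fix x :: box and v
  obtain r c where x: "x = (r, c)" by (cases x)
  show "M_tab n x = Some v \<longleftrightarrow> 1 \<le> v \<and> v \<le> n \<and> x \<in> layer stair (v - 1)"
    unfolding x M_tab_def layer_stair by auto
qed

lemma word_chain_bounds: "1 \<le> length w \<Longrightarrow> stair (length w - 1) \<subseteq> word_chain w j"
  "1 \<le> length w \<Longrightarrow> word_chain w j \<subseteq> stair (Suc (length w - 1))"
  unfolding word_chain_def stair_def by auto

lemma chain_word_chain:
  assumes "1 \<le> length w" shows "chain (word_chain w) k"
  unfolding chain_def
proof (intro conjI allI impI)
  show "diagram (word_chain w 0)" using diagram_between word_chain_bounds[OF assms] .
  fix j
  have "word_chain w j \<subseteq> word_chain w (Suc j)" unfolding word_chain_def by auto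
  then show "strip (word_chain w j) (word_chain w (Suc j))"
    by (rule strip_between[OF word_chain_bounds(1)[OF assms] _ word_chain_bounds(2)[OF assms]])
qed

lemma word_chain_0:
  assumes "w \<in> words n" shows "word_chain w 0 = stair (n - 1)"
proof -
  have "1 \<le> w ! (c - 1)" if "r + c = length w + 1" "1 \<le> r" "1 \<le> c" for r c
    using assms that nth_mem[of "c - 1" w] unfolding words_def by auto
  then show ?thesis using assms unfolding word_chain_def words_def by fastforce
qed

lemma word_chain_top:
  assumes "w \<in> words n" "1 \<le> n" "set w \<subseteq> {1..k}" shows "word_chain w k = stair n"
proof -
  have n: "length w = n" using assms unfolding words_def by simp
  have le: "w ! (c - 1) \<le> k" if "r + c = length w + 1" "1 \<le> r" "1 \<le> c" for r c
  proof -
    have "w ! (c - 1) \<in> set w" using that by (intro nth_mem) arith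
    then show ?thesis using assms(3) by auto
  qed
  have "(r, c) \<in> word_chain w k \<longleftrightarrow> (r, c) \<in> stair n" for r c
    using le[of r c] n assms(2) unfolding word_chain_def stair_def by auto
  then show ?thesis by auto
qed

lemma layer_word_chain:
  "layer (word_chain w) j = {(r, c). 1 \<le> r \<and> 1 \<le> c \<and> r + c = length w + 1 \<and> w ! (c - 1) = Suc j}"
  unfolding layer_def word_chain_def stair_def by auto

lemma fills_word_tab:
  assumes "w \<in> words n" "1 \<le> n" "set w \<subseteq> {1..k}" shows "fills (word_chain w) k (word_tab w)"
proof (rule fillsI)
  have n: "length w = n" using assms unfolding words_def by simp
  show "chain (word_chain w) k" using chain_word_chain n assms(2) by simp
  fix x :: box and v
  obtain r c where x: "x = (r, c)" by (cases x)
  have "w ! (c - 1) \<in> {1..k}" if "r + c = length w + 1" "1 \<le> r" "1 \<le> c"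
  proof -
    have "w ! (c - 1) \<in> set w" using that by (intro nth_mem) arith
    then show ?thesis using assms(3) by auto
  qed
  then show "word_tab w x = Some v \<longleftrightarrow> 1 \<le> v \<and> v \<le> k \<and> x \<in> layer (word_chain w) (v - 1)"
    unfolding x word_tab_def layer_word_chain by auto
qed

lemma word_chain_inject:
  assumes w: "w \<in> words n" "w' \<in> words n" "set w \<subseteq> {1..k}" "set w' \<subseteq> {1..k}"
    and eq: "\<And>j. j \<le> k \<Longrightarrow> word_chain w j = word_chain w' j"
  shows "w = w'"
proof (rule nth_equalityI)
  show n: "length w = length w'" using w unfolding words_def by simp
  fix p assume p: "p < length w"
  then have m: "w ! p \<in> {1..k}" using w(3) nth_mem by blast
  have "(length w - p, p + 1) \<in> layer (word_chain w) (w ! p - 1)"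
    using p m unfolding layer_word_chain by simp
  moreover have "layer (word_chain w) (w ! p - 1) = layer (word_chain w') (w ! p - 1)"
  proof -
    have "w ! p - 1 \<le> k" "Suc (w ! p - 1) \<le> k" using m by auto
    then show ?thesis unfolding layer_def using eq by simp
  qed
  ultimately have "(length w - p, p + 1) \<in> layer (word_chain w') (w ! p - 1)" by simp
  then show "w ! p = w' ! p" unfolding layer_word_chain using m by auto
qed

lemma word_of_chain:
  assumes ch: "chain s k" and n: "1 \<le> n" and s: "s 0 = stair (n - 1)" "s k = stair n"
  shows "\<exists>w \<in> words n. set w \<subseteq> {1..k} \<and> (\<forall>j\<le>k. s j = word_chain w j)"
proof -
  \<comment> \<open>A letter is the time at which its box on the antidiagonal enters the chain; list
    position \<open>p\<close> is column \<open>p + 1\<close>.\<close>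
  define w where "w = map (\<lambda>p. LEAST j. (n - p, p + 1) \<in> s j) [0..<n]"
  have nth: "w ! p = (LEAST j. (n - p, p + 1) \<in> s j)" if "p < n" for p using that unfolding w_def by simp
  have top: "(n - p, p + 1) \<in> s k" if "p < n" for p using that s(2) by (simp add: stair_iff)
  have le: "w ! p \<le> k" if "p < n" for p using nth[OF that] top[OF that] Least_le by metis
  have mem: "(n - p, p + 1) \<in> s (w ! p)" if "p < n" for p
    unfolding nth[OF that] using top[OF that] by (rule LeastI)
  have pos: "1 \<le> w ! p" if "p < n" for p
  proof (rule ccontr)
    assume "\<not> 1 \<le> w ! p"
    then have "w ! p = 0" by simp
    then have "(n - p, p + 1) \<in> stair (n - 1)" using mem[OF that] s(1) by simp
    then show False using that by (simp add: stair_iff)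
  qed
  have len: "length w = n" unfolding w_def by simp
  have iff: "(n - p, p + 1) \<in> s j \<longleftrightarrow> w ! p \<le> j" if "p < n" "j \<le> k" for p j
  proof
    assume "(n - p, p + 1) \<in> s j" then show "w ! p \<le> j" unfolding nth[OF that(1)] by (rule Least_le)
  next
    assume "w ! p \<le> j"
    then show "(n - p, p + 1) \<in> s j" using chain_mono[OF ch _ that(2)] mem[OF that(1)] by blast
  qed
  have "x \<in> s j \<longleftrightarrow> x \<in> word_chain w j" if "j \<le> k" for x j
  proof -
    obtain r c where x: "x = (r, c)" by (cases x)
    have sub: "stair (n - 1) \<subseteq> s j" "s j \<subseteq> stair n"
      using chain_mono[OF ch, of 0 j] chain_mono[OF ch, of j k] that s by auto
    show ?thesis
    proof (cases "1 \<le> r \<and> 1 \<le> c \<and> r + c = n + 1")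
      case True
      then have "r = n - (c - 1)" "c - 1 < n" "c = c - 1 + 1" by auto
      then show ?thesis using iff[of "c - 1" j] that True n len
        unfolding x word_chain_def by (auto simp: stair_iff)
    next
      case False
      then have "(r, c) \<in> stair n \<longleftrightarrow> (r, c) \<in> stair (n - 1)" using n by (auto simp: stair_iff)
      then show ?thesis using sub False unfolding x word_chain_def len by auto
    qed
  qed
  then have "\<forall>j\<le>k. s j = word_chain w j" by blast
  moreover have "w \<in> words n" "set w \<subseteq> {1..k}"
    using pos le len unfolding words_def by (auto simp: in_set_conv_nth)
  ultimately show ?thesis by blast
qed

lemma word_letter_iff:
  assumes "w \<in> words n" "1 \<le> n" shows "layer (word_chain w) j \<noteq> {} \<longleftrightarrow> Suc j \<in> set w"
proof
  assume "layer (word_chain w) j \<noteq> {}"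
  then obtain r c where "1 \<le> r" "1 \<le> c" "r + c = length w + 1" "w ! (c - 1) = Suc j"
    unfolding layer_word_chain by auto
  then show "Suc j \<in> set w" using nth_mem[of "c - 1" w] by auto
next
  assume "Suc j \<in> set w"
  then obtain p where "p < length w" "w ! p = Suc j" by (auto simp: in_set_conv_nth)
  then have "(length w - p, p + 1) \<in> layer (word_chain w) j" unfolding layer_word_chain by simp
  then show "layer (word_chain w) j \<noteq> {}" by blast
qed

section \<open>Unique rectification to the staircase\<close>

lemma growth_column_invariant:
  assumes "\<And>j. j < J \<Longrightarrow> Q (layer (\<lambda>i. g i j)) \<longleftrightarrow> Q (layer (\<lambda>i. g i (Suc j)))"
  shows "Q (layer (\<lambda>i. g i 0)) \<longleftrightarrow> Q (layer (\<lambda>i. g i J))"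
proof -
  have "Q (layer (\<lambda>i. g i 0)) \<longleftrightarrow> Q (layer (\<lambda>i. g i j))" if "j \<le> J" for j
    using that by (induction j) (use assms in auto)
  then show ?thesis by simp
qed

text \<open>In the staircase filling the box \<open>(k - i, j + 1)\<close> has coordinate sum
  \<open>(k - 1 - i + j) + 2\<close>, hence the prescribed letter.\<close>

lemma has_array_stair: "has_array (layer stair) n k"
  unfolding has_array_def is_array_def layer_stair
  by (intro exI[of _ "\<lambda>i j. (k - i, j + 1)"]) auto

text \<open>A box can be added only one step after its upper and left neighbours, so staircases grow
  as fast as possible.\<close>

lemma chain_empty_subset_stair:
  assumes ch: "chain s k" and s: "s 0 = {}" and "i \<le> k" shows "s i \<subseteq> stair i"
  using assms(3)
proof (induction i)
  case (Suc i)
  then have IH: "s i \<subseteq> stair i" and st: "strip (s i) (s (Suc i))" using chain_strip[OF ch, of i] by auto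
  show ?case
  proof
    fix x assume x: "x \<in> s (Suc i)"
    obtain r c where rc: "x = (r, c)" by (cases x)
    have pos: "1 \<le> r" "1 \<le> c" using diagram_pos[OF strip_diagram(2)[OF st]] x rc by auto
    consider "1 < r" | "1 < c" | "r = 1" "c = 1" using pos by linarith
    then show "x \<in> stair (Suc i)"
    proof cases
      case 1
      then have "(r - 1, c) \<in> stair i" using IH strip_above[OF st, of "r - 1" c] x rc by auto
      then show ?thesis unfolding rc stair_iff using 1 pos by auto
    next
      case 2
      then have "(r, c - 1) \<in> stair i" using IH strip_left[OF st, of r "c - 1"] x rc pos by auto
      then show ?thesis unfolding rc stair_iff using 2 pos by auto
    qed (simp add: rc stair_iff)
  qed
qed (simp add: s)

text \<open>Take the array with \<open>k = r\<close>. Strictness along the array, starting from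
  coordinates at least 1, gives \<open>f 0 (c - 1)\<close> row at least \<open>r\<close> and column
  at least \<open>c\<close>, while its letter confines it to \<open>stair (r + c - 1)\<close>. So it
  is the box \<open>(r, c)\<close>, which thus appears as early as in the staircase filling.\<close>

lemma straight_array:
  assumes ch: "chain s (n - 1)" and s: "s 0 = {}" and arr: "\<And>k. has_array (layer s) n k"
    and i: "i \<le> n - 1"
  shows "s i = stair i"
proof
  show "s i \<subseteq> stair i" using chain_empty_subset_stair[OF ch s i] .
  have "(r, c) \<in> s (r + c - 1)" if rc: "1 \<le> r" "1 \<le> c" "r + c \<le> n" for r c
  proof -
    obtain f where f: "is_array (layer s) n r f" using arr unfolding has_array_def by blast
    have c: "c - 1 < n - r" "0 < r" using rc by auto
    have row: "r - i \<le> fst (f i j)" if "j < n - r" "i < r" for i j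
    proof -
      have "m < r \<Longrightarrow> m + 1 \<le> fst (f (r - 1 - m) j)" for m
      proof (induction m)
        case 0
        have "f (r - 1) j \<in> layer s (r - 1 - (r - 1) + j)"
          using f[unfolded is_array_def, rule_format, of "r - 1" j] that rc by simp
        then have "f (r - 1) j \<in> s (Suc j)" unfolding layer_def by simp
        then have "1 \<le> fst (f (r - 1) j)"
          using diagram_pos[OF chain_diagram[OF ch, of "Suc j"], of "fst (f (r - 1) j)" "snd (f (r - 1) j)"]
            that rc by simp
        then show ?case by simp
      next
        case (Suc m)
        have "Suc (r - 1 - Suc m) = r - 1 - m" using Suc.prems by simp
        moreover have "fst (f (Suc (r - 1 - Suc m)) j) < fst (f (r - 1 - Suc m) j)"
          using f that Suc.prems unfolding is_array_def by simp
        ultimately show ?case using Suc by simp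
      qed
      from this[of "r - 1 - i"] show ?thesis using that by simp
    qed
    have mem: "f 0 j \<in> s (r + j)" if "j < n - r" for j
    proof -
      have "f 0 j \<in> layer s (r - 1 - 0 + j)" using f that rc unfolding is_array_def by simp
      then show ?thesis unfolding layer_def using rc by simp
    qed
    have col: "j + 1 \<le> snd (f 0 j)" if "j < n - r" for j
      using that
    proof (induction j)
      case 0
      then show ?case
        using mem[of 0] diagram_pos[OF chain_diagram[OF ch, of "r + 0"], of "fst (f 0 0)" "snd (f 0 0)"] by simp
    next
      case (Suc j)
      then have "snd (f 0 j) < snd (f 0 (Suc j))" using f rc unfolding is_array_def by simp
      then show ?case using Suc by simp
    qed
    have m: "f 0 (c - 1) \<in> s (r + (c - 1))" using mem c by simp
    then have "f 0 (c - 1) \<in> stair (r + (c - 1))"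
    proof -
      have "r + (c - 1) \<le> n - 1" using rc by arith
      then show ?thesis using chain_empty_subset_stair[OF ch s] m by blast
    qed
    then have "fst (f 0 (c - 1)) + snd (f 0 (c - 1)) \<le> r + c"
      unfolding stair_def using rc by (auto simp: case_prod_beta)
    moreover have "r \<le> fst (f 0 (c - 1))" "c \<le> snd (f 0 (c - 1))" using row[of "c - 1" 0] col[of "c - 1"] c rc by auto
    ultimately have "f 0 (c - 1) = (r, c)" by (intro prod_eqI) auto
    then show ?thesis using m rc by simp
  qed
  note mem = this
  show "stair i \<subseteq> s i"
  proof
    fix x assume x: "x \<in> stair i"
    obtain r c where rc: "x = (r, c)" by (cases x)
    then have r: "1 \<le> r" "1 \<le> c" "r + c \<le> i + 1" using x by (auto simp: stair_iff)
    then have "r + c \<le> n" "r + c - 1 \<le> i" using i by arith+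
    then show "x \<in> s i" using mem[OF r(1,2)] chain_mono[OF ch _ i] rc by blast
  qed
qed

text \<open>Arrays are carried from the left column of \<open>g\<close> to the common right column
  and from there to the left column of \<open>h\<close>. The top rows may differ.\<close>

lemma staircase_unique_rectification:
  assumes g: "growth g (n - 1) k" and l: "\<And>i. i \<le> n - 1 \<Longrightarrow> g i 0 = stair i"
    and h: "growth h (n - 1) m" and h0: "h 0 0 = {}" and r: "\<And>i. i \<le> n - 1 \<Longrightarrow> h i m = g i k"
    and i: "i \<le> n - 1"
  shows "h i 0 = stair i"
proof (rule straight_array[OF growth_chain_column[OF h] _ _ i])
  have N: "n \<le> Suc (n - 1)" by simp
  have cong: "has_array L n q" if "has_array L' n q" "\<And>u. u < n - 1 \<Longrightarrow> L u = L' u" for L L' q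
  proof -
    have "L (q - 1 - i + j) = L' (q - 1 - i + j)" if "i < q" "j < n - q" for i j
      using that \<open>\<And>u. u < n - 1 \<Longrightarrow> L u = L' u\<close> by simp
    then show ?thesis using that(1) unfolding has_array_def is_array_def by (metis (no_types, lifting))
  qed
  fix q
  have "has_array (layer (\<lambda>i. g i 0)) n q"
    by (rule cong[OF has_array_stair]) (simp add: layer_def l)
  then have "has_array (layer (\<lambda>i. g i k)) n q"
    using growth_column_invariant[of k "\<lambda>L. has_array L n q" g]
      slide_has_array[OF growth_slide_column[OF g] N] by blast
  then have "has_array (layer (\<lambda>i. h i m)) n q"
    by (rule cong) (simp add: layer_def r)
  then show "has_array (layer (\<lambda>i. h i 0)) n q"
    using growth_column_invariant[of m "\<lambda>L. has_array L n q" h]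
      slide_has_array[OF growth_slide_column[OF h] N] by blast
qed (simp_all add: h0)

section \<open>Longest increasing subsequences\<close>

definition inc_positions :: "nat list \<Rightarrow> nat set \<Rightarrow> bool" where
  "inc_positions w A \<longleftrightarrow> A \<subseteq> {..<length w} \<and> (\<forall>p\<in>A. \<forall>q\<in>A. p < q \<longrightarrow> w ! p < w ! q)"

lemma inc_positions_finite: "inc_positions w A \<Longrightarrow> finite A"
  unfolding inc_positions_def using finite_subset by blast

lemma nths_eq_map: "nths w A = map ((!) w) (filter (\<lambda>i. i \<in> A) [0..<length w])"
proof -
  have "zip w [0..<length w] = map (\<lambda>i. (w ! i, i)) [0..<length w]"
    by (rule nth_equalityI) auto
  then show ?thesis unfolding nths_def by (simp add: filter_map comp_def)
qed

lemma sorted_wrt_strict_sorted: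
  "sorted_wrt (<) (xs :: nat list) \<Longrightarrow> sorted_wrt R xs \<longleftrightarrow> (\<forall>x\<in>set xs. \<forall>y\<in>set xs. x < y \<longrightarrow> R x y)"
  by (induction xs) (auto dest: less_asym)

lemma sorted_nths:
  "sorted_wrt (<) (nths w A) \<longleftrightarrow> (\<forall>p\<in>A. \<forall>q\<in>A. p < q \<longrightarrow> q < length w \<longrightarrow> w ! p < w ! q)"
proof -
  have "sorted_wrt (<) (filter (\<lambda>i. i \<in> A) [0..<length w])" by (simp add: sorted_wrt_filter)
  from sorted_wrt_strict_sorted[OF this, of "\<lambda>x y. w ! x < w ! y"] show ?thesis
    unfolding nths_eq_map sorted_wrt_map by auto
qed

lemma subseq_filter_iff: "subseq s (filter P w) \<longleftrightarrow> subseq s w \<and> (\<forall>x\<in>set s. P x)"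
proof
  assume s: "subseq s (filter P w)"
  have "P x" if "x \<in> set s" for x using list_emb_set[OF s that] by auto
  then show "subseq s w \<and> (\<forall>x\<in>set s. P x)" using s subseq_filter_left subseq_order.trans by blast
next
  assume "subseq s w \<and> (\<forall>x\<in>set s. P x)"
  then show "subseq s (filter P w)" using subseq_filter[of s w P] by (simp add: filter_id_conv)
qed

text \<open>The invariants only tell for which \<open>m\<close> a sequence of size \<open>m\<close>
  exists, so \<open>lis\<close> enters through comparisons with all \<open>m\<close>.\<close>

lemma le_lis_filter:
  "m \<le> lis (filter P w) \<longleftrightarrow> (\<exists>A. inc_positions w A \<and> (\<forall>p\<in>A. P (w ! p)) \<and> card A = m)"
proof -
  let ?X = "{s. subseq s (filter P w) \<and> sorted_wrt (<) s}"
  have fin: "finite (length ` ?X)"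
  proof (rule finite_imageI, rule finite_subset)
    show "?X \<subseteq> set (subseqs (filter P w))" by auto
  qed simp
  have "[] \<in> ?X" by simp
  then have ne: "length ` ?X \<noteq> {}" by blast
  have "m \<le> lis (filter P w) \<longleftrightarrow> (\<exists>s\<in>?X. m \<le> length s)"
    unfolding lis_def using Max_ge_iff[OF fin ne] by simp
  also have "\<dots> \<longleftrightarrow> (\<exists>A. inc_positions w A \<and> (\<forall>p\<in>A. P (w ! p)) \<and> card A = m)"
  proof
    assume "\<exists>s\<in>?X. m \<le> length s"
    then obtain s where s0: "subseq s (filter P w)" "sorted_wrt (<) s" "m \<le> length s" by blast
    then have s: "subseq s w" "\<forall>x\<in>set s. P x" "sorted_wrt (<) s" "m \<le> length s"
      using subseq_filter_iff[of s P w] by auto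
    then obtain B where B: "s = nths w B" using subseq_conv_nths by blast
    define A where "A = {i \<in> B. i < length w}"
    have "nths w B = nths w A" unfolding nths_eq_map A_def by (intro arg_cong[where f = "map _"] filter_cong) auto
    then have "length s = card A"
      unfolding B by (simp add: length_nths A_def) (metis (no_types, lifting) conj_commute)
    moreover have "inc_positions w A"
      using s(3) unfolding B sorted_nths inc_positions_def A_def by auto
    moreover have "\<forall>p\<in>A. P (w ! p)" using s(2) unfolding B nths_eq_map A_def by auto
    moreover obtain A' where "A' \<subseteq> A" "card A' = m"
      using s(4) \<open>length s = card A\<close> obtain_subset_with_card_n by metis
    ultimately show "\<exists>A. inc_positions w A \<and> (\<forall>p\<in>A. P (w ! p)) \<and> card A = m"
      unfolding inc_positions_def by (intro exI[of _ A']) blast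
  next
    assume "\<exists>A. inc_positions w A \<and> (\<forall>p\<in>A. P (w ! p)) \<and> card A = m"
    then obtain A where A: "inc_positions w A" "\<forall>p\<in>A. P (w ! p)" "card A = m" by blast
    have "{i. i < length w \<and> i \<in> A} = A" using A(1) unfolding inc_positions_def by auto
    then have "length (nths w A) = m" using A(3) by (simp add: length_nths)
    moreover have "\<forall>x\<in>set (nths w A). P x" using A(2) unfolding nths_eq_map by auto
    moreover have "sorted_wrt (<) (nths w A)" using A(1) unfolding sorted_nths inc_positions_def by blast
    moreover have "subseq (nths w A) w" using subseq_conv_nths by blast
    ultimately show "\<exists>s\<in>?X. m \<le> length s" using subseq_filter_iff by (intro bexI[of _ "nths w A"]) auto
  qed
  finally show ?thesis .
qed

lemma le_lis: "m \<le> lis w \<longleftrightarrow> (\<exists>A. inc_positions w A \<and> card A = m)"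
  using le_lis_filter[of m "\<lambda>_. True" w] by simp

lemma subseq_rev: "subseq s w \<Longrightarrow> subseq (rev s) (rev w)"
proof (induction rule: list_emb.induct)
  case (list_emb_Cons xs ys y)
  then show ?case using subseq_rev_drop_many by simp
next
  case (list_emb_Cons2 x y xs ys)
  then show ?case using list_emb_append_mono[of "(=)" "rev xs" "rev ys" "[x]" "[y]"] by simp
qed simp

lemma lds_eq_lis_rev: "lds w = lis (rev w)"
proof -
  have "length ` {s. subseq s w \<and> sorted_wrt (>) s} = length ` {s. subseq s (rev w) \<and> sorted_wrt (<) s}"
  proof
    show "length ` {s. subseq s w \<and> sorted_wrt (>) s} \<subseteq> length ` {s. subseq s (rev w) \<and> sorted_wrt (<) s}"
    proof (rule image_subsetI)
      fix s assume "s \<in> {s. subseq s w \<and> sorted_wrt (>) s}"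
      then have "rev s \<in> {s. subseq s (rev w) \<and> sorted_wrt (<) s}"
        by (simp add: sorted_wrt_rev subseq_rev)
      then show "length s \<in> length ` {s. subseq s (rev w) \<and> sorted_wrt (<) s}" by (metis image_eqI length_rev)
    qed
    show "length ` {s. subseq s (rev w) \<and> sorted_wrt (<) s} \<subseteq> length ` {s. subseq s w \<and> sorted_wrt (>) s}"
    proof (rule image_subsetI)
      fix s assume "s \<in> {s. subseq s (rev w) \<and> sorted_wrt (<) s}"
      then have "rev s \<in> {s. subseq s w \<and> sorted_wrt (>) s}"
        using subseq_rev[of s "rev w"] by (simp add: sorted_wrt_rev)
      then show "length s \<in> length ` {s. subseq s w \<and> sorted_wrt (>) s}" by (metis image_eqI length_rev)
    qed
  qed
  then show ?thesis unfolding lds_def lis_def by simp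
qed

lemma le_lis_factor:
  assumes "1 \<le> a" "a \<le> b" "b \<le> length w"
  shows "m \<le> lis (factor w a b) \<longleftrightarrow> (\<exists>A. inc_positions w A \<and> A \<subseteq> {a - 1..<b} \<and> card A = m)"
proof -
  have len: "length (factor w a b) = b - (a - 1)" using assms unfolding factor_def by simp
  have nth: "factor w a b ! p = w ! (a - 1 + p)" if "p < b - (a - 1)" for p
    using that assms unfolding factor_def by simp
  show ?thesis
    unfolding le_lis
  proof
    assume "\<exists>A. inc_positions (factor w a b) A \<and> card A = m"
    then obtain A where A: "inc_positions (factor w a b) A" "card A = m" by blast
    have sub: "p < b - (a - 1)" if "p \<in> A" for p using A(1) that len unfolding inc_positions_def by auto
    have inj: "inj_on (\<lambda>p. a - 1 + p) A" by (rule inj_onI) simp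
    have "inc_positions w ((\<lambda>p. a - 1 + p) ` A)"
      unfolding inc_positions_def
    proof (intro conjI ballI impI)
      show "(\<lambda>p. a - 1 + p) ` A \<subseteq> {..<length w}" using sub assms by fastforce
      fix p q assume "p \<in> (\<lambda>p. a - 1 + p) ` A" "q \<in> (\<lambda>p. a - 1 + p) ` A" "p < q"
      then obtain p' q' where "p = a - 1 + p'" "q = a - 1 + q'" "p' \<in> A" "q' \<in> A" "p' < q'" by auto
      then show "w ! p < w ! q" using A(1) nth[OF sub] unfolding inc_positions_def by metis
    qed
    moreover have "(\<lambda>p. a - 1 + p) ` A \<subseteq> {a - 1..<b}" using sub by fastforce
    ultimately show "\<exists>A. inc_positions w A \<and> A \<subseteq> {a - 1..<b} \<and> card A = m"
      using A(2) card_image[OF inj] by (intro exI[of _ "(\<lambda>p. a - 1 + p) ` A"]) simp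
  next
    assume "\<exists>A. inc_positions w A \<and> A \<subseteq> {a - 1..<b} \<and> card A = m"
    then obtain A where A: "inc_positions w A" "A \<subseteq> {a - 1..<b}" "card A = m" by blast
    have inj: "inj_on (\<lambda>p. p - (a - 1)) A"
    proof (rule inj_onI)
      fix p q assume "p \<in> A" "q \<in> A" and eq: "p - (a - 1) = q - (a - 1)"
      then have "a - 1 \<le> p" "a - 1 \<le> q" using A(2) by auto
      then show "p = q" using eq by (metis le_add_diff_inverse)
    qed
    have "inc_positions (factor w a b) ((\<lambda>p. p - (a - 1)) ` A)"
      unfolding inc_positions_def
    proof (intro conjI ballI impI)
      show "(\<lambda>p. p - (a - 1)) ` A \<subseteq> {..<length (factor w a b)}" using A(2) len by fastforce
      fix p q assume "p \<in> (\<lambda>p. p - (a - 1)) ` A" "q \<in> (\<lambda>p. p - (a - 1)) ` A" "p < q"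
      then obtain p' q' where pq: "p = p' - (a - 1)" "q = q' - (a - 1)" "p' \<in> A" "q' \<in> A" by auto
      then have "a - 1 \<le> p'" "a - 1 \<le> q'" "p' < b" "q' < b" using A(2) by auto
      moreover from this have "p' < q'" using pq(1,2) \<open>p < q\<close> by arith
      ultimately show "factor w a b ! p < factor w a b ! q"
        using A(1) pq nth[of p] nth[of q] unfolding inc_positions_def by simp
    qed
    then show "\<exists>A. inc_positions (factor w a b) A \<and> card A = m"
      using A(3) card_image[OF inj] by (intro exI[of _ "(\<lambda>p. p - (a - 1)) ` A"]) simp
  qed
qed

lemma increasing_inj: "increasing S \<Longrightarrow> inj_on (\<lambda>(u, r, c). c) S"
  unfolding increasing_def inj_on_def by (auto simp: case_prod_beta) (metis less_irrefl)+

text \<open>On the antidiagonal the column is the position in the word, so the bound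
  \<open>d\<close> cuts the word after \<open>d\<close> letters.\<close>

lemma has_increasing_word:
  assumes "\<forall>x\<in>set w. 1 \<le> x"
  shows "has_increasing (layer (word_chain w)) d P m \<longleftrightarrow>
    (\<exists>A. inc_positions w A \<and> (\<forall>p\<in>A. P (w ! p - 1) \<and> p < d) \<and> card A = m)"
proof
  assume "has_increasing (layer (word_chain w)) d P m"
  then obtain S where S: "finite S" "card S = m" "increasing S"
    "\<And>u r c. (u, r, c) \<in> S \<Longrightarrow> P u \<and> (r, c) \<in> layer (word_chain w) u \<and> c \<le> d"
    unfolding has_increasing_def by blast
  define A where "A = (\<lambda>(u, r, c). c - 1) ` S"
  have c1: "1 \<le> c \<and> c \<le> length w \<and> w ! (c - 1) = Suc u" if "(u, r, c) \<in> S" for u r c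
    using S(4)[OF that] unfolding layer_word_chain by auto
  have inj: "inj_on (\<lambda>(u, r, c). c - 1) S"
  proof (rule inj_onI)
    fix x y assume xy: "x \<in> S" "y \<in> S" "(case x of (u, r, c) \<Rightarrow> c - 1) = (case y of (u, r, c) \<Rightarrow> c - 1)"
    obtain u r c v r' c' where e: "x = (u, r, c)" "y = (v, r', c')" by (metis prod_cases3)
    have "1 \<le> c" "1 \<le> c'" using c1 xy e by blast+
    then have "c = c'" using xy(3) e by simp
    then show "x = y" using increasingD[OF S(3), of u r c v r' c'] xy e by auto
  qed
  have "inc_positions w A"
    unfolding inc_positions_def
  proof (intro conjI ballI impI)
    show "A \<subseteq> {..<length w}" using c1 unfolding A_def by fastforce
    fix p q assume "p \<in> A" "q \<in> A" "p < q"
    then obtain u r c v r' c' where e: "(u, r, c) \<in> S" "(v, r', c') \<in> S" "p = c - 1" "q = c' - 1"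
      unfolding A_def by auto
    then show "w ! p < w ! q"
      using increasingD[OF S(3) e(1,2)] c1[OF e(1)] c1[OF e(2)] \<open>p < q\<close> by auto
  qed
  moreover have "P (w ! p - 1) \<and> p < d" if p: "p \<in> A" for p
  proof -
    obtain u r c where e: "(u, r, c) \<in> S" "p = c - 1" using p unfolding A_def by auto
    then show ?thesis using S(4)[OF e(1)] c1[OF e(1)] by auto
  qed
  moreover have "card A = m" unfolding A_def using card_image[OF inj] S(2) by simp
  ultimately show "\<exists>A. inc_positions w A \<and> (\<forall>p\<in>A. P (w ! p - 1) \<and> p < d) \<and> card A = m" by blast
next
  assume "\<exists>A. inc_positions w A \<and> (\<forall>p\<in>A. P (w ! p - 1) \<and> p < d) \<and> card A = m"
  then obtain A where A: "inc_positions w A" "\<forall>p\<in>A. P (w ! p - 1) \<and> p < d" "card A = m" by blast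
  define F where "F p = (w ! p - 1, length w - p, p + 1)" for p
  have inj: "inj_on F A" unfolding F_def by (rule inj_onI) simp
  have len: "p < length w" "1 \<le> w ! p" if "p \<in> A" for p
    using A(1) that assms unfolding inc_positions_def by auto
  have "increasing (F ` A)"
    unfolding increasing_def
  proof (intro allI impI)
    fix u r c v r' c' assume "(u, r, c) \<in> F ` A" "(v, r', c') \<in> F ` A"
    then obtain p q where pq: "p \<in> A" "q \<in> A" "(u, r, c) = F p" "(v, r', c') = F q" by auto
    have "w ! p < w ! q" if "p < q" using A(1) pq that unfolding inc_positions_def by blast
    moreover have "w ! q < w ! p" if "q < p" using A(1) pq that unfolding inc_positions_def by blast
    ultimately show "(u, r, c) = (v, r', c') \<or> u < v \<and> c < c' \<or> v < u \<and> c' < c"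
      using pq len[OF pq(1)] len[OF pq(2)] unfolding F_def by (cases p q rule: linorder_cases) auto
  qed
  moreover have "P u \<and> (r, c) \<in> layer (word_chain w) u \<and> c \<le> d" if "(u, r, c) \<in> F ` A" for u r c
    using that A(2) len unfolding F_def layer_word_chain by fastforce
  moreover have "card (F ` A) = m" using card_image[OF inj] A(3) by simp
  ultimately show "has_increasing (layer (word_chain w)) d P m"
    unfolding has_increasing_def using inc_positions_finite[OF A(1)] by (intro exI[of _ "F ` A"]) blast
qed

section \<open>Increasing subsequences of factors\<close>

lemma chain_cong: "(\<And>j. j \<le> J \<Longrightarrow> s j = s' j) \<Longrightarrow> chain s J \<Longrightarrow> chain s' J"
  unfolding chain_def by (metis Suc_leI le0 less_imp_le_nat)

lemma slide_cong:
  assumes "\<And>j. j \<le> J \<Longrightarrow> a j = a' j" "\<And>j. j \<le> J \<Longrightarrow> b j = b' j" "slide a b J" shows "slide a' b' J"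
  unfolding slide_def
proof (intro conjI allI impI)
  show "chain a' J" using chain_cong[OF assms(1) slide_chains(1)[OF assms(3)]] by blast
  show "chain b' J" using chain_cong[OF assms(2) slide_chains(2)[OF assms(3)]] by blast
  fix j
  show "strip (a' j) (b' j)" if "j \<le> J" using slide_strip[OF assms(3) that] assms(1,2) that by simp
  show "square (a' j) (b' j) (a' (Suc j)) (b' (Suc j))" if "j < J"
    using slide_square[OF assms(3) that] assms(1,2) that by simp
qed

lemma growth_iff_slides: "growth g I J \<longleftrightarrow> chain (g 0) J \<and> (\<forall>i<I. slide (g i) (g (Suc i)) J)"
proof
  assume "growth g I J"
  then show "chain (g 0) J \<and> (\<forall>i<I. slide (g i) (g (Suc i)) J)"
    using growth_slide growth_chain by blast
next
  assume a: "chain (g 0) J \<and> (\<forall>i<I. slide (g i) (g (Suc i)) J)"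
  show "growth g I J"
    unfolding growth_def
  proof (intro conjI allI impI)
    fix i assume "i \<le> I"
    then show "chain (g i) J"
    proof (cases i)
      case (Suc m)
      then show ?thesis using slide_chains(2)[of "g m" "g (Suc m)" J] a \<open>i \<le> I\<close> by simp
    qed (use a in simp)
  next
    fix j assume "j \<le> J"
    then show "chain (\<lambda>i. g i j) I"
      unfolding chain_def using a slide_strip chain_diagram by blast
  next
    fix i j assume "i < I" "j < J"
    then show "square (g i j) (g (Suc i) j) (g i (Suc j)) (g (Suc i) (Suc j))" using a slide_square by blast
  qed
qed

lemma growth_glue:
  assumes g: "growth g I J" and h: "growth h I' J" and eq: "\<And>j. j \<le> J \<Longrightarrow> g I j = h 0 j"
  shows "growth (\<lambda>i. if i \<le> I then g i else h (i - I)) (I + I') J"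
  unfolding growth_iff_slides
proof (intro conjI allI impI)
  show "chain (if 0 \<le> I then g 0 else h (0 - I)) J" using growth_chain[OF g, of 0] by simp
  fix i assume i: "i < I + I'"
  consider "i < I" | "i = I" | "I < i" by linarith
  then show "slide (if i \<le> I then g i else h (i - I)) (if Suc i \<le> I then g (Suc i) else h (Suc i - I)) J"
  proof cases
    case 1
    then show ?thesis using growth_slide[OF g] by simp
  next
    case 2
    then have "slide (h 0) (h (Suc 0)) J" using growth_slide[OF h, of 0] i by simp
    then have "slide (g I) (h (Suc 0)) J" by (rule slide_cong[rotated 2]) (use eq in auto)
    then show ?thesis using 2 by simp
  next
    case 3
    then have "slide (h (i - I)) (h (Suc (i - I))) J" using growth_slide[OF h, of "i - I"] i by simp
    then show ?thesis using 3 by (simp add: Suc_diff_le)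
  qed
qed

lemma growth_shift:
  assumes g: "growth g I J" and "i0 + I' \<le> I"
  shows "growth (\<lambda>i. g (i0 + i)) I' J"
  unfolding growth_iff_slides
  using assms growth_chain[OF g, of i0] growth_slide[OF g] by auto

text \<open>Full antidiagonals switch with full antidiagonals. This gives the staircase part of the
  diagram in which the letters added by \<open>prefixed\<close> are rectified.\<close>

lemma growth_stair: "growth (\<lambda>i j. stair (i + j)) I J"
proof -
  have "square (stair s) (stair (Suc s)) (stair (Suc s)) (stair (Suc (Suc s)))" for s
    unfolding square_def
  proof (intro conjI allI impI)
    fix r c assume "(r, c) \<in> stair (Suc (Suc s)) - stair s"
    then have rc: "1 \<le> r" "1 \<le> c" "s + 1 < r + c" "r + c \<le> s + 3" by (auto simp: stair_iff)
    show "(r, c) \<in> stair (Suc s) \<longleftrightarrow>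
        addable (stair s) r c \<and> \<not> ((r, c) \<in> stair (Suc s) \<and> maximal (stair (Suc (Suc s))) r c)"
    proof (cases "r + c = s + 2")
      case True
      then have "\<not> maximal (stair (Suc (Suc s))) r c" unfolding maximal_def using rc by (auto simp: stair_iff)
      moreover have "addable (stair s) r c" unfolding addable_def using True rc by (auto simp: stair_iff)
      ultimately show ?thesis using True rc by (auto simp: stair_iff)
    next
      case False
      then have "r + c = s + 3" using rc by simp
      then have "\<not> addable (stair s) r c" unfolding addable_def using rc by (auto simp: stair_iff)
      then show ?thesis using False rc by (auto simp: stair_iff)
    qed
  qed (rule strip_stair)+
  then show ?thesis
    unfolding growth_iff_slides slide_def chain_def
    by (auto simp: diagram_stair strip_stair)
qed

lemma has_path_shift:
  "has_path L n (s + p) (s + q) m \<longleftrightarrow> has_path (\<lambda>u. L (s + u)) n p q m"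
proof
  assume "has_path L n (s + p) (s + q) m"
  then obtain \<rho> where \<rho>: "is_path n (s + p) (s + q) \<rho>" "card (paid L (s + p) (s + q) \<rho>) \<le> m"
    unfolding has_path_def by blast
  let ?\<rho> = "\<lambda>u. \<rho> (s + u)"
  have "is_path n p q ?\<rho>" using \<rho>(1) unfolding is_path_def by (metis add_Suc_right add_le_cancel_left nat_add_left_cancel_less)
  moreover have "paid L (s + p) (s + q) \<rho> = (+) s ` paid (\<lambda>u. L (s + u)) p q ?\<rho>"
  proof (intro set_eqI iffI)
    fix u assume u: "u \<in> paid L (s + p) (s + q) \<rho>"
    then have "u = s + (u - s)" unfolding paid_def by simp
    moreover have "u - s \<in> paid (\<lambda>u. L (s + u)) p q ?\<rho>" using u unfolding paid_def by auto
    ultimately show "u \<in> (+) s ` paid (\<lambda>u. L (s + u)) p q ?\<rho>" by blast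
  qed (auto simp: paid_def)
  then have "card (paid (\<lambda>u. L (s + u)) p q ?\<rho>) = card (paid L (s + p) (s + q) \<rho>)"
    by (simp add: card_image)
  ultimately show "has_path (\<lambda>u. L (s + u)) n p q m" using \<rho>(2) unfolding has_path_def by metis
next
  assume "has_path (\<lambda>u. L (s + u)) n p q m"
  then obtain \<rho> where \<rho>: "is_path n p q \<rho>" "card (paid (\<lambda>u. L (s + u)) p q \<rho>) \<le> m"
    unfolding has_path_def by blast
  let ?\<rho> = "\<lambda>u. \<rho> (u - s)"
  have "is_path n (s + p) (s + q) ?\<rho>"
    using \<rho>(1) unfolding is_path_def by (auto simp: Suc_diff_le)
  moreover have "paid L (s + p) (s + q) ?\<rho> = (+) s ` paid (\<lambda>u. L (s + u)) p q \<rho>"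
  proof (intro set_eqI iffI)
    fix u assume u: "u \<in> paid L (s + p) (s + q) ?\<rho>"
    then have e: "u = s + (u - s)" unfolding paid_def by simp
    have "u - s \<in> paid (\<lambda>u. L (s + u)) p q \<rho>"
      using u e unfolding paid_def by (auto simp: Suc_diff_le)
    then show "u \<in> (+) s ` paid (\<lambda>u. L (s + u)) p q \<rho>" using e by blast
  qed (auto simp: paid_def Suc_diff_le)
  then have "card (paid L (s + p) (s + q) ?\<rho>) = card (paid (\<lambda>u. L (s + u)) p q \<rho>)"
    by (simp add: card_image)
  ultimately show "has_path L n (s + p) (s + q) m" using \<rho>(2) unfolding has_path_def by metis
qed

lemma has_path_cong:
  assumes "\<And>u. u < q \<Longrightarrow> L u = L' u" shows "has_path L n p q m \<longleftrightarrow> has_path L' n p q m"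
proof -
  have "paid L p q \<rho> = paid L' p q \<rho>" for \<rho> unfolding paid_def using assms by auto
  then show ?thesis unfolding has_path_def by simp
qed

text \<open>Staying in row \<open>n\<close> costs its length. Conversely, fix a column of row
  \<open>n\<close> and follow the box of the path in that column. When it first belongs to the
  diagram, the path has not just changed rows, because a higher box of the column would have been
  there before; so a letter is paid. Different columns give different letters, as a letter occurs at
  most once in a row.\<close>

lemma straight_has_path:
  assumes ch: "chain s J" and s: "s 0 = {}" and n: "1 \<le> n"
  shows "has_path (layer s) n 0 J m \<longleftrightarrow> row_length (s J) n \<le> m"
proof
  assume "row_length (s J) n \<le> m"
  moreover have "row_length (s J) n = card (paid (layer s) 0 J (\<lambda>_. n))"
    using card_row_layers[OF ch n, of 0 J] s unfolding paid_def row_length_def by simp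
  moreover have "is_path n 0 J (\<lambda>_. n)" unfolding is_path_def using n by simp
  ultimately show "has_path (layer s) n 0 J m" unfolding has_path_def by metis
next
  assume "has_path (layer s) n 0 J m"
  then obtain \<rho> where \<rho>: "is_path n 0 J \<rho>" "card (paid (layer s) 0 J \<rho>) \<le> m" unfolding has_path_def by blast
  have dJ: "diagram (s J)" using chain_diagram[OF ch] by simp
  have ex: "\<exists>u. u \<in> paid (layer s) 0 J \<rho> \<and> (\<rho> u, c) \<in> layer s u" if c: "c \<in> {1..row_length (s J) n}" for c
  proof -
    have "(n, c) \<in> s J" using row_length_iff[OF dJ] c n by simp
    then have top: "(\<rho> J, c) \<in> s J" using diagram_le[OF dJ, of n c "\<rho> J" c] \<rho>(1) c unfolding is_path_def by simp
    define t where "t = (LEAST t. (\<rho> t, c) \<in> s t)"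
    have t: "(\<rho> t, c) \<in> s t" unfolding t_def by (rule LeastI) (rule top)
    have tJ: "t \<le> J" unfolding t_def by (rule Least_le) (rule top)
    have "t \<noteq> 0"
    proof
      assume "t = 0"
      then show False using t s by simp
    qed
    then obtain u where u: "t = Suc u" by (cases t) auto
    have nu: "(\<rho> u, c) \<notin> s u" using not_less_Least[of u "\<lambda>t. (\<rho> t, c) \<in> s t"] u t_def by simp
    have st: "strip (s u) (s (Suc u))" using chain_strip[OF ch] u tJ by simp
    have le: "\<rho> u \<le> \<rho> (Suc u)" "1 \<le> \<rho> u" using \<rho>(1) u tJ unfolding is_path_def by auto
    have "\<rho> u = \<rho> (Suc u)"
    proof (rule ccontr)
      assume "\<rho> u \<noteq> \<rho> (Suc u)"
      then have "(\<rho> u, c) \<in> s u"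
        using strip_less[OF st, of "\<rho> (Suc u)" c "\<rho> u" c] t u le c by simp
      then show False using nu by simp
    qed
    then have "(\<rho> u, c) \<in> layer s u" using t u nu unfolding layer_def by simp
    moreover from this have "u \<in> paid (layer s) 0 J \<rho>"
      using \<open>\<rho> u = \<rho> (Suc u)\<close> u tJ unfolding paid_def by auto
    ultimately show ?thesis by blast
  qed
  define F where "F c = (SOME u. u \<in> paid (layer s) 0 J \<rho> \<and> (\<rho> u, c) \<in> layer s u)" for c
  have F: "F c \<in> paid (layer s) 0 J \<rho>" "(\<rho> (F c), c) \<in> layer s (F c)"
    if "c \<in> {1..row_length (s J) n}" for c
    using someI_ex[OF ex[OF that]] unfolding F_def by auto
  have uniq: "\<not> c < c'" if "(r, c) \<in> layer s u" "(r, c') \<in> layer s u" "u < J" for r c c' u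
  proof
    assume "c < c'"
    have st: "strip (s u) (s (Suc u))" using chain_strip[OF ch that(3)] .
    have "1 \<le> r" "1 \<le> c" using that(1) diagram_pos[OF strip_diagram(2)[OF st]] unfolding layer_def by blast+
    then have "(r, c) \<in> s u"
      using strip_less[OF st, of r c' r c] that(2) \<open>c < c'\<close> unfolding layer_def by simp
    then show False using that(1) unfolding layer_def by simp
  qed
  have "inj_on F {1..row_length (s J) n}"
  proof (rule inj_onI)
    fix c c' assume c: "c \<in> {1..row_length (s J) n}" "c' \<in> {1..row_length (s J) n}" "F c = F c'"
    have "F c < J" using F(1)[OF c(1)] unfolding paid_def by simp
    then have "\<not> c < c'" "\<not> c' < c" using uniq F(2)[OF c(1)] F(2)[OF c(2)] c(3) by metis+
    then show "c = c'" by simp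
  qed
  then have "card {1..row_length (s J) n} \<le> card (paid (layer s) 0 J \<rho>)"
    by (rule card_inj_on_le) (use F finite_paid in auto)
  then show "row_length (s J) n \<le> m" using \<rho>(2) by simp
qed

text \<open>The columns of a sequence are distinct. A column that reaches row \<open>n\<close> in
  \<open>s 0\<close> is complete and holds no letter; each other column up to \<open>d\<close> can
  be used through its letter in row \<open>n\<close>.\<close>

lemma bottom_row_has_increasing:
  assumes ch: "chain s K" and n: "1 \<le> n" and rows: "\<And>r c. (r, c) \<in> s K \<Longrightarrow> c \<le> d \<Longrightarrow> r \<le> n"
    and full: "\<And>c. 1 \<le> c \<Longrightarrow> c \<le> d \<Longrightarrow> (n, c) \<in> s K"
  shows "has_increasing (layer s) d (\<lambda>u. u < K) m \<longleftrightarrow> m \<le> d - row_length (s 0) n"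
proof
  have d0: "diagram (s 0)" using chain_diagram[OF ch] by simp
  assume "has_increasing (layer s) d (\<lambda>u. u < K) m"
  then obtain S where S: "finite S" "card S = m" "increasing S"
    "\<And>u r c. (u, r, c) \<in> S \<Longrightarrow> u < K \<and> (r, c) \<in> layer s u \<and> c \<le> d"
    unfolding has_increasing_def by blast
  have "(\<lambda>(u, r, c). c) ` S \<subseteq> {row_length (s 0) n + 1..d}"
  proof
    fix c assume "c \<in> (\<lambda>(u, r, c). c) ` S"
    then obtain u r where e: "(u, r, c) \<in> S" by auto
    then have u: "u < K" "(r, c) \<in> s (Suc u)" "(r, c) \<notin> s u" "c \<le> d" using S(4) unfolding layer_def by blast+
    have rK: "(r, c) \<in> s K" using chain_mono[OF ch, of "Suc u" K] u by auto
    have pos: "1 \<le> r" "1 \<le> c" using diagram_pos[OF chain_diagram[OF ch order_refl] rK] by auto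
    have "\<not> c \<le> row_length (s 0) n"
    proof
      assume "c \<le> row_length (s 0) n"
      then have "(n, c) \<in> s 0" using row_length_iff[OF d0] n pos by simp
      then have "(r, c) \<in> s 0" using diagram_le[OF d0, of n c r c] rows[OF rK u(4)] pos by simp
      then show False using u chain_mono[OF ch, of 0 u] by auto
    qed
    then show "c \<in> {row_length (s 0) n + 1..d}" using u by simp
  qed
  then have "card ((\<lambda>(u, r, c). c) ` S) \<le> card {row_length (s 0) n + 1..d}" by (intro card_mono) auto
  then show "m \<le> d - row_length (s 0) n" using card_image[OF increasing_inj[OF S(3)]] S(2) by simp
next
  have d0: "diagram (s 0)" using chain_diagram[OF ch] by simp
  assume m: "m \<le> d - row_length (s 0) n"
  let ?C = "{row_length (s 0) n + 1..row_length (s 0) n + m}"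
  have "\<exists>u. u < K \<and> (n, c) \<in> layer s u" if c: "c \<in> ?C" for c
  proof -
    have "1 \<le> c" "c \<le> d" using c m by auto
    then have "(n, c) \<in> s K" by (rule full)
    moreover have "(n, c) \<notin> s 0" using row_length_iff[OF d0, of n c] c by simp
    ultimately show ?thesis using layer_between[of "(n, c)" s K 0] by auto
  qed
  then obtain U where U: "\<And>c. c \<in> ?C \<Longrightarrow> U c < K \<and> (n, c) \<in> layer s (U c)" by metis
  define S where "S = (\<lambda>c. (U c, n, c)) ` ?C"
  have mono: "U c < U c'" if "c \<in> ?C" "c' \<in> ?C" "c < c'" for c c'
  proof (rule ccontr)
    assume n': "\<not> U c < U c'"
    have st: "strip (s (U c')) (s (Suc (U c')))" using chain_strip[OF ch] U[OF that(2)] by simp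
    have "(n, c) \<in> s (U c')"
      using strip_less[OF st, of n c' n c] U[OF that(2)] n that unfolding layer_def by auto
    moreover have "s (U c') \<subseteq> s (U c)" using chain_mono[OF ch, of "U c'" "U c"] n' U[OF that(1)] by simp
    ultimately show False using U[OF that(1)] unfolding layer_def by blast
  qed
  have "increasing S"
    unfolding increasing_def
  proof (intro allI impI)
    fix u r c v r' c' assume "(u, r, c) \<in> S" "(v, r', c') \<in> S"
    then have e: "c \<in> ?C" "c' \<in> ?C" "u = U c" "v = U c'" "r = n" "r' = n" unfolding S_def by auto
    then show "(u, r, c) = (v, r', c') \<or> u < v \<and> c < c' \<or> v < u \<and> c' < c"
      using mono[of c c'] mono[of c' c] by (cases c c' rule: linorder_cases) auto
  qed
  moreover have "card S = m" unfolding S_def by (subst card_image) (auto intro: inj_onI)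
  moreover have "u < K \<and> (r, c) \<in> layer s u \<and> c \<le> d" if "(u, r, c) \<in> S" for u r c
    using that U m unfolding S_def by auto
  ultimately show "has_increasing (layer s) d (\<lambda>u. u < K) m"
    unfolding has_increasing_def using S_def by (intro exI[of _ S]) auto
qed

text \<open>Dots travel down and to the right while the letters are processed, so the last state
  bounds all earlier ones.\<close>

lemma slide_dots:
  assumes sl: "slide a b J" and d: "\<And>r c. (r, c) \<in> b J - a J \<Longrightarrow> c \<le> d" and j: "j \<le> J"
  shows "(r, c) \<in> b j - a j \<Longrightarrow> c \<le> d"
  using j
proof (induction j arbitrary: r c rule: inc_induct)
  case base
  then show ?case using d by blast
next
  case (step j)
  have sq: "square (a j) (b j) (a (Suc j)) (b (Suc j))" using slide_square[OF sl] step by simp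
  have D: "(r, c) \<in> b (Suc j)" using step strip_subset[OF square_strips(2)[OF sq]] by blast
  show ?case
  proof (cases "(r, c) \<in> a (Suc j)")
    case False
    then show ?thesis using step.IH D by blast
  next
    case True
    then have "(r + 1, c) \<in> b (Suc j) \<or> (r, c + 1) \<in> b (Suc j)"
      using square_moved_rev[OF sq] step by blast
    moreover have "(r + 1, c) \<notin> a (Suc j)" "(r, c + 1) \<notin> a (Suc j)"
      using True step square_strips(3)[OF sq] unfolding strip_def by blast+
    ultimately have "c \<le> d \<or> c + 1 \<le> d" using step.IH by blast
    then show ?thesis by linarith
  qed
qed

text \<open>The chain from \<open>stair n\<close> to its union with the rectangle of \<open>n\<close> rows and \<open>d\<close> columns.\<close>

definition completion :: "nat \<Rightarrow> nat \<Rightarrow> nat \<Rightarrow> box set" where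
  "completion n d l = stair n \<union> {(r, c). 1 \<le> r \<and> r \<le> n \<and> 1 \<le> c \<and> c \<le> d \<and> r + c \<le> n + l + 1}"

lemma completion_iff:
  "(r, c) \<in> completion n d l \<longleftrightarrow> 1 \<le> r \<and> 1 \<le> c \<and> (r + c \<le> n + 1 \<or> (r \<le> n \<and> c \<le> d \<and> r + c \<le> n + l + 1))"
  unfolding completion_def by (auto simp: stair_iff)

lemma completion_0: "completion n d 0 = stair n"
  unfolding completion_def stair_def by auto

lemma chain_completion: "chain (completion n d) J"
proof -
  have dia: "diagram (completion n d l)" for l
    unfolding diagram_def
  proof (intro conjI allI impI)
    have "completion n d l \<subseteq> stair n \<union> {..n} \<times> {..d}" unfolding completion_def by auto
    moreover have "finite (stair n)" using diagram_stair unfolding diagram_def by blast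
    ultimately show "finite (completion n d l)" by (meson finite_SigmaI finite_UnI finite_atMost finite_subset)
  qed (auto simp: completion_iff)
  then show ?thesis unfolding chain_def strip_def by (auto simp: completion_iff)
qed

text \<open>The antidiagonals between \<open>stair (n - a)\<close> and \<open>stair (n - 1)\<close> act as letters smaller than those
  of the word. They supply \<open>a - 1\<close> steps of an increasing subsequence, which makes it optimal to
  use only positions from \<open>a\<close> on.\<close>

definition prefixed :: "nat list \<Rightarrow> nat \<Rightarrow> nat \<Rightarrow> box set" where
  "prefixed w a i = (if i \<le> a - 1 then stair (length w - a + i) else word_chain w (i - (a - 1)))"

text \<open>The part outside the factor has at most \<open>a - 1\<close> members. If it uses no word
  position, its letters are among the \<open>a - 1\<close> prefix letters. If it uses one before
  \<open>a\<close>, the prefix boxes lie to the left of that position, so all columns are below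
  \<open>a\<close>.\<close>

lemma prefixed_has_increasing:
  assumes w: "w \<in> words n" "set w \<subseteq> {1..k}" and ab: "1 \<le> a" "a \<le> b" "b \<le> n"
  shows "has_increasing (layer (prefixed w a)) b (\<lambda>u. u < a - 1 + k) m \<longleftrightarrow> m \<le> a - 1 + lis (factor w a b)"
proof -
  have len: "length w = n" and pos: "\<And>x. x \<in> set w \<Longrightarrow> 1 \<le> x" using w(1) unfolding words_def by auto
  have lay1: "layer (prefixed w a) i = {(r, c). 1 \<le> r \<and> 1 \<le> c \<and> r + c = n - a + i + 2}" if "i < a - 1" for i
    using that layer_stair[of "n - a + i"] unfolding layer_def prefixed_def len by simp
  have w0: "prefixed w a i = word_chain w (i - (a - 1))" if "a - 1 \<le> i" for i
    using that word_chain_0[OF w(1)] ab unfolding prefixed_def len by auto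
  have lay2: "layer (prefixed w a) i = layer (word_chain w) (i - (a - 1))" if "a - 1 \<le> i" for i
    using that w0[OF that] w0[of "Suc i"] unfolding layer_def by (simp add: Suc_diff_le)
  show ?thesis
  proof
    assume "has_increasing (layer (prefixed w a)) b (\<lambda>u. u < a - 1 + k) m"
    then obtain S where S: "finite S" "card S = m" "increasing S"
      "\<And>u r c. (u, r, c) \<in> S \<Longrightarrow> u < a - 1 + k \<and> (r, c) \<in> layer (prefixed w a) u \<and> c \<le> b"
      unfolding has_increasing_def by blast
    define S1 where "S1 = {(u, r, c) \<in> S. u < a - 1}"
    define S2 where "S2 = {(u, r, c) \<in> S. a - 1 \<le> u \<and> c < a}"
    define S3 where "S3 = {(u, r, c) \<in> S. a - 1 \<le> u \<and> a \<le> c}"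
    have SU: "S = S1 \<union> S2 \<union> S3" "(S1 \<union> S2) \<inter> S3 = {}" unfolding S1_def S2_def S3_def by auto
    have word: "1 \<le> c \<and> c \<le> n \<and> c \<le> b \<and> w ! (c - 1) = Suc (u - (a - 1))"
      if "(u, r, c) \<in> S" "a - 1 \<le> u" for u r c
      using S(4)[OF that(1)] lay2[OF that(2)] unfolding layer_word_chain len by auto
    have col1: "1 \<le> c" if "(u, r, c) \<in> S" for u r c
    proof (cases "u < a - 1")
      case True
      then show ?thesis using S(4)[OF that] lay1 by auto
    next
      case False
      then show ?thesis using word[OF that] by simp
    qed
    have card12: "card (S1 \<union> S2) \<le> a - 1"
    proof (cases "S2 = {}")
      case True
      have "inj_on fst S1"
      proof (rule inj_onI)
        fix x y assume xy: "x \<in> S1" "y \<in> S1" "fst x = fst y"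
        obtain u r c v r' c' where e: "x = (u, r, c)" "y = (v, r', c')" by (metis prod_cases3)
        then show "x = y" using increasingD[OF S(3), of u r c v r' c'] xy unfolding S1_def by auto
      qed
      moreover have "fst ` S1 \<subseteq> {..<a - 1}" unfolding S1_def by auto
      ultimately have "card S1 \<le> card {..<a - 1}" by (metis card_inj_on_le finite_lessThan)
      then show ?thesis using True by simp
    next
      case False
      then obtain v p q where z: "(v, p, q) \<in> S2" by auto
      have "(\<lambda>(u, r, c). c) ` (S1 \<union> S2) \<subseteq> {1..a - 1}"
      proof
        fix c assume "c \<in> (\<lambda>(u, r, c). c) ` (S1 \<union> S2)"
        then obtain u r where e: "(u, r, c) \<in> S1 \<union> S2" by auto
        then have eS: "(u, r, c) \<in> S" unfolding S1_def S2_def by auto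
        have "c < a"
        proof (cases "(u, r, c) \<in> S1")
          case True
          then show ?thesis
            using increasingD[OF S(3) eS, of v p q] z unfolding S1_def S2_def by auto
        next
          case False
          then show ?thesis using e unfolding S2_def by auto
        qed
        then show "c \<in> {1..a - 1}" using col1[OF eS] by simp
      qed
      moreover have "inj_on (\<lambda>(u, r, c). c) (S1 \<union> S2)"
        by (rule inj_on_subset[OF increasing_inj[OF S(3)]]) (use SU(1) in blast)
      ultimately have "card (S1 \<union> S2) \<le> card {1..a - 1}" by (metis card_inj_on_le finite_atLeastAtMost)
      then show ?thesis by simp
    qed
    define A where "A = (\<lambda>(u, r, c). c - 1) ` S3"
    have inj: "inj_on (\<lambda>(u, r, c). c - 1) S3"
    proof (rule inj_onI)
      fix x y assume xy: "x \<in> S3" "y \<in> S3" "(case x of (u, r, c) \<Rightarrow> c - 1) = (case y of (u, r, c) \<Rightarrow> c - 1)"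
      obtain u r c v r' c' where e: "x = (u, r, c)" "y = (v, r', c')" by (metis prod_cases3)
      then have eS: "(u, r, c) \<in> S" "(v, r', c') \<in> S" using xy unfolding S3_def by auto
      then have "c = c'" using col1[OF eS(1)] col1[OF eS(2)] xy(3) e by simp
      then show "x = y" using increasingD[OF S(3) eS] e by auto
    qed
    have "inc_positions w A"
      unfolding inc_positions_def
    proof (intro conjI ballI impI)
      show "A \<subseteq> {..<length w}" using word len unfolding A_def S3_def by fastforce
      fix p q assume "p \<in> A" "q \<in> A" "p < q"
      then obtain u r c v r' c' where e: "(u, r, c) \<in> S" "(v, r', c') \<in> S" "p = c - 1" "q = c' - 1"
        "a - 1 \<le> u" "a - 1 \<le> v"
        unfolding A_def S3_def by auto
      then have "u < v" using increasingD[OF S(3) e(1,2)] \<open>p < q\<close> by auto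
      then show "w ! p < w ! q" using word[OF e(1,5)] word[OF e(2,6)] e by simp
    qed
    moreover have "A \<subseteq> {a - 1..<b}"
    proof
      fix p assume "p \<in> A"
      then obtain u r c where e: "(u, r, c) \<in> S" "a - 1 \<le> u" "a \<le> c" "p = c - 1" unfolding A_def S3_def by auto
      then show "p \<in> {a - 1..<b}" using word[OF e(1,2)] by auto
    qed
    ultimately have "card A \<le> lis (factor w a b)" using le_lis_factor ab len by blast
    then have "card S3 \<le> lis (factor w a b)" using card_image[OF inj] unfolding A_def by simp
    moreover have "card S = card (S1 \<union> S2) + card S3"
      using card_Un_disjoint[OF _ _ SU(2)] S(1) SU(1) by (metis finite_Un)
    ultimately show "m \<le> a - 1 + lis (factor w a b)" using card12 S(2) by simp
  next
    assume m: "m \<le> a - 1 + lis (factor w a b)"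
    obtain A where A: "inc_positions w A" "A \<subseteq> {a - 1..<b}" "card A = lis (factor w a b)"
      using le_lis_factor[of a b w "lis (factor w a b)"] ab len by auto
    \<comment> \<open>The first row below \<open>stair (n - a)\<close>: it has the prefix letter
      \<open>i\<close> in column \<open>i + 1\<close>, left of all columns of the factor.\<close>
    define F1 where "F1 i = (i, n - a + 1, i + 1)" for i :: nat
    define F2 where "F2 p = (a - 1 + (w ! p - 1), n - p, p + 1)" for p
    define S where "S = F1 ` {..<a - 1} \<union> F2 ` A"
    have pA: "p < n" "1 \<le> w ! p" "w ! p \<le> k" "a - 1 \<le> p" "p < b" if "p \<in> A" for p
    proof -
      show pn: "p < n" using A(1) that len unfolding inc_positions_def by auto
      then have "w ! p \<in> set w" using len by simp
      then show "1 \<le> w ! p" "w ! p \<le> k" using w(2) by auto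
      show "a - 1 \<le> p" "p < b" using A(2) that by auto
    qed
    have incA: "w ! p < w ! q" if "p \<in> A" "q \<in> A" "p < q" for p q
      using A(1) that unfolding inc_positions_def by blast
    have "increasing S"
      unfolding increasing_def
    proof (intro allI impI)
      fix u r c v r' c' assume e: "(u, r, c) \<in> S" "(v, r', c') \<in> S"
      have cases: "(u < a - 1 \<and> r = n - a + 1 \<and> c = u + 1) \<or> (\<exists>p\<in>A. (u, r, c) = F2 p)"
        if "(u, r, c) \<in> S" for u r c
        using that unfolding S_def F1_def by auto
      show "(u, r, c) = (v, r', c') \<or> u < v \<and> c < c' \<or> v < u \<and> c' < c"
      proof (cases "u < a - 1")
        case u: True
        then have e1: "r = n - a + 1" "c = u + 1" using cases[OF e(1)] unfolding F2_def by auto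
        show ?thesis
        proof (cases "v < a - 1")
          case True
          then have "r' = n - a + 1" "c' = v + 1" using cases[OF e(2)] unfolding F2_def by auto
          then show ?thesis using e1 by (cases u v rule: linorder_cases) auto
        next
          case False
          then obtain q where "q \<in> A" "(v, r', c') = F2 q" using cases[OF e(2)] by blast
          then show ?thesis using e1 u pA[of q] unfolding F2_def by auto
        qed
      next
        case u: False
        then obtain p where p: "p \<in> A" "(u, r, c) = F2 p" using cases[OF e(1)] by blast
        show ?thesis
        proof (cases "v < a - 1")
          case True
          then have "r' = n - a + 1" "c' = v + 1" using cases[OF e(2)] unfolding F2_def by auto
          then show ?thesis using True p pA[of p] unfolding F2_def by auto
        next
          case False
          then obtain q where q: "q \<in> A" "(v, r', c') = F2 q" using cases[OF e(2)] by blast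
          show ?thesis
            using p q incA[OF p(1) q(1)] incA[OF q(1) p(1)] pA[OF p(1)] pA[OF q(1)] unfolding F2_def
            by (cases p q rule: linorder_cases) auto
        qed
      qed
    qed
    have S4: "u < a - 1 + k \<and> (r, c) \<in> layer (prefixed w a) u \<and> c \<le> b" if uS: "(u, r, c) \<in> S" for u r c
    proof (cases "u < a - 1")
      case True
      then have "r = n - a + 1" "c = u + 1" using uS unfolding S_def F1_def F2_def by auto
      then show ?thesis using True lay1[OF True] ab by auto
    next
      case False
      then have "(u, r, c) \<notin> F1 ` {..<a - 1}" unfolding F1_def by auto
      then obtain p where p: "p \<in> A" "(u, r, c) = F2 p" using uS unfolding S_def by blast
      then have "layer (prefixed w a) u = layer (word_chain w) (w ! p - 1)"
        using lay2[of u] unfolding F2_def by simp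
      then show ?thesis using p pA[OF p(1)] len unfolding F2_def layer_word_chain by auto
    qed
    have fin: "finite S" unfolding S_def using inc_positions_finite[OF A(1)] by simp
    have "card S = a - 1 + lis (factor w a b)"
    proof -
      have "inj_on F1 {..<a - 1}" "inj_on F2 A" unfolding F1_def F2_def by (auto intro: inj_onI)
      moreover have "F1 ` {..<a - 1} \<inter> F2 ` A = {}" unfolding F1_def F2_def by auto
      ultimately show ?thesis unfolding S_def
        using card_Un_disjoint[of "F1 ` {..<a - 1}" "F2 ` A"] inc_positions_finite[OF A(1)] A(3)
        by (simp add: card_image)
    qed
    then obtain S' where S': "S' \<subseteq> S" "card S' = m" using m obtain_subset_with_card_n by metis
    have "increasing S'" using \<open>increasing S\<close> S'(1) unfolding increasing_def by blast
    moreover have "u < a - 1 + k \<and> (r, c) \<in> layer (prefixed w a) u \<and> c \<le> b" if "(u, r, c) \<in> S'" for u r c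
      using S4 S'(1) that by blast
    ultimately show "has_increasing (layer (prefixed w a)) b (\<lambda>u. u < a - 1 + k) m"
      unfolding has_increasing_def using fin S' finite_subset by (intro exI[of _ S']) blast
  qed
qed

lemma chain_prefixed:
  assumes w: "w \<in> words n" and a: "1 \<le> a" "a \<le> n"
  shows "chain (prefixed w a) K"
  unfolding chain_def
proof (intro conjI allI impI)
  have len: "length w = n" using w unfolding words_def by simp
  show "diagram (prefixed w a 0)" unfolding prefixed_def using diagram_stair by simp
  fix i
  show "strip (prefixed w a i) (prefixed w a (Suc i))"
  proof (cases "i < a - 1")
    case True
    then show ?thesis using strip_stair unfolding prefixed_def by simp
  next
    case False
    have w0: "prefixed w a i = word_chain w (i - (a - 1))" if "a - 1 \<le> i" for i
      using that word_chain_0[OF w] a unfolding prefixed_def len by auto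
    have "strip (word_chain w (i - (a - 1))) (word_chain w (Suc (i - (a - 1))))"
      by (rule chain_strip[OF chain_word_chain[of w "Suc (i - (a - 1))"]]) (use len a in auto)
    then show ?thesis using w0[of i] w0[of "Suc i"] False by (simp add: Suc_diff_le)
  qed
qed

text \<open>The left-hand side only depends on the right column of the growth diagram. The path is moved
  along the rows to a straight shape, where it measures the last row; the increasing subsequence is
  moved along the columns to a filling of the rectangle \<open>completion n b (b - 1)\<close>, where it measures
  the part of the last row not in that straight shape.\<close>

lemma right_column_lis:
  assumes g: "growth g (n - 1) k" and left: "\<And>i. i \<le> n - 1 \<Longrightarrow> g i 0 = stair i"
    and bottom: "\<And>j. j \<le> k \<Longrightarrow> g (n - 1) j = word_chain w j"
    and w: "w \<in> words n" "set w \<subseteq> {1..k}" and ab: "1 \<le> a" "a \<le> b" "b \<le> n"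
    and \<zeta>: "\<zeta> = (\<lambda>u. if u \<le> n - 1 then g u k else completion n b (u - (n - 1)))"
  shows "has_path (layer \<zeta>) n (a - 1) (n - 1 + (b - 1)) m \<longleftrightarrow> b + 1 - a \<le> m + lis (factor w a b)"
proof -
  define K where "K = a - 1 + k"
  have len: "length w = n" using w unfolding words_def by simp
  have n1: "1 \<le> n" using ab by simp
  have pref: "prefixed w a i = word_chain w (i - (a - 1))" if "a - 1 \<le> i" for i
    using that word_chain_0[OF w(1)] ab unfolding prefixed_def len by auto
  have top: "prefixed w a K = stair n" using pref[of K] word_chain_top[OF w(1) n1 w(2)] unfolding K_def by simp
  \<comment> \<open>The extended word is switched with the completion letters; \<open>b - 1\<close>
    antidiagonals complete \<open>stair n\<close> to contain the rectangle with \<open>n\<close>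
    rows and \<open>b\<close> columns.\<close>
  obtain Q where Q: "growth Q K (b - 1)" "\<And>i. i \<le> K \<Longrightarrow> Q i 0 = prefixed w a i"
    "\<And>l. l \<le> b - 1 \<Longrightarrow> Q K l = completion n b l"
    using growth_exists_up[OF chain_prefixed[OF w(1), of a K] chain_completion[of n b "b - 1"]]
      top ab by (auto simp: completion_0)
  have sub: "Q i l \<subseteq> completion n b l" if "i \<le> K" "l \<le> b - 1" for i l
    using chain_mono[OF growth_chain_column[OF Q(1) that(2)], of i K] that Q(3) by simp
  \<comment> \<open>The shape reached from \<open>stair (n - a)\<close> by the completion letters
    after they have passed the extended word.\<close>
  define \<kappa> where "\<kappa> = Q 0 (b - 1)"
  \<comment> \<open>The diagram of the word continued downwards by the word part of
    \<open>Q\<close>. Its right column is \<open>\<zeta>\<close>, and its left column begins with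
    the staircases.\<close>
  define H where "H u j = (if u \<le> n - 1 then g u j else Q (a - 1 + j) (u - (n - 1)))" for u j
  have H: "growth H (n - 1 + (b - 1)) k"
  proof -
    have Q': "growth (\<lambda>l j. Q (a - 1 + j) l) (b - 1) k"
      using growth_transpose[OF growth_shift[OF Q(1), of "a - 1" k]] unfolding K_def by simp
    have "g (n - 1) j = Q (a - 1 + j) 0" if "j \<le> k" for j
      using that bottom Q(2)[of "a - 1 + j"] pref[of "a - 1 + j"] unfolding K_def by simp
    then have "growth (\<lambda>u. if u \<le> n - 1 then g u else (\<lambda>j. Q (a - 1 + j) (u - (n - 1)))) (n - 1 + (b - 1)) k"
      by (rule growth_glue[OF g Q'])
    moreover have "H = (\<lambda>u. if u \<le> n - 1 then g u else (\<lambda>j. Q (a - 1 + j) (u - (n - 1))))"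
      unfolding H_def by (intro ext) simp
    ultimately show ?thesis by simp
  qed
  have "has_path (layer (\<lambda>u. H u 0)) n (a - 1) (n - 1 + (b - 1)) m \<longleftrightarrow>
      has_path (layer (\<lambda>u. H u k)) n (a - 1) (n - 1 + (b - 1)) m"
  proof (rule growth_column_invariant[where Q = "\<lambda>L. has_path L n (a - 1) (n - 1 + (b - 1)) m"])
    fix j assume j: "j < k"
    have "r \<le> n" if "(r, c) \<in> H (n - 1 + (b - 1)) (Suc j)" for r c
    proof (cases "b = 1")
      case True
      then have "(r, c) \<in> stair n"
        using that bottom[of "Suc j"] j word_chain_bounds(2)[of w "Suc j"] len n1 unfolding H_def by auto
      then show ?thesis by (auto simp: stair_iff)
    next
      case False
      then have "\<not> n - 1 + (b - 1) \<le> n - 1" "n - 1 + (b - 1) - (n - 1) = b - 1" using ab by auto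
      then have "(r, c) \<in> Q (a - 1 + Suc j) (b - 1)" using that unfolding H_def by (simp only: if_False)
      moreover have "a - 1 + Suc j \<le> K" unfolding K_def using j by simp
      ultimately have "(r, c) \<in> completion n b (b - 1)" using sub[of "a - 1 + Suc j" "b - 1"] by blast
      then show ?thesis by (auto simp: completion_iff)
    qed
    then show "has_path (layer (\<lambda>i. H i j)) n (a - 1) (n - 1 + (b - 1)) m \<longleftrightarrow>
        has_path (layer (\<lambda>i. H i (Suc j))) n (a - 1) (n - 1 + (b - 1)) m"
      by (rule slide_has_path[OF growth_slide_column[OF H j] order_refl])
  qed
  moreover have "has_path (layer (\<lambda>u. H u k)) n (a - 1) (n - 1 + (b - 1)) m \<longleftrightarrow>
      has_path (layer \<zeta>) n (a - 1) (n - 1 + (b - 1)) m"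
  proof (rule has_path_cong)
    fix u assume "u < n - 1 + (b - 1)"
    moreover have "H u k = \<zeta> u" if "u \<le> n - 1 + (b - 1)" for u
      using that Q(3)[of "u - (n - 1)"] unfolding H_def \<zeta> K_def by auto
    ultimately show "layer (\<lambda>u. H u k) u = layer \<zeta> u" unfolding layer_def by simp
  qed
  moreover have "has_path (layer (\<lambda>u. H u 0)) n (a - 1) (n - 1 + (b - 1)) m \<longleftrightarrow> row_length \<kappa> n \<le> m"
  proof -
    \<comment> \<open>From \<open>stair (a - 1)\<close> on, the left column of \<open>H\<close> is
      the right column of \<open>G\<close>. The left column of \<open>G\<close> is straight: it
      grows from the empty diagram to \<open>\<kappa>\<close>. Hence the path starts at the letter
      \<open>a - 1\<close>.\<close>
    define G where "G u i = (if u \<le> n - a then stair (u + i) else Q i (u - (n - a)))" for u i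
    have G: "growth G (n - a + (b - 1)) (a - 1)"
    proof -
      have Q': "growth (\<lambda>l i. Q i l) (b - 1) (a - 1)"
        using growth_transpose[OF growth_shift[OF Q(1), of 0 "a - 1"]] unfolding K_def by simp
      have "stair (n - a + i) = Q i 0" if "i \<le> a - 1" for i
        using that Q(2)[of i] unfolding prefixed_def K_def len by simp
      then have "growth (\<lambda>u. if u \<le> n - a then (\<lambda>i. stair (u + i)) else (\<lambda>i. Q i (u - (n - a)))) (n - a + (b - 1)) (a - 1)"
        by (rule growth_glue[OF growth_stair Q'])
      moreover have "G = (\<lambda>u. if u \<le> n - a then (\<lambda>i. stair (u + i)) else (\<lambda>i. Q i (u - (n - a))))"
        unfolding G_def by (intro ext) simp
      ultimately show ?thesis by simp
    qed
    have eq: "n - 1 + (b - 1) = a - 1 + (n - a + (b - 1))" using ab by simp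
    have "has_path (layer (\<lambda>u. H u 0)) n (a - 1) (n - 1 + (b - 1)) m \<longleftrightarrow>
        has_path (\<lambda>u. layer (\<lambda>u. H u 0) (a - 1 + u)) n 0 (n - a + (b - 1)) m"
      unfolding eq using has_path_shift[of "layer (\<lambda>u. H u 0)" n "a - 1" 0 "n - a + (b - 1)" m]
      by (simp only: add_0_right)
    also have "\<dots> \<longleftrightarrow> has_path (layer (\<lambda>u. G u (a - 1))) n 0 (n - a + (b - 1)) m"
    proof (rule has_path_cong)
      fix u assume u: "u < n - a + (b - 1)"
      have "H (a - 1 + u) 0 = G u (a - 1)" for u
      proof (cases "u \<le> n - a")
        case True
        then have "a - 1 + u \<le> n - 1" using ab by simp
        then show ?thesis using True left[of "a - 1 + u"] unfolding H_def G_def by (simp add: add.commute)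
      next
        case False
        then have "\<not> a - 1 + u \<le> n - 1" "a - 1 + u - (n - 1) = u - (n - a)" using ab by auto
        then show ?thesis using False unfolding H_def G_def by simp
      qed
      from this[of u] this[of "Suc u"] show "layer (\<lambda>u. H u 0) (a - 1 + u) = layer (\<lambda>u. G u (a - 1)) u"
        unfolding layer_def by simp
    qed
    also have "\<dots> \<longleftrightarrow> has_path (layer (\<lambda>u. G u 0)) n 0 (n - a + (b - 1)) m"
    proof (rule growth_column_invariant[where Q = "\<lambda>L. has_path L n 0 (n - a + (b - 1)) m", symmetric])
      fix j assume j: "j < a - 1"
      have "r \<le> n" if rc: "(r, c) \<in> G (n - a + (b - 1)) (Suc j)" for r c
      proof (cases "b = 1")
        case True
        then have "(r, c) \<in> stair (n - a + Suc j)" using rc unfolding G_def by simp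
        then show ?thesis using j ab by (auto simp: stair_iff)
      next
        case False
        then have "\<not> n - a + (b - 1) \<le> n - a" "n - a + (b - 1) - (n - a) = b - 1" using ab by auto
        then have "(r, c) \<in> Q (Suc j) (b - 1)" using rc unfolding G_def by (simp only: if_False)
        moreover have "Suc j \<le> K" unfolding K_def using j by simp
        ultimately have "(r, c) \<in> completion n b (b - 1)" using sub[of "Suc j" "b - 1"] by blast
        then show ?thesis by (auto simp: completion_iff)
      qed
      then show "has_path (layer (\<lambda>i. G i j)) n 0 (n - a + (b - 1)) m \<longleftrightarrow>
          has_path (layer (\<lambda>i. G i (Suc j))) n 0 (n - a + (b - 1)) m"
        by (rule slide_has_path[OF growth_slide_column[OF G j] order_refl])
    qed
    also have "\<dots> \<longleftrightarrow> row_length (G (n - a + (b - 1)) 0) n \<le> m"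
      by (rule straight_has_path[OF growth_chain_column[OF G] _ n1]) (simp_all add: G_def stair_0)
    also have "G (n - a + (b - 1)) 0 = \<kappa>"
    proof (cases "b = 1")
      case True
      then show ?thesis using Q(2)[of 0] unfolding G_def \<kappa>_def prefixed_def len by simp
    next
      case False
      then have "\<not> n - a + (b - 1) \<le> n - a" "n - a + (b - 1) - (n - a) = b - 1" using ab by auto
      then show ?thesis unfolding G_def \<kappa>_def by (simp only: if_False)
    qed
    finally show ?thesis .
  qed
  ultimately have path: "has_path (layer \<zeta>) n (a - 1) (n - 1 + (b - 1)) m \<longleftrightarrow> row_length \<kappa> n \<le> m" by blast
  \<comment> \<open>Across \<open>Q\<close> the extended word becomes a filling of what
    \<open>completion n b (b - 1)\<close> has beyond \<open>\<kappa>\<close>. There the longest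
    sequence is the part of row \<open>n\<close> not covered by \<open>\<kappa>\<close>.\<close>
  have inc: "q \<le> a - 1 + lis (factor w a b) \<longleftrightarrow> q \<le> b - row_length \<kappa> n" for q
  proof -
    have "has_increasing (layer (\<lambda>i. Q i 0)) b (\<lambda>u. u < K) q \<longleftrightarrow>
        has_increasing (layer (\<lambda>i. Q i (b - 1))) b (\<lambda>u. u < K) q"
    proof (rule growth_column_invariant[where Q = "\<lambda>L. has_increasing L b (\<lambda>u. u < K) q"])
      fix l assume l: "l < b - 1"
      have sl: "slide (\<lambda>i. Q i l) (\<lambda>i. Q i (Suc l)) K" using growth_slide_column[OF Q(1) l] .
      have "c \<le> b" if "(r, c) \<in> Q K (Suc l) - Q K l" for r c
        using that Q(3)[of l] Q(3)[of "Suc l"] l by (auto simp: completion_iff)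
      then have "c \<le> b" if "i \<le> K" "(r, c) \<in> Q i (Suc l) - Q i l" for i r c
        using slide_dots[OF sl _ that(1), of b r c] that(2) by blast
      then show "has_increasing (layer (\<lambda>i. Q i l)) b (\<lambda>u. u < K) q \<longleftrightarrow>
          has_increasing (layer (\<lambda>i. Q i (Suc l))) b (\<lambda>u. u < K) q"
        by (intro slide_has_increasing[OF sl]) auto
    qed
    moreover have "has_increasing (layer (\<lambda>i. Q i 0)) b (\<lambda>u. u < K) q \<longleftrightarrow>
        has_increasing (layer (prefixed w a)) b (\<lambda>u. u < K) q"
    proof -
      have "layer (\<lambda>i. Q i 0) u = layer (prefixed w a) u" if "u < K" for u
        using that Q(2)[of u] Q(2)[of "Suc u"] unfolding layer_def by simp
      then show ?thesis unfolding has_increasing_def by metis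
    qed
    moreover have "has_increasing (layer (\<lambda>i. Q i (b - 1))) b (\<lambda>u. u < K) q \<longleftrightarrow> q \<le> b - row_length \<kappa> n"
      unfolding \<kappa>_def
    proof (rule bottom_row_has_increasing[OF growth_chain_column[OF Q(1) order_refl] n1])
      show "r \<le> n" if "(r, c) \<in> Q K (b - 1)" for r c using that Q(3)[of "b - 1"] by (auto simp: completion_iff)
      show "(n, c) \<in> Q K (b - 1)" if "1 \<le> c" "c \<le> b" for c
        using that Q(3)[of "b - 1"] n1 by (auto simp: completion_iff)
    qed
    ultimately show ?thesis using prefixed_has_increasing[OF w ab] unfolding K_def by blast
  qed
  have "row_length \<kappa> n \<le> b"
  proof (cases "row_length \<kappa> n = 0")
    case False
    have d: "diagram \<kappa>" unfolding \<kappa>_def using chain_diagram[OF growth_chain[OF Q(1), of 0]] by simp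
    then have "(n, row_length \<kappa> n) \<in> \<kappa>" using row_length_iff[OF d] False n1 by simp
    then have "(n, row_length \<kappa> n) \<in> completion n b (b - 1)" using sub[of 0 "b - 1"] unfolding \<kappa>_def by auto
    then show ?thesis using ab by (auto simp: completion_iff)
  qed simp
  moreover have "a - 1 + lis (factor w a b) = b - row_length \<kappa> n" using inc le_antisym le_refl by metis
  ultimately show ?thesis unfolding path using ab by linarith
qed

section \<open>Reflection in the main diagonal\<close>

lemma diagram_converse: "diagram A \<Longrightarrow> diagram (A\<inverse>)"
  unfolding diagram_def converse_iff finite_converse by meson

lemma strip_converse: "strip A B \<Longrightarrow> strip (A\<inverse>) (B\<inverse>)"
  unfolding strip_def by (simp add: diagram_converse)

lemma square_converse:
  assumes sq: "square A B C D" shows "square (A\<inverse>) (B\<inverse>) (C\<inverse>) (D\<inverse>)"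
  unfolding square_def
proof (intro conjI allI impI)
  fix r c assume "(r, c) \<in> D\<inverse> - A\<inverse>"
  then have "(c, r) \<in> D - A" by simp
  then have "(c, r) \<in> C \<longleftrightarrow> addable A c r \<and> \<not> ((c, r) \<in> B \<and> maximal D c r)"
    using sq unfolding square_def by blast
  then show "(r, c) \<in> C\<inverse> \<longleftrightarrow> addable (A\<inverse>) r c \<and> \<not> ((r, c) \<in> B\<inverse> \<and> maximal (D\<inverse>) r c)"
    unfolding addable_def maximal_def by auto
qed (use square_strips[OF sq] strip_converse in blast)+

lemma slide_converse:
  assumes "slide a b J" shows "slide (\<lambda>j. (a j)\<inverse>) (\<lambda>j. (b j)\<inverse>) J"
  unfolding slide_def chain_def
proof (intro conjI allI impI)
  show "diagram ((a 0)\<inverse>)" "diagram ((b 0)\<inverse>)"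
    using diagram_converse chain_diagram[OF slide_chains(1)[OF assms]] chain_diagram[OF slide_chains(2)[OF assms]] by simp_all
  fix j
  show "strip ((a j)\<inverse>) ((b j)\<inverse>)" if "j \<le> J" by (rule strip_converse[OF slide_strip[OF assms that]])
  assume j: "j < J"
  show "strip ((a j)\<inverse>) ((a (Suc j))\<inverse>)"
    by (rule strip_converse[OF chain_strip[OF slide_chains(1)[OF assms] j]])
  show "strip ((b j)\<inverse>) ((b (Suc j))\<inverse>)"
    by (rule strip_converse[OF chain_strip[OF slide_chains(2)[OF assms] j]])
  show "square ((a j)\<inverse>) ((b j)\<inverse>) ((a (Suc j))\<inverse>) ((b (Suc j))\<inverse>)"
    by (rule square_converse[OF slide_square[OF assms j]])
qed

lemma growth_converse:
  assumes "growth g I J" shows "growth (\<lambda>i j. (g i j)\<inverse>) I J"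
  unfolding growth_iff_slides chain_def
proof (intro conjI allI impI)
  show "diagram ((g 0 0)\<inverse>)"
    by (rule diagram_converse[OF chain_diagram[OF growth_chain[OF assms]]]) simp_all
  show "strip ((g 0 j)\<inverse>) ((g 0 (Suc j))\<inverse>)" if "j < J" for j
    by (rule strip_converse[OF chain_strip[OF growth_chain[OF assms] that]]) simp
  show "slide (\<lambda>j. (g i j)\<inverse>) (\<lambda>j. (g (Suc i) j)\<inverse>) J" if "i < I" for i
    by (rule slide_converse[OF growth_slide[OF assms that]])
qed

lemma stair_converse: "(stair n)\<inverse> = stair n"
  by (auto simp: stair_iff)

lemma word_chain_converse: "(word_chain w j)\<inverse> = word_chain (rev w) j"
proof -
  have "w ! (r - 1) = rev w ! (c - 1)" if "1 \<le> r" "1 \<le> c" "c + r = length w + 1" for r c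
  proof -
    have "c - 1 < length w" "length w - Suc (c - 1) = r - 1" using that by auto
    then show ?thesis by (simp add: rev_nth)
  qed
  then have "(r, c) \<in> (word_chain w j)\<inverse> \<longleftrightarrow> (r, c) \<in> word_chain (rev w) j" for r c
    unfolding word_chain_def by (auto simp: stair_iff add.commute)
  then show ?thesis by auto
qed

lemma lds_factor:
  assumes "1 \<le> a" "a \<le> b" "b \<le> length w"
  shows "lds (factor w a b) = lis (factor (rev w) (length w + 1 - b) (length w + 1 - a))"
proof -
  have "length (take b w) = b" "b - (a - 1) = b + 1 - a" using assms by auto
  then have "rev (factor w a b) = take (b + 1 - a) (drop (length w - b) (rev w))"
    unfolding factor_def by (simp add: rev_drop rev_take)
  moreover have "length w + 1 - b - 1 = length w - b" "length w + 1 - a - (length w - b) = b + 1 - a"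
    using assms by auto
  then have "factor (rev w) (length w + 1 - b) (length w + 1 - a) =
      take (b + 1 - a) (drop (length w - b) (rev w))"
    unfolding factor_def by (simp add: drop_take)
  ultimately show ?thesis unfolding lds_eq_lis_rev by simp
qed

section \<open>Growth diagrams of words\<close>

definition word_growth :: "nat \<Rightarrow> nat \<Rightarrow> nat list \<Rightarrow> (nat \<Rightarrow> nat \<Rightarrow> box set) \<Rightarrow> bool" where
  "word_growth n k w g \<longleftrightarrow> growth g (n - 1) k \<and> (\<forall>i\<le>n - 1. g i 0 = stair i) \<and>
     (\<forall>j\<le>k. g (n - 1) j = word_chain w j)"

lemma word_growthD:
  assumes "word_growth n k w g"
  shows "growth g (n - 1) k" "i \<le> n - 1 \<Longrightarrow> g i 0 = stair i" "j \<le> k \<Longrightarrow> g (n - 1) j = word_chain w j"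
  using assms unfolding word_growth_def by blast+

lemma word_growth_converse:
  assumes "word_growth n k w g" shows "word_growth n k (rev w) (\<lambda>i j. (g i j)\<inverse>)"
  using growth_converse[OF word_growthD(1)[OF assms]] word_growthD(2,3)[OF assms]
  unfolding word_growth_def by (simp add: stair_converse word_chain_converse)

lemma word_growth_exists:
  assumes "w \<in> words n" "1 \<le> n" shows "\<exists>g. word_growth n k w g"
proof -
  have "1 \<le> length w" using assms unfolding words_def by auto
  from growth_exists_up[OF chain_stair chain_word_chain[OF this] word_chain_0[OF assms(1)], of k]
  show ?thesis unfolding word_growth_def by blast
qed

lemma growth_lis:
  assumes w: "w \<in> words n" "set w \<subseteq> {1..k}" "word_growth n k w g"
    and w': "w' \<in> words n" "set w' \<subseteq> {1..k}" "word_growth n k w' h"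
    and right: "\<And>i. i \<le> n - 1 \<Longrightarrow> g i k = h i k" and ab: "1 \<le> a" "a \<le> b" "b \<le> n"
  shows "lis (factor w a b) = lis (factor w' a b)"
proof -
  define \<zeta> where "\<zeta> = (\<lambda>u. if u \<le> n - 1 then g u k else completion n b (u - (n - 1)))"
  have \<zeta>': "\<zeta> = (\<lambda>u. if u \<le> n - 1 then h u k else completion n b (u - (n - 1)))"
    unfolding \<zeta>_def by (intro ext) (simp add: right)
  have eq: "b + 1 - a \<le> m + lis (factor w a b) \<longleftrightarrow> b + 1 - a \<le> m + lis (factor w' a b)" for m
    using right_column_lis[OF word_growthD[OF w(3)] w(1,2) ab \<zeta>_def, of m]
      right_column_lis[OF word_growthD[OF w'(3)] w'(1,2) ab \<zeta>', of m] by simp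
  have le: "lis (factor u a b) \<le> b + 1 - a" if "u \<in> words n" for u
  proof -
    have "length u = n" using that unfolding words_def by simp
    then obtain A where "A \<subseteq> {a - 1..<b}" "card A = lis (factor u a b)"
      using le_lis_factor[of a b u "lis (factor u a b)"] ab by auto
    then have "lis (factor u a b) \<le> card {a - 1..<b}" by (metis card_mono finite_atLeastLessThan)
    then show ?thesis using ab by simp
  qed
  \<comment> \<open>The minimal cost for each word is tested on the other one. By \<open>le\<close>
    the subtractions are not truncated.\<close>
  show ?thesis
    using eq[of "b + 1 - a - lis (factor w a b)"] eq[of "b + 1 - a - lis (factor w' a b)"]
      le[OF w(1)] le[OF w'(1)] by linarith
qed

lemma rev_words: "w \<in> words n \<Longrightarrow> rev w \<in> words n"
  unfolding words_def by simp

lemma growth_cid: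
  assumes w: "w \<in> words n" "set w \<subseteq> {1..k}" "word_growth n k w g"
    and w': "w' \<in> words n" "set w' \<subseteq> {1..k}" "word_growth n k w' h"
    and right: "\<And>i. i \<le> n - 1 \<Longrightarrow> g i k = h i k"
  shows "w \<sim>cid w'"
  unfolding cid_def
proof (intro conjI allI impI)
  have len: "length w = n" "length w' = n" using w(1) w'(1) unfolding words_def by auto
  show "length w = length w'" using len by simp
  fix a b assume ab: "1 \<le> a \<and> a \<le> b \<and> b \<le> length w"
  show "lis (factor w a b) = lis (factor w' a b)" using growth_lis[OF w w' right, of a b] ab len by simp
  have "lis (factor (rev w) (n + 1 - b) (n + 1 - a)) = lis (factor (rev w') (n + 1 - b) (n + 1 - a))"
    by (rule growth_lis[OF rev_words[OF w(1)] _ word_growth_converse[OF w(3)]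
          rev_words[OF w'(1)] _ word_growth_converse[OF w'(3)]])
      (use w w' right ab len in auto)
  then show "lds (factor w a b) = lds (factor w' a b)"
    using lds_factor[of a b w] lds_factor[of a b w'] ab len by simp
qed

section \<open>Infusion and promotion of words\<close>

lemma fills_cong:
  assumes eq: "\<And>j. j \<le> k \<Longrightarrow> s j = s' j" and f: "fills s k T" shows "fills s' k T"
proof (rule fillsI)
  show "chain s' k" using chain_cong[OF eq fills_chain[OF f]] by blast
  fix x v
  have "layer s (v - 1) = layer s' (v - 1)" if "1 \<le> v" "v \<le> k"
    using eq[of "v - 1"] eq[of "Suc (v - 1)"] that unfolding layer_def by simp
  then show "T x = Some v \<longleftrightarrow> 1 \<le> v \<and> v \<le> k \<and> x \<in> layer s' (v - 1)"
    using fills_iff[OF f, of x v] by auto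
qed

lemma word_infusion_fills:
  assumes w: "w \<in> words n" "1 \<le> n" "set w \<subseteq> {1..k}" and g: "word_growth n k w g"
  shows "fills (g 0) k (\<W> w)" "fills (\<lambda>i. g i k) (n - 1) (\<M> w)"
proof -
  have len: "length w = n" using w(1) unfolding words_def by simp
  have l: "fills (\<lambda>i. g i 0) (n - 1) (M_tab (n - 1))"
    by (rule fills_cong[OF _ fills_M_tab]) (use word_growthD(2)[OF g] in simp)
  have b: "fills (g (n - 1)) k (word_tab w)"
    by (rule fills_cong[OF _ fills_word_tab[OF w]]) (use word_growthD(3)[OF g] in simp)
  show "fills (g 0) k (\<W> w)"
    using jdt_by_fills[OF word_growthD(1)[OF g] l b] unfolding \<W>_def word_infusion_def infusion_def len by simp
  show "fills (\<lambda>i. g i k) (n - 1) (\<M> w)"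
    using rjdt_by_fills[OF word_growthD(1)[OF g] l b] unfolding \<M>_def word_infusion_def infusion_def len by simp
qed

lemma word_growth_layer:
  assumes w: "w \<in> words n" "1 \<le> n" and g: "word_growth n k w g" and j: "j < k"
  shows "layer (g 0) j \<noteq> {} \<longleftrightarrow> Suc j \<in> set w"
proof -
  have "layer (g 0) j \<noteq> {} \<longleftrightarrow> layer (g (n - 1)) j \<noteq> {}"
    using growth_layer_empty[OF word_growthD(1)[OF g] _ _ j, of 0 "n - 1"] by simp
  also have "layer (g (n - 1)) j = layer (word_chain w) j"
    using word_growthD(3)[OF g] j unfolding layer_def by simp
  finally show ?thesis using word_letter_iff[OF w] by simp
qed

lemma largest_entry_W:
  assumes w: "w \<in> words n" "1 \<le> n" "set w = {1..k}"
  shows "largest_entry (\<W> w) = k"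
proof -
  obtain g where g: "word_growth n k w g" using word_growth_exists[OF w(1,2)] by blast
  show ?thesis
    by (rule fills_largest_eq[OF word_infusion_fills(1)[OF w(1,2) _ g]])
      (use w word_growth_layer[OF w(1,2) g] in auto)
qed

lemma growth_determines_word:
  assumes w: "w \<in> words n" "w' \<in> words n" "set w \<subseteq> {1..k}" "set w' \<subseteq> {1..k}"
    and g: "word_growth n k w g" "word_growth n k w' h"
    and top: "\<And>j. j \<le> k \<Longrightarrow> g 0 j = h 0 j" and right: "\<And>i. i \<le> n - 1 \<Longrightarrow> g i k = h i k"
  shows "w = w'"
proof (rule word_chain_inject[OF w])
  fix j assume j: "j \<le> k"
  have "g (n - 1) j = h (n - 1) j"
    by (rule growth_unique_down[OF word_growthD(1)[OF g(1)] word_growthD(1)[OF g(2)] right top _ j]) auto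
  then show "word_chain w j = word_chain w' j" using word_growthD(3)[OF g(1) j] word_growthD(3)[OF g(2) j] by simp
qed

text \<open>The value of \<open>inv_into\<close> in \<open>R_st\<close> can be computed only with
  injectivity. \<open>\<W>\<close> gives the number of letters and the top row, \<open>\<M>\<close>
  the right column, and these determine the whole diagram.\<close>

lemma inj_word_infusion:
  assumes "1 \<le> n" shows "inj_on word_infusion (st_words n)"
proof (rule inj_onI)
  fix w w' assume "w \<in> st_words n" "w' \<in> st_words n" and eq: "word_infusion w = word_infusion w'"
  then obtain k k' where w: "w \<in> words n" "set w = {1..k}" and w': "w' \<in> words n" "set w' = {1..k'}"
    unfolding st_words_def by blast
  have WM: "\<W> w = \<W> w'" "\<M> w = \<M> w'" unfolding \<W>_def \<M>_def eq by simp_all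
  have k: "k' = k" using largest_entry_W[OF w(1) assms w(2)] largest_entry_W[OF w'(1) assms w'(2)] WM by simp
  obtain g h where g: "word_growth n k w g" and h: "word_growth n k w' h"
    using word_growth_exists w(1) w'(1) assms by blast
  have sub: "set w \<subseteq> {1..k}" "set w' \<subseteq> {1..k}" using w w' k by auto
  note fg = word_infusion_fills[OF w(1) assms sub(1) g]
  note fh = word_infusion_fills[OF w'(1) assms sub(2) h, folded WM]
  have top: "g 0 j = h 0 j" if "j \<le> k" for j
    by (rule fills_chain_unique[OF fg(1) fh(1) _ that])
      (use word_growthD(2)[OF g, of 0] word_growthD(2)[OF h, of 0] in simp)
  have right: "g i k = h i k" if "i \<le> n - 1" for i
    by (rule fills_chain_unique[OF fg(2) fh(2) _ that]) (use top in simp)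
  show "w = w'" by (rule growth_determines_word[OF w(1) w'(1) sub g h top right])
qed

lemma strip_empty: "strip {} A \<Longrightarrow> A \<subseteq> {(1, 1)}"
proof
  fix x :: box assume st: "strip {} A" and "x \<in> A"
  moreover obtain r c where x: "x = (r, c)" by (cases x)
  ultimately have "1 \<le> r" "1 \<le> c" using diagram_pos[OF strip_diagram(2)[OF st]] by blast+
  then show "x \<in> {(1, 1)}" using strip_less[OF st, of r c 1 1] \<open>x \<in> A\<close> x by auto
qed

text \<open>Deleting 1 leaves the chain from \<open>s 1 = {(1, 1)}\<close> on, so promotion slides
  it with a single dot, and refilling with \<open>k\<close> appends \<open>s k\<close> as the last
  diagram. The last layer is nonempty because the dot does not vanish.\<close>

lemma promotion_fills:
  assumes W: "fills s k W" and s0: "s 0 = {}" and k: "1 \<le> k" and ne: "\<And>j. j < k \<Longrightarrow> layer s j \<noteq> {}"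
  shows "\<exists>p. p 0 = {} \<and> p k = s k \<and> slide p (\<lambda>j. s (Suc j)) (k - 1) \<and> fills p k (promotion W) \<and>
    (\<forall>j<k. layer p j \<noteq> {})"
proof -
  have ch: "chain s k" using fills_chain[OF W] .
  have "strip {} (s 1)" using chain_strip[OF ch, of 0] k s0 by simp
  then have s1: "s 1 = {(1, 1)}"
    using strip_empty[of "s 1"] ne[of 0] k s0 unfolding layer_def by auto
  have ch': "chain (\<lambda>j. s (Suc j)) (k - 1)"
    unfolding chain_def using chain_diagram[OF ch, of 1] chain_strip[OF ch] k by auto
  then obtain v where v: "v 0 = {}" "slide v (\<lambda>j. s (Suc j)) (k - 1)"
    using slide_exists_up[OF ch', of "{}"] \<open>strip {} (s 1)\<close> by auto
  define Wm where "Wm = (\<lambda>b. if b = (1, 1) then None else map_option (\<lambda>a. a - 1) (W b))"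
  define V where "V = jdt {(1, 1)} Wm"
  have Wm: "fills (\<lambda>j. s (Suc j)) (k - 1) Wm"
  proof (rule fillsI[OF ch'])
    fix x v
    have lay: "layer (\<lambda>j. s (Suc j)) (v - 1) = layer s v" if "1 \<le> v" using that unfolding layer_def by simp
    have "(1, 1) \<notin> layer s v" if "1 \<le> v" "v \<le> k - 1"
      using that chain_mono[OF ch, of 1 v] s1 unfolding layer_def by auto
    moreover have "2 \<le> a" if "W x = Some a" "x \<noteq> (1, 1)" for a
      using that fills_iff[OF W, of x a] s1 s0 unfolding layer_def by (cases "a = 1") auto
    ultimately show "Wm x = Some v \<longleftrightarrow> 1 \<le> v \<and> v \<le> k - 1 \<and> x \<in> layer (\<lambda>j. s (Suc j)) (v - 1)"
    proof (cases "x = (1, 1)")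
      case False
      have "Wm x = Some v \<longleftrightarrow> 1 \<le> v \<and> W x = Some (Suc v)"
      proof
        assume "Wm x = Some v"
        then obtain a where "W x = Some a" "v = a - 1" using False unfolding Wm_def by auto
        then show "1 \<le> v \<and> W x = Some (Suc v)" using \<open>\<And>a. W x = Some a \<Longrightarrow> x \<noteq> (1, 1) \<Longrightarrow> 2 \<le> a\<close> False by fastforce
      qed (use False in \<open>simp add: Wm_def\<close>)
      then show ?thesis using fills_iff[OF W, of x "Suc v"] lay k by auto
    qed (use lay in \<open>auto simp: Wm_def\<close>)
  qed
  have V: "fills v (k - 1) V" using jdt_fills[OF v(2) Wm] unfolding V_def v(1) using s1 by simp
  have kk: "Suc (k - 1) = k" using k by simp
  have domV: "dom V = v (k - 1)" "dom W = s k" using fills_dom[OF V] v(1) fills_dom[OF W] s0 by auto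
  have vs: "strip (v (k - 1)) (s k)" using slide_strip[OF v(2), of "k - 1"] kk by simp
  have le: "largest_entry W = k" using fills_largest_eq[OF W] ne by blast
  have prom: "promotion W = (\<lambda>b. if b \<in> s k - v (k - 1) then Some k else V b)"
    unfolding promotion_def Let_def Wm_def[symmetric] V_def[symmetric] domV le ..
  define p where "p j = (if j < k then v j else s k)" for j
  have lay: "layer p j = layer v j" if "j < k - 1" for j
  proof -
    have "j < k" "Suc j < k" using that by auto
    then show ?thesis unfolding layer_def p_def by simp
  qed
  have last: "layer p (k - 1) = s k - v (k - 1)" unfolding layer_def p_def using k by simp
  have chv: "chain v (k - 1)" using slide_chains(1)[OF v(2)] .
  have chp: "chain p k"
    unfolding chain_def
  proof (intro conjI allI impI)
    show "diagram (p 0)" unfolding p_def using k chain_diagram[OF chv, of 0] by simp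
    fix j assume j: "j < k"
    show "strip (p j) (p (Suc j))"
    proof (cases "Suc j < k")
      case True
      then show ?thesis using chain_strip[OF chv, of j] unfolding p_def by simp
    next
      case False
      then have "j = k - 1" using j by simp
      then show ?thesis unfolding p_def using vs k by simp
    qed
  qed
  have "fills p k (promotion W)"
  proof (rule fillsI[OF chp])
    fix x u
    have sub: "layer v (u - 1) \<subseteq> v (k - 1)" if "1 \<le> u" "u \<le> k - 1"
      using chain_mono[OF chv, of u "k - 1"] that unfolding layer_def by auto
    consider "1 \<le> u" "u \<le> k - 1" | "u = k" | "u = 0 \<or> k < u" by linarith
    then show "promotion W x = Some u \<longleftrightarrow> 1 \<le> u \<and> u \<le> k \<and> x \<in> layer p (u - 1)"
    proof cases
      case 1
      then show ?thesis using fills_iff[OF V, of x u] lay[of "u - 1"] sub unfolding prom by auto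
    next
      case 2
      have "\<not> k \<le> k - 1" using k by arith
      then have "V x \<noteq> Some k" using fills_iff[OF V, of x k] by blast
      then have "promotion W x = Some k \<longleftrightarrow> x \<in> layer p (k - 1)" unfolding prom last by simp
      then show ?thesis unfolding 2 using k by simp
    next
      case 3
      then have "\<not> (1 \<le> u \<and> u \<le> k - 1)" "u \<noteq> k" using k by auto
      then have "V x \<noteq> Some u" "u \<noteq> k" using fills_iff[OF V, of x u] by blast+
      then have "promotion W x \<noteq> Some u" unfolding prom by simp
      then show ?thesis using 3 by auto
    qed
  qed
  moreover have "layer p j \<noteq> {}" if "j < k" for j
  proof (cases "j < k - 1")
    case True
    have "growth (\<lambda>i. if i = 0 then v else (\<lambda>j. s (Suc j))) 1 (k - 1)"
      unfolding growth_iff_slides using chv v(2) by simp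
    from growth_layer_empty[OF this _ _ True, of 0 1] have "layer v j = {} \<longleftrightarrow> layer s (Suc j) = {}"
      unfolding layer_def by simp
    then show ?thesis using lay[OF True] ne[of "Suc j"] True by simp
  next
    case False
    then have "j = k - 1" using that by simp
    moreover have "v (k - 1) \<noteq> s k" using slide_trivial[OF v(2), of 0 "k - 1"] v(1) s1 kk by simp
    ultimately show ?thesis using last strip_subset[OF vs] by auto
  qed
  moreover have "slide p (\<lambda>j. s (Suc j)) (k - 1)"
    by (rule slide_cong[OF _ _ v(2)]) (use k in \<open>auto simp: p_def\<close>)
  moreover have "p 0 = {}" "p k = s k" using v(1) k unfolding p_def by auto
  ultimately show ?thesis by blast
qed

text \<open>The abstract preimage in \<open>R_st\<close> is identified with a word read off a
  diagram. That the bottom row of \<open>h\<close> ends in \<open>stair n\<close> is inherited from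
  the common right column; that all letters occur, from the nonempty layers of the
  promotion.\<close>

lemma R_st_growths:
  assumes w: "w \<in> words n" "1 \<le> n" "set w = {1..k}"
  shows "\<exists>g h. word_growth n k w g \<and> word_growth n k (R_st w) h \<and>
    slide (h 0) (\<lambda>j. g 0 (Suc j)) (k - 1) \<and> (\<forall>i\<le>n - 1. g i k = h i k) \<and>
    R_st w \<in> words n \<and> set (R_st w) = {1..k}"
proof -
  have len: "length w = n" using w(1) unfolding words_def by simp
  then have "set w \<noteq> {}" using w(2) by auto
  then have k: "1 \<le> k" using w(3) by auto
  obtain g where g: "word_growth n k w g" using word_growth_exists[OF w(1,2)] by blast
  note gg = word_growthD(1)[OF g]
  have fW: "fills (g 0) k (\<W> w)" and fM: "fills (\<lambda>i. g i k) (n - 1) (\<M> w)"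
    using word_infusion_fills[OF w(1,2) _ g] w(3) by auto
  have g0: "g 0 0 = {}" using word_growthD(2)[OF g, of 0] by (simp add: stair_0)
  have "layer (g 0) j \<noteq> {}" if "j < k" for j using word_growth_layer[OF w(1,2) g that] w(3) that by simp
  from promotion_fills[OF fW g0 k this] obtain p where p: "p 0 = {}" "p k = g 0 k"
    "slide p (\<lambda>j. g 0 (Suc j)) (k - 1)" "fills p k (promotion (\<W> w))" "\<And>j. j < k \<Longrightarrow> layer p j \<noteq> {}"
    by blast
  obtain h where h: "growth h (n - 1) k" "\<And>j. j \<le> k \<Longrightarrow> h 0 j = p j" "\<And>i. i \<le> n - 1 \<Longrightarrow> h i k = g i k"
    using growth_exists_down[OF fills_chain[OF p(4)] growth_chain_column[OF gg order_refl]] p(2) by auto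
  have left: "h i 0 = stair i" if "i \<le> n - 1" for i
    by (rule staircase_unique_rectification[OF gg word_growthD(2)[OF g] h(1) _ h(3) that])
      (use h(2)[of 0] p(1) in auto)
  have "h (n - 1) k = stair n"
    using h(3)[of "n - 1"] word_growthD(3)[OF g, of k] word_chain_top[OF w(1,2)] w(3) by simp
  then obtain w' where w': "w' \<in> words n" "set w' \<subseteq> {1..k}" "\<And>j. j \<le> k \<Longrightarrow> h (n - 1) j = word_chain w' j"
    using word_of_chain[OF growth_chain[OF h(1) order_refl] w(2) left[OF order_refl]] by blast
  have hw: "word_growth n k w' h" unfolding word_growth_def using h(1) left w'(3) by blast
  have "Suc j \<in> set w'" if "j < k" for j
  proof -
    have "layer (h 0) j = layer p j" using h(2) that unfolding layer_def by simp
    then show ?thesis using word_growth_layer[OF w'(1) w(2) hw that] p(5)[OF that] by simp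
  qed
  moreover have "x \<in> set w'" if "x \<in> {1..k}" "\<And>j. j < k \<Longrightarrow> Suc j \<in> set w'" for x
    using that(1) that(2)[of "x - 1"] by auto
  ultimately have set': "set w' = {1..k}" using w'(2) by blast
  have "fills (h 0) k (promotion (\<W> w))" by (rule fills_cong[OF _ p(4)]) (use h(2) in simp)
  moreover have "fills (\<lambda>i. h i k) (n - 1) (\<M> w)" by (rule fills_cong[OF _ fM]) (use h(3) in simp)
  ultimately have "\<W> w' = promotion (\<W> w)" "\<M> w' = \<M> w"
    using word_infusion_fills[OF w'(1) w(2) w'(2) hw] fills_unique by blast+
  then have "(promotion (\<W> w), \<M> w) = word_infusion w'" unfolding \<W>_def \<M>_def by (metis prod.collapse)
  moreover have "w' \<in> st_words n" unfolding st_words_def using w'(1) set' by blast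
  ultimately have R: "R_st w = w'"
    unfolding R_st_def len by (simp add: inv_into_f_f[OF inj_word_infusion[OF w(2)]])
  have "slide (h 0) (\<lambda>j. g 0 (Suc j)) (k - 1)"
    by (rule slide_cong[OF _ _ p(3)]) (use h(2) k in auto)
  then show ?thesis using g hw h(3) w'(1) set' unfolding R by auto
qed

text \<open>The staircases and \<open>R_st w\<close> determine \<open>h\<close>, hence the common
  right column. The promotion slide is then undone from its last diagram \<open>g 0 k\<close>, the
  corner of the top row and that column.\<close>

lemma R_st_inject:
  assumes n: "1 \<le> n" and w: "w \<in> words n" "set w = {1..k}" and w': "w' \<in> words n" "set w' = {1..k}"
    and eq: "R_st w = R_st w'"
  shows "w = w'"
proof -
  obtain g h where g: "word_growth n k w g" "word_growth n k (R_st w) h"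
    "slide (h 0) (\<lambda>j. g 0 (Suc j)) (k - 1)" "\<And>i. i \<le> n - 1 \<Longrightarrow> g i k = h i k"
    using R_st_growths[OF w(1) n w(2)] by blast
  obtain g' h' where g': "word_growth n k w' g'" "word_growth n k (R_st w) h'"
    "slide (h' 0) (\<lambda>j. g' 0 (Suc j)) (k - 1)" "\<And>i. i \<le> n - 1 \<Longrightarrow> g' i k = h' i k"
    using R_st_growths[OF w'(1) n w'(2)] unfolding eq by blast
  have "h i 0 = h' i 0" if "i \<le> n - 1" for i
    using word_growthD(2)[OF g(2) that] word_growthD(2)[OF g'(2) that] by simp
  moreover have "h (n - 1) j = h' (n - 1) j" if "j \<le> k" for j
    using word_growthD(3)[OF g(2) that] word_growthD(3)[OF g'(2) that] by simp
  ultimately have hh: "h i j = h' i j" if "i \<le> n - 1" "j \<le> k" for i j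
    by (rule growth_unique_up[OF word_growthD(1)[OF g(2)] word_growthD(1)[OF g'(2)] _ _ that])
  have right: "g i k = g' i k" if "i \<le> n - 1" for i using g(4)[OF that] g'(4)[OF that] hh[OF that order_refl] by simp
  have "g 0 j = g' 0 j" if j: "j \<le> k" for j
  proof (cases j)
    case 0
    then show ?thesis using word_growthD(2)[OF g(1), of 0] word_growthD(2)[OF g'(1), of 0] by simp
  next
    case (Suc i)
    have "g 0 (Suc i) = g' 0 (Suc i)"
      by (rule slide_unique_down[OF g(3) g'(3)]) (use right[of 0] hh Suc j in auto)
    then show ?thesis using Suc by simp
  qed
  then show ?thesis
    using growth_determines_word[OF w(1) w'(1) _ _ g(1) g'(1) _ right] w(2) w'(2) by auto
qed

section \<open>Subsequences with letters in an interval\<close>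

text \<open>This accounts for the decrement of the letters in promotion.\<close>

lemma has_increasing_shift:
  "has_increasing (\<lambda>u. L (Suc u)) d P m \<longleftrightarrow> has_increasing L d (\<lambda>u. 1 \<le> u \<and> P (u - 1)) m"
proof
  assume "has_increasing (\<lambda>u. L (Suc u)) d P m"
  then obtain S where S: "finite S" "card S = m" "increasing S"
    "\<And>u r c. (u, r, c) \<in> S \<Longrightarrow> P u \<and> (r, c) \<in> L (Suc u) \<and> c \<le> d"
    unfolding has_increasing_def by blast
  let ?f = "\<lambda>(u, r, c). (Suc u, r :: nat, c :: nat)"
  have "inj_on ?f S" by (rule inj_onI) (auto split: prod.splits)
  then have "card (?f ` S) = m" using S(2) by (simp add: card_image)
  moreover have "increasing (?f ` S)"
    unfolding increasing_def
  proof (intro allI impI)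
    fix u r c v r' c' assume "(u, r, c) \<in> ?f ` S" "(v, r', c') \<in> ?f ` S"
    then obtain u' v' where "u = Suc u'" "v = Suc v'" "(u', r, c) \<in> S" "(v', r', c') \<in> S" by auto
    then show "(u, r, c) = (v, r', c') \<or> u < v \<and> c < c' \<or> v < u \<and> c' < c"
      using increasingD[OF S(3)] by fastforce
  qed
  moreover have "(1 \<le> u \<and> P (u - 1)) \<and> (r, c) \<in> L u \<and> c \<le> d" if "(u, r, c) \<in> ?f ` S" for u r c
    using that S(4) by fastforce
  ultimately show "has_increasing L d (\<lambda>u. 1 \<le> u \<and> P (u - 1)) m"
    unfolding has_increasing_def using S(1) by (intro exI[of _ "?f ` S"]) blast
next
  assume "has_increasing L d (\<lambda>u. 1 \<le> u \<and> P (u - 1)) m"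
  then obtain S where S: "finite S" "card S = m" "increasing S"
    "\<And>u r c. (u, r, c) \<in> S \<Longrightarrow> (1 \<le> u \<and> P (u - 1)) \<and> (r, c) \<in> L u \<and> c \<le> d"
    unfolding has_increasing_def by blast
  let ?f = "\<lambda>(u, r, c). (u - 1, r :: nat, c :: nat)"
  have mem: "(u, r, c) \<in> ?f ` S \<Longrightarrow> (Suc u, r, c) \<in> S" for u r c
    using S(4) by fastforce
  have "inj_on ?f S"
  proof (rule inj_onI)
    fix x y assume xy: "x \<in> S" "y \<in> S" "?f x = ?f y"
    obtain u r c v r' c' where e: "x = (u, r, c)" "y = (v, r', c')" by (metis prod_cases3)
    then have "1 \<le> u" "1 \<le> v" using S(4) xy by blast+
    then show "x = y" using xy(3) e by auto
  qed
  then have "card (?f ` S) = m" using S(2) by (simp add: card_image)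
  moreover have "increasing (?f ` S)"
    unfolding increasing_def
  proof (intro allI impI)
    fix u r c v r' c' assume "(u, r, c) \<in> ?f ` S" "(v, r', c') \<in> ?f ` S"
    from increasingD[OF S(3) mem[OF this(1)] mem[OF this(2)]]
    show "(u, r, c) = (v, r', c') \<or> u < v \<and> c < c' \<or> v < u \<and> c' < c" by auto
  qed
  moreover have "P u \<and> (r, c) \<in> L (Suc u) \<and> c \<le> d" if "(u, r, c) \<in> ?f ` S" for u r c
    using S(4)[OF mem[OF that]] by simp
  ultimately show "has_increasing (\<lambda>u. L (Suc u)) d P m"
    unfolding has_increasing_def using S(1) by (intro exI[of _ "?f ` S"]) blast
qed

lemma has_increasing_cong:
  assumes "\<And>u. P u \<Longrightarrow> L u = L' u" shows "has_increasing L d P m \<longleftrightarrow> has_increasing L' d P m"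
  unfolding has_increasing_def using assms by metis

text \<open>All diagrams lie in \<open>stair n\<close>, so every letter and every dot satisfies the
  column bound \<open>n\<close>, and the bottom row can be compared with the top row.\<close>

lemma growth_has_increasing:
  assumes g: "word_growth n k w g" and w: "w \<in> words n" "1 \<le> n" "set w \<subseteq> {1..k}"
    and convex: "\<And>u v w. P u \<Longrightarrow> P w \<Longrightarrow> u \<le> v \<Longrightarrow> v \<le> w \<Longrightarrow> P v" and Pk: "\<And>u. P u \<Longrightarrow> u < k"
  shows "has_increasing (layer (g 0)) n P m \<longleftrightarrow> m \<le> lis (filter (\<lambda>x. P (x - 1)) w)"
proof -
  note gg = word_growthD(1)[OF g]
  have top: "g (n - 1) k = stair n" using word_growthD(3)[OF g, of k] word_chain_top[OF w] by simp
  have cols: "c \<le> n" if "i \<le> n - 1" "j \<le> k" "(r, c) \<in> g i j" for i j r c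
  proof -
    have "g i j \<subseteq> g i k" "g i k \<subseteq> g (n - 1) k"
      using chain_mono[OF growth_chain[OF gg that(1)] that(2) order_refl]
        chain_mono[OF growth_chain_column[OF gg order_refl] that(1) order_refl] by auto
    then show ?thesis using that(3) top by (auto simp: stair_iff)
  qed
  have "has_increasing (layer (g 0)) n P m \<longleftrightarrow> has_increasing (layer (g i)) n P m" if "i \<le> n - 1" for i
    using that
  proof (induction i)
    case (Suc i)
    have "has_increasing (layer (g i)) n P m \<longleftrightarrow> has_increasing (layer (g (Suc i))) n P m"
    proof (rule slide_has_increasing[OF growth_slide[OF gg]])
      show "i < n - 1" using Suc.prems by simp
      show "c \<le> n" if "j \<le> k" "(r, c) \<in> g (Suc i) j - g i j" for j r c
        using cols[OF Suc.prems that(1)] that(2) by blast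
    qed (fact convex, fact Pk)
    then show ?case using Suc by simp
  qed simp
  then have "has_increasing (layer (g 0)) n P m \<longleftrightarrow> has_increasing (layer (g (n - 1))) n P m" by simp
  also have "\<dots> \<longleftrightarrow> has_increasing (layer (word_chain w)) n P m"
  proof (rule has_increasing_cong)
    fix u assume "P u"
    then have "u < k" using Pk by blast
    then show "layer (g (n - 1)) u = layer (word_chain w) u" using word_growthD(3)[OF g] unfolding layer_def by simp
  qed
  also have "\<dots> \<longleftrightarrow> (\<exists>A. inc_positions w A \<and> (\<forall>p\<in>A. P (w ! p - 1) \<and> p < n) \<and> card A = m)"
    using w(1) by (intro has_increasing_word) (simp add: words_def)
  also have "\<dots> \<longleftrightarrow> (\<exists>A. inc_positions w A \<and> (\<forall>p\<in>A. P (w ! p - 1)) \<and> card A = m)"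
  proof -
    have "p < n" if "inc_positions w A" "p \<in> A" for A p
      using that w(1) unfolding inc_positions_def words_def by blast
    then show ?thesis by blast
  qed
  finally show ?thesis unfolding le_lis_filter .
qed

text \<open>Layer \<open>u\<close> of the promoted row is the letter \<open>u + 1\<close> of
  \<open>w'\<close> and comes from the letter \<open>u + 2\<close> of \<open>w\<close>; hence the
  two offsets. The bound \<open>k - 1\<close> leaves out the letter \<open>k\<close> of
  \<open>w'\<close>, which was refilled and not slid.\<close>

lemma growths_lis_filter:
  assumes n: "1 \<le> n" and w: "w \<in> words n" "set w \<subseteq> {1..k}" "word_growth n k w g"
    and w': "w' \<in> words n" "set w' \<subseteq> {1..k}" "word_growth n k w' h"
    and sl: "slide (h 0) (\<lambda>j. g 0 (Suc j)) (k - 1)"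
    and convex: "\<And>u v w. P u \<Longrightarrow> P w \<Longrightarrow> u \<le> v \<Longrightarrow> v \<le> w \<Longrightarrow> P v" and Pk: "\<And>u. P u \<Longrightarrow> u < k - 1"
  shows "lis (filter (\<lambda>x. 2 \<le> x \<and> P (x - 2)) w) = lis (filter (\<lambda>x. P (x - 1)) w')"
proof -
  have top: "g (n - 1) k = stair n" using word_growthD(3)[OF w(3), of k] word_chain_top[OF w(1) n w(2)] by simp
  have cols: "c \<le> n" if "(r, c) \<in> g 0 j" "j \<le> k" for r c j
  proof -
    have "g 0 j \<subseteq> g 0 k" "g 0 k \<subseteq> g (n - 1) k"
      using chain_mono[OF growth_chain[OF word_growthD(1)[OF w(3)], of 0] that(2) order_refl]
        chain_mono[OF growth_chain_column[OF word_growthD(1)[OF w(3)] order_refl], of 0 "n - 1"] by auto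
    then show ?thesis using that(1) top by (auto simp: stair_iff)
  qed
  let ?Q = "\<lambda>u. 1 \<le> u \<and> P (u - 1)"
  have "m \<le> lis (filter (\<lambda>x. P (x - 1)) w') \<longleftrightarrow> m \<le> lis (filter (\<lambda>x. 2 \<le> x \<and> P (x - 2)) w)" for m
  proof -
    have "m \<le> lis (filter (\<lambda>x. P (x - 1)) w') \<longleftrightarrow> has_increasing (layer (h 0)) n P m"
      by (rule growth_has_increasing[OF w'(3) w'(1) n w'(2), symmetric], fact convex) (use Pk in fastforce)
    also have "\<dots> \<longleftrightarrow> has_increasing (layer (\<lambda>j. g 0 (Suc j))) n P m"
    proof (rule slide_has_increasing[OF sl], fact convex, fact Pk)
      fix j r c assume j: "j \<le> k - 1" "(r, c) \<in> g 0 (Suc j) - h 0 j"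
      show "c \<le> n"
      proof (cases "k = 0")
        case True
        then have "g 0 (Suc j) = g 0 (Suc 0)" using j by simp
        then have "strip (h 0 0) (g 0 1)" using slide_strip[OF sl, of 0] by simp
        then show ?thesis using True w(2) w(1) n unfolding words_def by auto
      next
        case False
        then show ?thesis using cols[of r c "Suc j"] j by auto
      qed
    qed
    also have "layer (\<lambda>j. g 0 (Suc j)) = (\<lambda>u. layer (g 0) (Suc u))" unfolding layer_def by simp
    also have "has_increasing (\<lambda>u. layer (g 0) (Suc u)) n P m \<longleftrightarrow> has_increasing (layer (g 0)) n ?Q m"
      by (rule has_increasing_shift)
    also have "\<dots> \<longleftrightarrow> m \<le> lis (filter (\<lambda>x. ?Q (x - 1)) w)"
    proof (rule growth_has_increasing[OF w(3) w(1) n w(2)])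
      fix u v z assume "?Q u" "?Q z" "u \<le> v" "v \<le> z"
      then show "?Q v" using convex[of "u - 1" "z - 1" "v - 1"] by simp
    next
      fix u assume "?Q u"
      then show "u < k" using Pk[of "u - 1"] by simp
    qed
    also have "(\<lambda>x. ?Q (x - 1)) = (\<lambda>x. 2 \<le> x \<and> P (x - 2))"
      by (intro ext) (auto simp: numeral_2_eq_2)
    finally show ?thesis .
  qed
  then show ?thesis by (metis le_antisym le_refl)
qed

lemma R_st_filter:
  assumes w: "w \<in> words n" "1 \<le> n" "set w = {1..k}"
    and convex: "\<And>u v w. P u \<Longrightarrow> P w \<Longrightarrow> u \<le> v \<Longrightarrow> v \<le> w \<Longrightarrow> P v" and Pk: "\<And>u. P u \<Longrightarrow> u < k - 1"
  shows "lis (filter (\<lambda>x. 2 \<le> x \<and> P (x - 2)) w) = lis (filter (\<lambda>x. P (x - 1)) (R_st w))"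
    and "lds (filter (\<lambda>x. 2 \<le> x \<and> P (x - 2)) w) = lds (filter (\<lambda>x. P (x - 1)) (R_st w))"
proof -
  obtain g h where g: "word_growth n k w g" "word_growth n k (R_st w) h"
    "slide (h 0) (\<lambda>j. g 0 (Suc j)) (k - 1)" and R: "R_st w \<in> words n" "set (R_st w) = {1..k}"
    using R_st_growths[OF w] by blast
  show "lis (filter (\<lambda>x. 2 \<le> x \<and> P (x - 2)) w) = lis (filter (\<lambda>x. P (x - 1)) (R_st w))"
    by (rule growths_lis_filter[OF w(2,1) _ g(1) R(1) _ g(2,3)], simp add: w, simp add: R, fact convex, fact Pk)
  have "lis (filter (\<lambda>x. 2 \<le> x \<and> P (x - 2)) (rev w)) = lis (filter (\<lambda>x. P (x - 1)) (rev (R_st w)))"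
    by (rule growths_lis_filter[OF w(2) rev_words[OF w(1)] _ word_growth_converse[OF g(1)]
          rev_words[OF R(1)] _ word_growth_converse[OF g(2)] slide_converse[OF g(3)]],
        simp add: w, simp add: R, fact convex, fact Pk)
  then show "lds (filter (\<lambda>x. 2 \<le> x \<and> P (x - 2)) w) = lds (filter (\<lambda>x. P (x - 1)) (R_st w))"
    unfolding lds_eq_lis_rev rev_filter .
qed

lemma R_st_cid:
  assumes w: "w \<in> words n" "1 \<le> n" "set w = {1..k}" shows "w \<sim>cid R_st w"
proof -
  obtain g h where g: "word_growth n k w g" "word_growth n k (R_st w) h"
    and right: "\<And>i. i \<le> n - 1 \<Longrightarrow> g i k = h i k" and R: "R_st w \<in> words n" "set (R_st w) = {1..k}"
    using R_st_growths[OF w] by blast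
  show ?thesis using growth_cid[OF w(1) _ g(1) R(1) _ g(2) right] w(3) R(2) by simp
qed

section \<open>Words with arbitrary letters\<close>

lemma letter_less:
  assumes "1 \<le> i" "i < j" "j \<le> card (set w)" shows "letter w i < letter w j"
proof -
  have "sorted_wrt (<) (sorted_list_of_set (set w))" by simp
  from sorted_wrt_nth_less[OF this, of "i - 1" "j - 1"] show ?thesis
    unfolding letter_def using assms by simp
qed

lemma letter_image: "letter w ` {1..card (set w)} = set w"
proof -
  have "letter w ` {1..card (set w)} = (!) (sorted_list_of_set (set w)) ` {0..<card (set w)}"
  proof -
    have "{0..<card (set w)} = (\<lambda>i. i - 1) ` {1..card (set w)}"
    proof (intro set_eqI iffI)
      fix x assume "x \<in> {0..<card (set w)}"
      then have "Suc x \<in> {1..card (set w)}" "x = Suc x - 1" by auto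
      then show "x \<in> (\<lambda>i. i - 1) ` {1..card (set w)}" by blast
    qed auto
    then show ?thesis unfolding letter_def by (simp add: image_image)
  qed
  also have "\<dots> = set (sorted_list_of_set (set w))" using nth_image[of "card (set w)" "sorted_list_of_set (set w)"]
    by (simp add: atLeast0LessThan)
  finally show ?thesis by simp
qed

lemma letter_eq_iff:
  assumes "i \<in> {1..card (set w)}" "j \<in> {1..card (set w)}" shows "letter w i = letter w j \<longleftrightarrow> i = j"
  using letter_less[of i j w] letter_less[of j i w] assms by (cases i j rule: linorder_cases) auto

lemma letter_le_iff:
  assumes "i \<in> {1..card (set w)}" "j \<in> {1..card (set w)}" shows "letter w i \<le> letter w j \<longleftrightarrow> i \<le> j"
  using letter_less[of i j w] letter_less[of j i w] assms by (cases i j rule: linorder_cases) auto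

lemma rank_letter:
  assumes i: "i \<in> {1..card (set w)}" shows "rank w (letter w i) = i"
proof -
  have "{y \<in> set w. y \<le> letter w i} = letter w ` {1..i}"
  proof (intro set_eqI iffI)
    fix y assume y: "y \<in> {y \<in> set w. y \<le> letter w i}"
    then obtain j where j: "j \<in> {1..card (set w)}" "y = letter w j" using letter_image[of w] by blast
    then have "j \<le> i" using letter_le_iff[OF j(1) i] y by simp
    then show "y \<in> letter w ` {1..i}" using j by auto
  next
    fix y assume "y \<in> letter w ` {1..i}"
    then obtain j where j: "j \<in> {1..i}" "y = letter w j" by blast
    then have "j \<in> {1..card (set w)}" using i by auto
    then show "y \<in> {y \<in> set w. y \<le> letter w i}"
      using j letter_le_iff[of j w i] i letter_image[of w] by auto
  qed
  moreover have "inj_on (letter w) {1..i}"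
    by (rule inj_onI) (use letter_eq_iff[of _ w] i in \<open>auto dest: order_trans\<close>)
  ultimately show ?thesis unfolding rank_def by (simp add: card_image)
qed

lemma letter_rank:
  assumes "x \<in> set w" shows "letter w (rank w x) = x" "rank w x \<in> {1..card (set w)}"
proof -
  obtain i where "i \<in> {1..card (set w)}" "x = letter w i" using assms letter_image[of w] by blast
  then show "letter w (rank w x) = x" "rank w x \<in> {1..card (set w)}" using rank_letter[of i w] by auto
qed

lemma set_st: "set (st w) = {1..card (set w)}"
proof
  show "set (st w) \<subseteq> {1..card (set w)}" unfolding st_def using letter_rank(2) by auto
  show "{1..card (set w)} \<subseteq> set (st w)"
  proof
    fix i assume i: "i \<in> {1..card (set w)}"
    then have "letter w i \<in> set w" using letter_image[of w] by blast
    then have "rank w (letter w i) \<in> set (st w)" unfolding st_def by simp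
    then show "i \<in> set (st w)" using rank_letter[OF i] by simp
  qed
qed

lemma map_letter_st: "map (letter w) (st w) = w"
  unfolding st_def using letter_rank(1) by (simp add: map_idI)

lemma st_words_st: "w \<in> words n \<Longrightarrow> st w \<in> words n"
  using set_st[of w] unfolding words_def st_def by auto

lemma lis_map:
  assumes "\<And>x y. x \<in> set w \<Longrightarrow> y \<in> set w \<Longrightarrow> x < y \<Longrightarrow> f x < f y"
  shows "lis (map f w) = lis w"
proof -
  have iff: "f x < f y \<longleftrightarrow> x < y" if "x \<in> set w" "y \<in> set w" for x y
    using assms[OF that] assms[OF that(2,1)] by (cases x y rule: linorder_cases) auto
  have "map f w ! p < map f w ! q \<longleftrightarrow> w ! p < w ! q" if "p < length w" "q < length w" for p q
    using iff[of "w ! p" "w ! q"] that by simp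
  then have "inc_positions (map f w) A \<longleftrightarrow> inc_positions w A" for A
    unfolding inc_positions_def length_map by blast
  then have "m \<le> lis (map f w) \<longleftrightarrow> m \<le> lis w" for m unfolding le_lis by simp
  then show ?thesis by (metis le_antisym le_refl)
qed

lemma lds_map:
  assumes "\<And>x y. x \<in> set w \<Longrightarrow> y \<in> set w \<Longrightarrow> x < y \<Longrightarrow> f x < f y"
  shows "lds (map f w) = lds w"
  unfolding lds_eq_lis_rev rev_map by (rule lis_map) (use assms in simp)

text \<open>The separate clause for length 1 agrees with the general formula: a word with one
  position is determined by its set of letters.\<close>

lemma R_eq:
  assumes w: "w \<in> words n" "1 \<le> n"
  shows "\<R> w = map (letter w) (R_st (st w))"
proof (cases "length w = 1")
  case True
  have R: "R_st (st w) \<in> words n" "set (R_st (st w)) = set (st w)"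
    using R_st_growths[OF st_words_st[OF w(1)] w(2) set_st] set_st[of w] by auto
  have "length (R_st (st w)) = 1" "length (st w) = 1" using R(1) True w(1) unfolding words_def st_def by auto
  then obtain x y where xy: "R_st (st w) = [x]" "st w = [y]" by (auto simp: length_Suc_conv)
  then have "R_st (st w) = st w" using R(2) by simp
  then show ?thesis using True map_letter_st[of w] unfolding \<R>_def by simp
qed (simp add: \<R>_def)

lemma set_R:
  assumes w: "w \<in> words n" "1 \<le> n" shows "set (\<R> w) = set w"
proof -
  have "set (R_st (st w)) = {1..card (set w)}"
    using R_st_growths[OF st_words_st[OF w(1)] w(2) set_st] by blast
  then show ?thesis unfolding R_eq[OF w] using letter_image[of w] by simp
qed

lemma R_words:
  assumes w: "w \<in> words n" "1 \<le> n" shows "\<R> w \<in> words n"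
proof -
  have "R_st (st w) \<in> words n"
    using R_st_growths[OF st_words_st[OF w(1)] w(2) set_st] by blast
  then have "length (\<R> w) = n" unfolding R_eq[OF w] words_def by simp
  then show ?thesis using set_R[OF w] w(1) unfolding words_def by simp
qed

lemma R_cid:
  assumes w: "w \<in> words n" "1 \<le> n" shows "w \<sim>cid \<R> w"
proof -
  let ?l = "letter w"
  have R: "set (R_st (st w)) = {1..card (set w)}"
    using R_st_growths[OF st_words_st[OF w(1)] w(2) set_st] by blast
  have cid: "st w \<sim>cid R_st (st w)" by (rule R_st_cid[OF st_words_st[OF w(1)] w(2) set_st])
  have mono: "letter w x < letter w y" if "x \<in> {1..card (set w)}" "y \<in> {1..card (set w)}" "x < y" for x y
    using letter_less that by simp
  have sub: "set (factor u a b) \<subseteq> set u" for u a b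
    unfolding factor_def by (meson set_drop_subset set_take_subset subset_trans)
  have inv: "lis (factor (map ?l u) a b) = lis (factor u a b)" "lds (factor (map ?l u) a b) = lds (factor u a b)"
    if u: "set u = {1..card (set w)}" for u a b
  proof -
    have "factor (map ?l u) a b = map ?l (factor u a b)" unfolding factor_def by (simp add: take_map drop_map)
    moreover have "lis (map ?l (factor u a b)) = lis (factor u a b)"
      by (rule lis_map) (use mono sub[of u a b] u in blast)
    moreover have "lds (map ?l (factor u a b)) = lds (factor u a b)"
      by (rule lds_map) (use mono sub[of u a b] u in blast)
    ultimately show "lis (factor (map ?l u) a b) = lis (factor u a b)"
      "lds (factor (map ?l u) a b) = lds (factor u a b)" by simp_all
  qed
  have "map ?l (st w) \<sim>cid map ?l (R_st (st w))"
    using cid unfolding cid_def inv[OF R] inv[OF set_st] length_map .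
  then show ?thesis unfolding map_letter_st R_eq[OF w] .
qed

text \<open>Both sides are images under the strictly increasing map \<open>letter w\<close>, which
  changes neither \<open>lis\<close> nor \<open>lds\<close>. An interval of integers pulls back to a
  convex set of indices, as the invariance under slides requires.\<close>

lemma R_rid:
  assumes w: "w \<in> words n" "1 \<le> n"
  shows "remove_min_shift w \<sim>rid removeAll (Max (set w)) (\<R> w)"
  unfolding rid_def
proof (intro allI)
  fix a b :: int
  define k where "k = card (set w)"
  define u where "u = st w"
  define u' where "u' = R_st u"
  let ?l = "letter w"
  have u: "set u = {1..k}" "u \<in> words n" unfolding u_def k_def using set_st st_words_st[OF w(1)] by auto
  have u': "set u' = {1..k}" unfolding u'_def using R_st_growths[OF u(2) w(2) u(1)] by blast
  have wu: "w = map ?l u" unfolding u_def using map_letter_st by simp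
  have Rw: "\<R> w = map ?l u'" unfolding u'_def u_def by (rule R_eq[OF w])
  have "set w \<noteq> {}" using w unfolding words_def by auto
  then have k: "1 \<le> k" unfolding k_def by (simp add: Suc_le_eq card_gt_0_iff)
  have eq: "?l i = ?l j \<longleftrightarrow> i = j" and le: "?l i \<le> ?l j \<longleftrightarrow> i \<le> j" and less: "i < j \<Longrightarrow> ?l i < ?l j"
    if "i \<in> {1..k}" "j \<in> {1..k}" for i j
    using letter_eq_iff letter_le_iff letter_less that unfolding k_def by auto
  have img: "set w = ?l ` {1..k}" unfolding k_def using letter_image by simp
  have min: "Min (set w) = ?l 1" unfolding img by (rule Min_eqI) (use le k in auto)
  have max: "Max (set w) = ?l k" unfolding img by (rule Max_eqI) (use le k in auto)
  have "removeAll (?l 1) (map ?l u) = map ?l (filter (\<lambda>x. x \<noteq> 1) u)"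
    unfolding removeAll_filter_not_eq filter_map comp_def
    by (rule arg_cong[where f = "map _"], rule filter_cong) (use eq[of 1] u k in auto)
  then have rem: "removeAll (Min (set w)) w = map ?l (filter (\<lambda>x. x \<noteq> 1) u)" using min wu by simp
  have left: "restrict_letters a b (remove_min_shift w) =
      map (\<lambda>i. ?l (i - 1)) (filter (\<lambda>x. 2 \<le> x \<and> (x - 2 < k - 1 \<and> int (?l (x - 2 + 1)) \<in> {a..b})) u)"
  proof -
    have "remove_min_shift w = map (\<lambda>i. ?l (i - 1)) (filter (\<lambda>x. x \<noteq> 1) u)"
      unfolding remove_min_shift_def rem map_map comp_def
      by (rule map_cong[OF refl]) (use rank_letter[of _ w] u k_def in auto)
    then have "restrict_letters a b (remove_min_shift w) =
        map (\<lambda>i. ?l (i - 1)) (filter (\<lambda>x. x \<noteq> 1 \<and> int (?l (x - 1)) \<in> {a..b}) u)"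
      unfolding restrict_letters_def by (simp add: filter_map comp_def conj_commute)
    also have "filter (\<lambda>x. x \<noteq> 1 \<and> int (?l (x - 1)) \<in> {a..b}) u =
        filter (\<lambda>x. 2 \<le> x \<and> (x - 2 < k - 1 \<and> int (?l (x - 2 + 1)) \<in> {a..b})) u"
    proof (rule filter_cong[OF refl])
      fix x assume x: "x \<in> set u"
      show "x \<noteq> 1 \<and> int (?l (x - 1)) \<in> {a..b} \<longleftrightarrow>
        2 \<le> x \<and> (x - 2 < k - 1 \<and> int (?l (x - 2 + 1)) \<in> {a..b})"
      proof (cases "x = 1")
        case False
        have "1 \<le> x" "x \<le> k" using x u by auto
        then have e: "2 \<le> x" "x - 2 + 1 = x - 1" "x - 2 < k - 1" using False by auto
        show ?thesis unfolding e(2) using False e(1,3) by blast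
      qed simp
    qed
    finally show ?thesis .
  qed
  have right: "restrict_letters a b (removeAll (Max (set w)) (\<R> w)) =
      map ?l (filter (\<lambda>x. x - 1 < k - 1 \<and> int (?l (x - 1 + 1)) \<in> {a..b}) u')"
  proof -
    have "?l x \<noteq> ?l k \<and> int (?l x) \<in> {a..b} \<longleftrightarrow> x - 1 < k - 1 \<and> int (?l (x - 1 + 1)) \<in> {a..b}"
      if "x \<in> set u'" for x
    proof -
      have x: "1 \<le> x" "x \<le> k" using that u' by auto
      then have e: "x - 1 + 1 = x" "x \<noteq> k \<longleftrightarrow> x - 1 < k - 1" by auto
      have "?l x = ?l k \<longleftrightarrow> x = k" by (rule eq) (use x k in auto)
      then show ?thesis unfolding e(1) using e(2) by blast
    qed
    then have "filter (\<lambda>x. ?l x \<noteq> ?l k \<and> int (?l x) \<in> {a..b}) u' =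
        filter (\<lambda>x. x - 1 < k - 1 \<and> int (?l (x - 1 + 1)) \<in> {a..b}) u'"
      by (rule filter_cong[OF refl])
    moreover have "restrict_letters a b (removeAll (Max (set w)) (\<R> w)) =
        map ?l (filter (\<lambda>x. ?l x \<noteq> ?l k \<and> int (?l x) \<in> {a..b}) u')"
      unfolding restrict_letters_def max Rw removeAll_filter_not_eq filter_map filter_filter comp_def
      by (rule arg_cong[where f = "map _"], rule filter_cong) auto
    ultimately show ?thesis by simp
  qed
  \<comment> \<open>Index \<open>i\<close> stands for the letter \<open>?l (i + 1)\<close>. On the
    left it is the shifted letter of rank \<open>i + 2\<close>, on the right the letter of rank
    \<open>i + 1\<close>; \<open>i < k - 1\<close> expresses the removal of the largest one.\<close>
  let ?P = "\<lambda>i. i < k - 1 \<and> int (?l (i + 1)) \<in> {a..b}"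
  have convex: "?P v" if "?P x" "?P z" "x \<le> v" "v \<le> z" for x v z
  proof -
    have "x + 1 \<in> {1..k}" "v + 1 \<in> {1..k}" "z + 1 \<in> {1..k}" using that by auto
    then have "?l (x + 1) \<le> ?l (v + 1)" "?l (v + 1) \<le> ?l (z + 1)" using le that(3,4) by simp_all
    then have "int (?l (v + 1)) \<in> {a..b}" using that(1,2) by auto
    then show ?thesis using that by simp
  qed
  have Pk: "i < k - 1" if "?P i" for i using that by blast
  have left_map: "?l (x - 1) < ?l (y - 1)"
    if "x \<in> set (filter (\<lambda>x. 2 \<le> x \<and> ?P (x - 2)) u)" "y \<in> set (filter (\<lambda>x. 2 \<le> x \<and> ?P (x - 2)) u)" "x < y" for x y
  proof -
    have "2 \<le> x" "y \<le> k" using that(1,2) u(1) by auto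
    then have "x - 1 \<in> {1..k}" "y - 1 \<in> {1..k}" "x - 1 < y - 1" using that(3) by auto
    then show ?thesis by (rule less)
  qed
  have right_map: "?l x < ?l y"
    if "x \<in> set (filter (\<lambda>x. ?P (x - 1)) u')" "y \<in> set (filter (\<lambda>x. ?P (x - 1)) u')" "x < y" for x y
    by (rule less) (use that u' in auto)
  let ?X = "filter (\<lambda>x. 2 \<le> x \<and> ?P (x - 2)) u" and ?Y = "filter (\<lambda>x. ?P (x - 1)) u'"
  have lis: "lis ?X = lis ?Y"
    unfolding u'_def by (rule R_st_filter(1)[OF u(2) w(2) u(1), where P = ?P]; fact convex Pk)
  have lds: "lds ?X = lds ?Y"
    unfolding u'_def by (rule R_st_filter(2)[OF u(2) w(2) u(1), where P = ?P]; fact convex Pk)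
  have X: "lis (map (\<lambda>i. ?l (i - 1)) ?X) = lis ?X" by (rule lis_map) (fact left_map)
  have X': "lds (map (\<lambda>i. ?l (i - 1)) ?X) = lds ?X" by (rule lds_map) (fact left_map)
  have Y: "lis (map ?l ?Y) = lis ?Y" by (rule lis_map) (fact right_map)
  have Y': "lds (map ?l ?Y) = lds ?Y" by (rule lds_map) (fact right_map)
  show "lis (restrict_letters a b (remove_min_shift w)) = lis (restrict_letters a b (removeAll (Max (set w)) (\<R> w))) \<and>
      lds (restrict_letters a b (remove_min_shift w)) = lds (restrict_letters a b (removeAll (Max (set w)) (\<R> w)))"
    unfolding left right X X' Y Y' by (rule conjI[OF lis lds])
qed

text \<open>As \<open>\<R>\<close> preserves the set of letters, words with equal images are
  standardised by the same relabelling, and \<open>R_st_inject\<close> applies.\<close>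

lemma inj_R:
  assumes n: "1 \<le> n" shows "inj_on \<R> (words n)"
proof (rule inj_onI)
  fix w w' assume w: "w \<in> words n" and w': "w' \<in> words n" and eq: "\<R> w = \<R> w'"
  have s: "set w = set w'" using set_R[OF w n] set_R[OF w' n] eq by simp
  have l: "letter w' = letter w" unfolding letter_def s by simp
  let ?A = "{1..card (set w)}"
  have R: "set (R_st (st w)) = ?A" "set (R_st (st w')) = ?A"
    using R_st_growths[OF st_words_st[OF w] n set_st] R_st_growths[OF st_words_st[OF w'] n set_st] s by auto
  have "inj_on (letter w) (set (R_st (st w)) \<union> set (R_st (st w')))"
    unfolding R Un_absorb by (rule inj_onI) (use letter_eq_iff in blast)
  moreover have "map (letter w) (R_st (st w)) = map (letter w) (R_st (st w'))"
    using eq unfolding R_eq[OF w n] R_eq[OF w' n] l .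
  ultimately have "R_st (st w) = R_st (st w')" by (rule map_inj_on[rotated])
  then have "st w = st w'"
    using R_st_inject[OF n st_words_st[OF w] set_st st_words_st[OF w']] set_st[of w'] s by simp
  then show "w = w'" using map_letter_st[of w] map_letter_st[of w'] l by simp
qed

theorem theorem3p1:
  fixes n :: nat
  assumes "n \<ge> 1"
  shows "bij_betw \<R> (words n) (words n) \<and>
    (\<forall>w \<in> words n.
       w \<sim>cid \<R> w \<and>
       remove_min_shift w \<sim>rid removeAll (Max (set w)) (\<R> w) \<and>
       set (\<R> w) = set w)"
proof (intro conjI ballI)
  show "bij_betw \<R> (words n) (words n)"
    unfolding bij_betw_def
  proof (intro conjI subset_antisym)
    show inj: "inj_on \<R> (words n)" by (rule inj_R[OF assms])
    show "\<R> ` words n \<subseteq> words n" using R_words assms by blast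
    show "words n \<subseteq> \<R> ` words n"
    proof
      fix w assume w: "w \<in> words n"
      let ?X = "{u \<in> words n. set u = set w}"
      have "?X \<subseteq> {u. set u \<subseteq> set w \<and> length u = n}" unfolding words_def by auto
      then have "finite ?X" using finite_lists_length_eq[of "set w" n] finite_subset by blast
      moreover have "\<R> ` ?X \<subseteq> ?X" using R_words[OF _ assms] set_R[OF _ assms] by auto
      moreover have "inj_on \<R> ?X" by (rule inj_on_subset[OF inj]) blast
      ultimately have "\<R> ` ?X = ?X" by (rule endo_inj_surj)
      then show "w \<in> \<R> ` words n" using w by blast
    qed
  qed
qed (use assms R_cid R_rid set_R in blast)+

end
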